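(* Let $X_n$ be the number of queries used by a chordal AC algorithm on a partition of an $n$-element set chosen uniformly at random. Its probability generating function $\mathbb{E}(q^{X_n})$ equals both \[ \frac{1}{B_n}\left(\frac{q}{1-q}\right)^n\sum_{k=0}^n\binom{n}{k}(-1)^k\left(\frac{1-q}{q};q\right)_k \qquad\text{and}\qquad \frac{1}{B_n}\,\frac{1}{e_q(1/q)}\sum_{m\ge 0}\frac{[m]_q^n}{[m]_q!}\,q^{n-m}. \] Moreover, $(X_n-E_n)/\sigma_n$ converges in distribution to a standard Gaussian law, where \[ E_n=\frac14\bigl(2W(n)-1\bigr)e^{2W(n)},\qquad \sigma_n=\frac13\sqrt{\frac{3W(n)^2-4W(n)+2}{W(n)+1}\,e^{3W(n)}}. \]
   Context: AC algorithms: $S$ is a finite set with an unknown set partition; an AC algorithm adaptively asks an oracle whether two items are in the same block. Aggregated graphs: $G_0$ is the edgeless graph on $S$; each query concerns two distinct non-adjacent vertices $x,y$ of the current aggregated graph; a negative answer adds edge $xy$, a positive answer merges $x,y$ into one vertex adjacent to all their neighbours. The algorithm stops when the aggregated graph is complete. An AC algorithm is chordal if for every input partition every aggregated graph is chordal (all induced cycles have length $3$). Notation: $B_n$ is the $n$-th Bell number (number of set partitions of an $n$-set); $[n]_q=\sum_{k=0}^{n-1}q^k$, $[n]_q!=\prod_{k=1}^n[k]_q$, $(a;q)_n=\prod_{k=0}^{n-1}(1-aq^k)$, $e_q(z)=\sum_{n\ge0}z^n/[n]_q!$; $W(x)$ is the Lambert function, the unique solution $w$ of $we^w=x$ for $x>0$.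 *)

theory Defs
  imports "HOL-Probability.Probability" "HOL-Library.Disjoint_Sets"
begin

section \<open>Aggregated graphs\<close>

text \<open>Simple undirected graphs: a vertex set and a set of two-element edges.\<close>

type_synonym 'v graph = "'v set \<times> 'v set set"

definition adjacent :: "'v graph \<Rightarrow> 'v \<Rightarrow> 'v \<Rightarrow> bool" where
  "adjacent G x y \<longleftrightarrow> {x, y} \<in> snd G"

definition complete_graph :: "'v graph \<Rightarrow> bool" where
  "complete_graph G \<longleftrightarrow> (\<forall>x\<in>fst G. \<forall>y\<in>fst G. x \<noteq> y \<longrightarrow> adjacent G x y)"

definition induced_cycle :: "'v graph \<Rightarrow> 'v list \<Rightarrow> bool" where
  "induced_cycle G c \<longleftrightarrow>
     length c \<ge> 3 \<and> distinct c \<and> set c \<subseteq> fst G \<and>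
     (\<forall>i j. i < j \<and> j < length c \<longrightarrow>
        (adjacent G (c ! i) (c ! j) \<longleftrightarrow> j = i + 1 \<or> (i = 0 \<and> j = length c - 1)))"

definition chordal :: "'v graph \<Rightarrow> bool" where
  "chordal G \<longleftrightarrow> (\<forall>c. induced_cycle G c \<longrightarrow> length c = 3)"

text \<open>A vertex of an aggregated graph is the set of those items that have been merged into it.\<close>

definition initial_graph :: "'a set \<Rightarrow> 'a set graph" where
  "initial_graph S = ((\<lambda>s. {s}) ` S, {})"

definition add_edge :: "'v \<Rightarrow> 'v \<Rightarrow> 'v graph \<Rightarrow> 'v graph" where
  "add_edge x y G = (fst G, insert {x, y} (snd G))"

definition merge_vertices :: "'a set \<Rightarrow> 'a set \<Rightarrow> 'a set graph \<Rightarrow> 'a set graph" where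
  "merge_vertices x y G =
     (let r = (\<lambda>v. if v = x \<or> v = y then x \<union> y else v)
      in (r ` fst G, (\<lambda>e. r ` e) ` snd G))"

section \<open>Active clustering algorithms\<close>

text \<open>
  An algorithm is a decision tree: \<open>Query x y N P\<close> asks whether the items in \<open>x\<close> and those
  in \<open>y\<close> lie in the same block, and continues with \<open>N\<close> after a negative and with \<open>P\<close> after
  a positive answer. The next query may thus depend on all previous queries and answers.
\<close>

datatype 'a ac_tree = Stop | Query "'a set" "'a set" "'a ac_tree" "'a ac_tree"

primrec ac_valid :: "'a set graph \<Rightarrow> 'a ac_tree \<Rightarrow> bool" where
  "ac_valid G Stop \<longleftrightarrow> complete_graph G"
| "ac_valid G (Query x y N P) \<longleftrightarrow>
     x \<in> fst G \<and> y \<in> fst G \<and> x \<noteq> y \<and> \<not> adjacent G x y \<and>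
     ac_valid (add_edge x y G) N \<and> ac_valid (merge_vertices x y G) P"

definition ac_algorithm :: "'a set \<Rightarrow> 'a ac_tree \<Rightarrow> bool" where
  "ac_algorithm S A \<longleftrightarrow> ac_valid (initial_graph S) A"

definition same_block :: "'a set set \<Rightarrow> 'a set \<Rightarrow> 'a set \<Rightarrow> bool" where
  "same_block \<pi> x y \<longleftrightarrow> (\<exists>B\<in>\<pi>. x \<union> y \<subseteq> B)"

text \<open>The aggregated graphs met when running an algorithm from \<open>G\<close> on the input partition \<open>\<pi>\<close>.\<close>

primrec aggregated_graphs :: "'a set set \<Rightarrow> 'a set graph \<Rightarrow> 'a ac_tree \<Rightarrow> 'a set graph list" where
  "aggregated_graphs \<pi> G Stop = [G]"
| "aggregated_graphs \<pi> G (Query x y N P) =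
     G # (if same_block \<pi> x y then aggregated_graphs \<pi> (merge_vertices x y G) P
          else aggregated_graphs \<pi> (add_edge x y G) N)"

primrec num_queries :: "'a ac_tree \<Rightarrow> 'a set set \<Rightarrow> nat" where
  "num_queries Stop \<pi> = 0"
| "num_queries (Query x y N P) \<pi> =
     Suc (if same_block \<pi> x y then num_queries P \<pi> else num_queries N \<pi>)"

definition chordal_ac_algorithm :: "'a set \<Rightarrow> 'a ac_tree \<Rightarrow> bool" where
  "chordal_ac_algorithm S A \<longleftrightarrow>
     ac_algorithm S A \<and>
     (\<forall>\<pi>. partition_on S \<pi> \<longrightarrow>
        (\<forall>G\<in>set (aggregated_graphs \<pi> (initial_graph S) A). chordal G))"

definition random_partition :: "'a set \<Rightarrow> 'a set set pmf" where
  "random_partition S = pmf_of_set {\<pi>. partition_on S \<pi>}"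

section \<open>Combinatorial and analytic functions\<close>

definition bell :: "nat \<Rightarrow> nat" where
  "bell n = card {\<pi>. partition_on {..<n} \<pi>}"

definition q_int :: "'a::comm_ring_1 \<Rightarrow> nat \<Rightarrow> 'a" where
  "q_int q n = (\<Sum>k<n. q ^ k)"

definition q_fact :: "'a::comm_ring_1 \<Rightarrow> nat \<Rightarrow> 'a" where
  "q_fact q n = (\<Prod>k=1..n. q_int q k)"

definition q_pochhammer :: "'a::comm_ring_1 \<Rightarrow> 'a \<Rightarrow> nat \<Rightarrow> 'a" where
  "q_pochhammer a q n = (\<Prod>k<n. 1 - a * q ^ k)"

definition q_exp :: "complex \<Rightarrow> complex \<Rightarrow> complex" where
  "q_exp q z = (\<Sum>n. z ^ n / q_fact q n)"

text \<open>
  The complex numbers \<open>q\<close> for which all terms of the series defining \<open>q_exp q (1 / q)\<close> are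
  defined, the series converges, and its sum may be divided by.
\<close>

definition q_exp_admissible :: "complex \<Rightarrow> bool" where
  "q_exp_admissible q \<longleftrightarrow>
     q \<noteq> 0 \<and> (\<forall>m\<ge>1. q_int q m \<noteq> 0) \<and>
     summable (\<lambda>m. (1 / q) ^ m / q_fact q m) \<and> q_exp q (1 / q) \<noteq> 0"

text \<open>In particular this covers all real \<open>q > 1/2\<close>, including \<open>q = 1\<close>.\<close>

lemma q_exp_admissible_real:
  assumes r: "r > 1/2"
  shows "q_exp_admissible (complex_of_real r)"
proof -
  have r0: "r > 0" using r by simp
  have qi: "q_int (complex_of_real r) m = of_real (q_int r m)" for m
    by (simp add: q_int_def)
  have qf: "q_fact (complex_of_real r) m = of_real (q_fact r m)" for m
    by (simp add: q_fact_def qi)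
  have ipos: "q_int r m > 0" if "m \<ge> 1" for m
    unfolding q_int_def using r0 that by (intro sum_pos) (auto simp: lessThan_empty_iff)
  have fpos: "q_fact r m > 0" for m
    unfolding q_fact_def by (intro prod_pos) (auto intro: ipos)
  define a where "a m = (1 / r) ^ m / q_fact r m" for m
  have apos: "a m > 0" for m
    using r0 fpos by (simp add: a_def)
  have aS: "a (Suc m) = a m / (r * q_int r (Suc m))" for m
    by (simp add: a_def q_fact_def)
  have mono: "q_int r M \<le> q_int r m" if "M \<le> m" for M m
    unfolding q_int_def using r0 that by (intro sum_mono2) auto
  have "\<exists>M. r * q_int r M > 1"
  proof (cases "r < 1")
    case True
    have "(\<lambda>n. q_int r n) \<longlonglongrightarrow> 1 / (1 - r)"
      using geometric_sums[of r] True r0 by (simp add: sums_def q_int_def)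
    then have "(\<lambda>n. r * q_int r n) \<longlonglongrightarrow> r * (1 / (1 - r))"
      by (intro tendsto_intros)
    moreover have "1 < r * (1 / (1 - r))"
      using r True by (simp add: field_simps)
    ultimately have "eventually (\<lambda>n. r * q_int r n > 1) sequentially"
      by (rule order_tendstoD)
    then show ?thesis
      using eventually_happens sequentially_bot by blast
  next
    case False
    then have "r * r \<ge> 1"
      using mult_mono[of 1 r 1 r] by simp
    then have "r * q_int r 2 > 1"
      using r0 by (simp add: q_int_def numeral_2_eq_2 algebra_simps)
    then show ?thesis by blast
  qed
  then obtain M where M: "r * q_int r M > 1" by blast
  have "summable a"
  proof (rule summable_ratio_test[where c = "1 / (r * q_int r M)" and N = M])
    show "1 / (r * q_int r M) < 1" using M by simp
  next
    fix m assume "M \<le> m"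
    then have le: "r * q_int r M \<le> r * q_int r (Suc m)"
      using mono[of M "Suc m"] r0 by simp
    have "a (Suc m) \<le> a m / (r * q_int r M)"
      unfolding aS using le M apos[of m]
      by (smt (verit) divide_left_mono mult_pos_pos)
    then show "norm (a (Suc m)) \<le> 1 / (r * q_int r M) * norm (a m)"
      using apos[of m] apos[of "Suc m"] by simp
  qed
  have eq: "(1 / complex_of_real r) ^ m / q_fact (complex_of_real r) m = of_real (a m)" for m
    by (simp add: a_def qf)
  have "suminf a > 0"
    using \<open>summable a\<close> apos by (rule suminf_pos)
  moreover have "q_exp (of_real r) (1 / of_real r) = of_real (suminf a)"
    unfolding q_exp_def eq using \<open>summable a\<close> by (simp add: suminf_of_real)
  ultimately show ?thesis
    unfolding q_exp_admissible_def eq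
    using r0 ipos \<open>summable a\<close> by (auto simp: qi summable_of_real less_imp_neq[symmetric])
qed

definition lambert_W :: "real \<Rightarrow> real" where
  "lambert_W x = (THE w. w * exp w = x)"

definition E_asymp :: "nat \<Rightarrow> real" where
  "E_asymp n = 1/4 * (2 * lambert_W n - 1) * exp (2 * lambert_W n)"

definition sigma_asymp :: "nat \<Rightarrow> real" where
  "sigma_asymp n =
     1/3 * sqrt ((3 * (lambert_W n)\<^sup>2 - 4 * lambert_W n + 2) / (lambert_W n + 1)
                 * exp (3 * lambert_W n))"

end

theory Submission
  imports Defs "HOL-Complex_Analysis.Complex_Analysis" "HOL-Real_Asymp.Real_Asymp"
begin

text \<open>
  Let \<open>z\<close> mark the size of a clique. If the two queried vertices have \<open>d\<close> common neighbours,
  then these form a clique by chordality, and the clique polynomial of the aggregated graph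
  increases by \<open>z\<^sup>2 (1 + z)\<^sup>d\<close> after a negative and decreases by \<open>z (1 + z)\<^sup>d\<close> after a positive answer. Hence
  \<open>1 + z \<Sum>d\<in>D. (1 + z)\<^sup>d\<close> is the clique polynomial of every aggregated graph for some multiset \<open>D\<close>,
  and the generating function of the remaining queries is \<open>L (\<Prod>d\<in>D. q [m - d]\<^sub>q)\<close> for any linear
  functional \<open>L\<close> that maps \<open>\<Prod>d<k. q [m - d]\<^sub>q\<close> to 1 for all \<open>k\<close>: this is preserved because
  \<open>[m - d]\<^sub>q = q [m - d - 1]\<^sub>q + 1\<close>. At the edgeless graph, \<open>D\<close> consists of \<open>n\<close> zeros. Two such
  functionals, one given by \<open>(q\<^sup>m)\<^sup>k \<mapsto> ((1 - q) / q; q)\<^sub>k\<close> and one by the weights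
  \<open>q\<^sup>-\<^sup>m / [m]\<^sub>q!\<close>, give the two formulas.

  For the limit law, put \<open>q = exp (t / \<sigma>\<^sub>n)\<close> with real \<open>t\<close> in the second formula. The logarithms of
  the ratios of consecutive terms decrease, and near the mode \<open>exp W(n)\<close> they are almost linear, so
  that the sum is asymptotically Gaussian by dominated convergence. The quotient by the sum for
  \<open>q = 1\<close> shows that the moment generating functions converge to \<open>exp (t\<^sup>2 / 2)\<close> for all real \<open>t\<close>.
  By Montel's theorem and the identity theorem they also converge on the imaginary axis, and
  Levy's continuity theorem applies.
\<close>

section \<open>Clique polynomials of aggregated graphs\<close>

text \<open>The sum of the weights over all inputs below a graph depends on that graph only through
  \<open>D\<close>, and \<open>D\<close> is determined by the graph; hence all chordal algorithms
  have the same query distribution. The merge step needs the chordality of the graph that a negative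
  answer to the same query would produce. Some input always reaches that graph, for instance the
  partition into the current vertices.

  In the limit law the same centre exp W(n), adapted to q = 1, serves for all t. The tilt by q = exp
  \<delta> then has two effects, which split the exponent as t^2 / 2 = 3 t^2 / 8 + t^2 / 8. It
  raises the log ratios by \<beta> / \<open>spread n\<close> with \<beta> = t sqrt 3 / 2, which
  contributes exp (\<beta>^2 / 2). It also multiplies the term at the fixed mode by exp (\<delta> *
  \<open>E_asymp n\<close>) times a factor tending to exp (t^2 / 8), so that
  \<open>E_asymp n\<close> appears as the leading coefficient of \<delta> in the logarithm of that
  term.\<close>

definition is_clique :: "'v graph \<Rightarrow> 'v set \<Rightarrow> bool" where
  "is_clique G K \<longleftrightarrow> K \<subseteq> fst G \<and> (\<forall>u\<in>K. \<forall>v\<in>K. u \<noteq> v \<longrightarrow> adjacent G u v)"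

definition wf_graph :: "'v graph \<Rightarrow> bool" where
  "wf_graph G \<longleftrightarrow> finite (fst G) \<and> (\<forall>e\<in>snd G. \<exists>u v. e = {u, v} \<and> u \<in> fst G \<and> v \<in> fst G \<and> u \<noteq> v)"

definition common_nbrs :: "'v graph \<Rightarrow> 'v \<Rightarrow> 'v \<Rightarrow> 'v set" where
  "common_nbrs G x y = {v. adjacent G x v \<and> adjacent G y v}"

text \<open>The indeterminate is \<open>u = 1 + z\<close>, where \<open>z\<close> marks the size of a clique.\<close>

definition clique_poly :: "'v graph \<Rightarrow> int poly" where
  "clique_poly G = (\<Sum>K | is_clique G K. [:-1, 1:] ^ card K)"

lemma adjacent_sym: "adjacent G x y \<longleftrightarrow> adjacent G y x"
  by (simp add: adjacent_def insert_commute)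

lemma adjacent_wf:
  assumes "wf_graph G" "adjacent G x y"
  shows "x \<in> fst G" "y \<in> fst G" "x \<noteq> y"
proof -
  obtain u v where "{x, y} = {u, v}" "u \<in> fst G" "v \<in> fst G" "u \<noteq> v"
    using assms unfolding wf_graph_def adjacent_def by blast
  then show "x \<in> fst G" "y \<in> fst G" "x \<noteq> y"
    by (auto simp: doubleton_eq_iff)
qed

lemma adjacent_irrefl: "wf_graph G \<Longrightarrow> \<not> adjacent G x x"
  by (metis adjacent_wf(3))

lemma wf_graph_edgeE:
  assumes "wf_graph G" "e \<in> snd G"
  obtains u v where "e = {u, v}" "u \<in> fst G" "v \<in> fst G" "u \<noteq> v"
  using assms unfolding wf_graph_def by metis

lemma finite_cliques: "wf_graph G \<Longrightarrow> finite {K. is_clique G K}"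
  by (rule finite_subset[of _ "Pow (fst G)"]) (auto simp: is_clique_def wf_graph_def)

lemma sum_Pow_power_card:
  fixes z :: "'b::comm_semiring_1"
  assumes "finite A"
  shows "(\<Sum>K\<in>Pow A. z ^ card K) = (1 + z) ^ card A"
  using assms
proof (induction rule: finite_induct)
  case (insert a A)
  have fin: "finite K" "a \<notin> K" if "K \<in> Pow A" for K
    using that insert.hyps finite_subset by auto
  have inj: "inj_on (insert a) (Pow A)"
    using insert.hyps by (intro inj_onI) (metis PowD insert_ident subsetD)
  have "(\<Sum>K\<in>insert a ` Pow A. z ^ card K) = (\<Sum>K\<in>Pow A. z * z ^ card K)"
    unfolding sum.reindex[OF inj] o_def by (intro sum.cong refl) (simp add: fin)
  also have "\<dots> = z * (1 + z) ^ card A"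
    by (simp only: sum_distrib_left[symmetric] insert.IH)
  finally have "(\<Sum>K\<in>insert a ` Pow A. z ^ card K) = z * (1 + z) ^ card A" .
  moreover have "Pow A \<inter> insert a ` Pow A = {}"
    using insert.hyps by auto
  ultimately have "(\<Sum>K\<in>Pow (insert a A). z ^ card K) = (1 + z) ^ card A + z * (1 + z) ^ card A"
    unfolding Pow_insert using insert.hyps insert.IH by (subst sum.union_disjoint) simp_all
  then show ?case
    using insert.hyps by (simp add: algebra_simps)
qed auto

text \<open>Chordality is applied in this form. The two relevant cycles are x u y v, with common
  neighbours u, v of a queried pair x, y, and x u v y in the graph with the edge xy added.\<close>

lemma chordal_no_4_cycle:
  assumes "wf_graph G" "chordal G"
    and "adjacent G a b" "adjacent G b c" "adjacent G c d" "adjacent G a d" "a \<noteq> c" "b \<noteq> d"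
  shows "adjacent G a c \<or> adjacent G b d"
proof (rule ccontr)
  assume n: "\<not> ?thesis"
  have 1: "distinct [a, b, c, d]" and 2: "set [a, b, c, d] \<subseteq> fst G"
    using assms adjacent_wf[OF assms(1)] by auto
  have len: "length [a, b, c, d] = 4" by simp
  have "\<forall>i j. i < j \<and> j < 4 \<longrightarrow>
      (adjacent G ([a, b, c, d] ! i) ([a, b, c, d] ! j) \<longleftrightarrow> j = i + 1 \<or> (i = 0 \<and> j = 4 - 1))"
  proof (intro allI impI)
    fix i j :: nat assume ij: "i < j \<and> j < 4"
    then have "i \<in> {0, 1, 2}" "j \<in> {1, 2, 3}" by auto
    then consider "i = 0" "j = 1" | "i = 0" "j = 2" | "i = 0" "j = 3" | "i = 1" "j = 2" | "i = 1" "j = 3" | "i = 2" "j = 3"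
      using ij by auto
    then show "adjacent G ([a, b, c, d] ! i) ([a, b, c, d] ! j) \<longleftrightarrow> j = i + 1 \<or> (i = 0 \<and> j = 4 - 1)"
      using assms(3-6) n by cases simp_all
  qed
  then have "induced_cycle G [a, b, c, d]"
    unfolding induced_cycle_def len using 1 2 by (intro conjI) (simp, assumption+)
  then show False using assms(2) by (auto simp: chordal_def)
qed

lemma common_nbrs_clique:
  assumes "wf_graph G" "chordal G" "x \<noteq> y" "\<not> adjacent G x y"
  shows "is_clique G (common_nbrs G x y)"
proof -
  have "adjacent G u v" if "u \<in> common_nbrs G x y" "v \<in> common_nbrs G x y" "u \<noteq> v" for u v
    using chordal_no_4_cycle[OF assms(1,2), of x u y v] that assms adjacent_sym[of G u y]
    by (auto simp: common_nbrs_def)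
  moreover have "common_nbrs G x y \<subseteq> fst G"
    using adjacent_wf[OF assms(1)] by (auto simp: common_nbrs_def)
  ultimately show ?thesis by (auto simp: is_clique_def)
qed

section \<open>Effect of a negative answer\<close>

lemma wf_add_edge:
  "wf_graph G \<Longrightarrow> x \<in> fst G \<Longrightarrow> y \<in> fst G \<Longrightarrow> x \<noteq> y \<Longrightarrow> wf_graph (add_edge x y G)"
  by (auto simp: wf_graph_def add_edge_def)

lemma adjacent_add_edge: "adjacent (add_edge x y G) u v \<longleftrightarrow> {u, v} = {x, y} \<or> adjacent G u v"
  by (simp add: adjacent_def add_edge_def)

text \<open>The new cliques contain both x and y, and the rest can be any subset of the common
  neighbours \<open>N\<close>, since \<open>N\<close> is a clique. The gain is z^2 times the
  binomial sum (1 + z)^d, and 1 + z is the indeterminate.\<close>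

lemma clique_poly_add_edge:
  assumes "wf_graph G" "chordal G" "x \<in> fst G" "y \<in> fst G" "x \<noteq> y" "\<not> adjacent G x y"
  shows "clique_poly (add_edge x y G) =
           clique_poly G + [:-1, 1:] ^ 2 * monom 1 (card (common_nbrs G x y))"
proof -
  define N where "N = common_nbrs G x y"
  have N: "is_clique G N" unfolding N_def by (rule common_nbrs_clique) fact+
  have fN: "finite N" using N assms(1) by (auto simp: is_clique_def wf_graph_def intro: finite_subset)
  have xyN: "x \<notin> N" "y \<notin> N"
    using adjacent_irrefl[OF assms(1)] by (auto simp: N_def common_nbrs_def)
  define f where "f = (\<lambda>K. insert x (insert y K))"
  have eq: "{K. is_clique (add_edge x y G) K} = {K. is_clique G K} \<union> f ` Pow N"
  proof (intro equalityI subsetI)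
    fix K assume K: "K \<in> {K. is_clique (add_edge x y G) K}"
    show "K \<in> {K. is_clique G K} \<union> f ` Pow N"
    proof (cases "x \<in> K \<and> y \<in> K")
      case True
      have "K - {x, y} \<subseteq> N"
        using K True assms by (auto simp: is_clique_def adjacent_add_edge N_def common_nbrs_def doubleton_eq_iff)
      moreover have "K = f (K - {x, y})" using True by (auto simp: f_def)
      ultimately show ?thesis by blast
    next
      case False
      then show ?thesis
        using K unfolding is_clique_def adjacent_add_edge by (auto simp: doubleton_eq_iff add_edge_def)
    qed
  next
    fix K assume "K \<in> {K. is_clique G K} \<union> f ` Pow N"
    then show "K \<in> {K. is_clique (add_edge x y G) K}"
    proof
      assume "K \<in> {K. is_clique G K}" then show ?thesis
        unfolding is_clique_def adjacent_add_edge by (simp add: add_edge_def)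
    next
      assume "K \<in> f ` Pow N"
      then obtain L where L: "L \<subseteq> N" "K = f L" by auto
      have "adjacent G x v" "adjacent G y v" "adjacent G v x" "adjacent G v y" if "v \<in> L" for v
        using L that by (auto simp: N_def common_nbrs_def adjacent_sym)
      moreover have "adjacent G u v" if "u \<in> L" "v \<in> L" "u \<noteq> v" for u v
        using that L N by (auto simp: is_clique_def subset_iff)
      moreover have "L \<subseteq> fst G" using L N by (auto simp: is_clique_def)
      ultimately show ?thesis
        using assms(3,4) unfolding is_clique_def adjacent_add_edge L(2) f_def
        by (auto simp: add_edge_def doubleton_eq_iff)
    qed
  qed
  have disj: "{K. is_clique G K} \<inter> f ` Pow N = {}"
    using assms by (auto simp: is_clique_def f_def)
  have inj: "inj_on f (Pow N)"
    using xyN by (auto simp: inj_on_def f_def)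
  have card: "card (f K) = 2 + card K" if "K \<in> Pow N" for K
  proof -
    have "x \<notin> K" "y \<notin> K" "finite K" using that xyN fN finite_subset by auto
    then show ?thesis using assms(5) by (simp add: f_def)
  qed
  have "clique_poly (add_edge x y G) = clique_poly G + (\<Sum>K\<in>f ` Pow N. [:-1, 1:] ^ card K)"
    unfolding clique_poly_def eq using finite_cliques[OF assms(1)] disj fN
    by (subst sum.union_disjoint) auto
  also have "(\<Sum>K\<in>f ` Pow N. [:-1, 1:] ^ card K) = (\<Sum>K\<in>Pow N. [:-1, 1 :: int:] ^ 2 * [:-1, 1:] ^ card K)"
    by (subst sum.reindex[OF inj], intro sum.cong) (simp_all only: card power_add o_def)
  also have "\<dots> = [:-1, 1:] ^ 2 * (1 + [:-1, 1:]) ^ card N"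
    by (simp only: sum_distrib_left[symmetric] sum_Pow_power_card[OF fN])
  also have "1 + [:-1, 1 :: int:] = monom 1 1"
    by (simp add: monom_altdef one_pCons)
  finally show ?thesis by (simp add: N_def monom_power)
qed

section \<open>Effect of a positive answer\<close>

definition identify :: "'v \<Rightarrow> 'v \<Rightarrow> 'v \<Rightarrow> 'v \<Rightarrow> 'v" where
  "identify x y w v = (if v = x \<or> v = y then w else v)"

text \<open>The name \<open>w\<close> of the merged vertex is a parameter, so that the graph
  arguments only need its freshness; that vertices are sets of items matters again in
  \<open>union_not_vertex\<close>.\<close>

definition contract :: "'v \<Rightarrow> 'v \<Rightarrow> 'v \<Rightarrow> 'v graph \<Rightarrow> 'v graph" where
  "contract x y w G = (identify x y w ` fst G, (`) (identify x y w) ` snd G)"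

lemma merge_vertices_eq: "merge_vertices x y G = contract x y (x \<union> y) G"
  by (simp add: merge_vertices_def contract_def identify_def[abs_def] Let_def)

lemma adjacent_contract:
  assumes "wf_graph G"
  shows "adjacent (contract x y w G) a b \<longleftrightarrow>
           (\<exists>u v. adjacent G u v \<and> a = identify x y w u \<and> b = identify x y w v)" (is "?l \<longleftrightarrow> ?r")
proof
  assume ?l
  then obtain e where e: "e \<in> snd G" "{a, b} = identify x y w ` e"
    by (auto simp: adjacent_def contract_def)
  then obtain u v where "e = {u, v}" using wf_graph_edgeE[OF assms] by metis
  then have "adjacent G u v" "adjacent G v u" "(a = identify x y w u \<and> b = identify x y w v) \<or> (a = identify x y w v \<and> b = identify x y w u)"
    using e by (auto simp: adjacent_def doubleton_eq_iff insert_commute)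
  then show ?r by blast
next
  assume ?r
  then obtain u v where "{u, v} \<in> snd G" "a = identify x y w u" "b = identify x y w v"
    by (auto simp: adjacent_def)
  then have "{a, b} = identify x y w ` {u, v}" by simp
  then show ?l using \<open>{u, v} \<in> snd G\<close> unfolding adjacent_def contract_def snd_conv by blast
qed

lemma wf_contract:
  assumes "wf_graph G" "x \<noteq> y" "\<not> adjacent G x y" "w \<notin> fst G"
  shows "wf_graph (contract x y w G)"
  unfolding wf_graph_def
proof (intro conjI ballI)
  show "finite (fst (contract x y w G))" using assms(1) by (auto simp: wf_graph_def contract_def)
  fix e assume "e \<in> snd (contract x y w G)"
  then obtain e' where e': "e' \<in> snd G" "e = identify x y w ` e'" by (auto simp: contract_def)
  then obtain u v where uv: "e' = {u, v}" "u \<in> fst G" "v \<in> fst G" "u \<noteq> v"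
    using wf_graph_edgeE[OF assms(1)] by metis
  have "identify x y w u \<noteq> identify x y w v"
    using uv e' assms by (auto simp: identify_def adjacent_def insert_commute)
  moreover have "e = {identify x y w u, identify x y w v}" using e' uv by simp
  moreover have "identify x y w u \<in> fst (contract x y w G)" "identify x y w v \<in> fst (contract x y w G)"
    using uv by (auto simp: contract_def)
  ultimately show "\<exists>u v. e = {u, v} \<and> u \<in> fst (contract x y w G) \<and> v \<in> fst (contract x y w G) \<and> u \<noteq> v"
    by blast
qed

text \<open>Two distinct cliques have the same image only if they are \<open>insert x L\<close> and
  \<open>insert y L\<close> with \<open>L\<close> among the common neighbours. Dropping the set
  \<open>T\<close> of all \<open>insert y L\<close> makes the map injective and accounts for z (1 +
  z)^d. Surjectivity is where \<open>chordal (add_edge x y G)\<close> enters.\<close>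

lemma clique_poly_contract:
  assumes "wf_graph G" "chordal G" "chordal (add_edge x y G)"
    and "x \<in> fst G" "y \<in> fst G" "x \<noteq> y" "\<not> adjacent G x y" and w: "w \<notin> fst G"
  shows "clique_poly G = clique_poly (contract x y w G) +
           [:-1, 1:] * monom 1 (card (common_nbrs G x y))"
proof -
  define N where "N = common_nbrs G x y"
  define r where "r = identify x y w"
  have N: "is_clique G N" unfolding N_def by (rule common_nbrs_clique) fact+
  have fN: "finite N" using N assms(1) by (auto simp: is_clique_def wf_graph_def intro: finite_subset)
  have xyN: "x \<notin> N" "y \<notin> N"
    using adjacent_irrefl[OF assms(1)] by (auto simp: N_def common_nbrs_def)
  define T where "T = insert y ` Pow N"
  have T: "T \<subseteq> {K. is_clique G K}"
  proof
    fix K assume "K \<in> T"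
    then obtain L where L: "L \<subseteq> N" "K = insert y L" by (auto simp: T_def)
    have "adjacent G y v" "adjacent G v y" if "v \<in> L" for v
      using L that by (auto simp: N_def common_nbrs_def adjacent_sym)
    moreover have "adjacent G u v" if "u \<in> L" "v \<in> L" "u \<noteq> v" for u v
      using that L N by (auto simp: is_clique_def subset_iff)
    moreover have "L \<subseteq> fst G" using L N by (auto simp: is_clique_def)
    ultimately show "K \<in> {K. is_clique G K}"
      using assms(5) unfolding is_clique_def L(2) mem_Collect_eq by (metis insert_iff insert_subset)
  qed
  have not_both: "\<not> (x \<in> K \<and> y \<in> K)" if "is_clique G K" for K
    using that assms(6,7) unfolding is_clique_def by blast
  have r_inj: "inj_on r K" if "is_clique G K" for K
  proof (rule inj_onI)
    fix u v assume "u \<in> K" "v \<in> K" "r u = r v"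
    moreover have "u \<noteq> w" "v \<noteq> w"
      using that calculation(1,2) w unfolding is_clique_def by blast+
    ultimately show "u = v"
      using not_both[OF that] unfolding r_def identify_def by metis
  qed
  have clique_img: "is_clique (contract x y w G) (r ` K)" if "is_clique G K" for K
    unfolding is_clique_def
  proof (intro conjI ballI impI)
    show "r ` K \<subseteq> fst (contract x y w G)"
      using that by (auto simp: is_clique_def contract_def r_def)
    fix a b assume "a \<in> r ` K" "b \<in> r ` K" "a \<noteq> b"
    then obtain u v where uv: "u \<in> K" "v \<in> K" "a = r u" "b = r v" "u \<noteq> v" by auto
    then have "adjacent G u v" using that by (auto simp: is_clique_def)
    then show "adjacent (contract x y w G) a b"
      unfolding adjacent_contract[OF assms(1)] using uv by (auto simp: r_def)
  qed
  have vert: "w \<noteq> v" if "v \<in> fst G" for v using w that by auto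
  have img_eq: "r ` K = (if x \<in> K \<or> y \<in> K then insert (w) (K - {x, y}) else K)" for K
    by (auto simp: r_def identify_def)
  have inj: "inj_on ((`) r) ({K. is_clique G K} - T)"
  proof (rule inj_onI)
    fix K L assume K: "K \<in> {K. is_clique G K} - T" and L: "L \<in> {K. is_clique G K} - T"
      and eq: "r ` K = r ` L"
    have sub: "K \<subseteq> fst G" "L \<subseteq> fst G" using K L by (auto simp: is_clique_def)
    have KL: "K - {x, y} = L - {x, y}"
    proof -
      have "r ` K - {w} = K - {x, y}" "r ` L - {w} = L - {x, y}"
        using sub vert assms(4,5) unfolding img_eq by auto
      then show ?thesis using eq by simp
    qed
    have iff: "x \<in> K \<or> y \<in> K \<longleftrightarrow> x \<in> L \<or> y \<in> L"
    proof -
      have "w \<in> r ` K \<longleftrightarrow> x \<in> K \<or> y \<in> K" "w \<in> r ` L \<longleftrightarrow> x \<in> L \<or> y \<in> L"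
        using sub w by (auto simp: img_eq)
      then show ?thesis using eq by simp
    qed
    \<comment> \<open>If two cliques differ only by x in place of y, all their other members are
      adjacent to both, so the clique with y belongs to \<open>T\<close>.\<close>
    have bad: False if "is_clique G A" "is_clique G B" "x \<in> A" "y \<in> B" "A - {x, y} = B - {x, y}" "B \<notin> T" for A B
    proof -
      have "B - {y} \<subseteq> N"
      proof
        fix v assume v: "v \<in> B - {y}"
        have "x \<notin> B" using not_both that by auto
        then have "v \<in> A" "v \<noteq> x" using that v by auto
        then show "v \<in> N" using that v by (auto simp: N_def common_nbrs_def is_clique_def)
      qed
      moreover have "B = insert y (B - {y})" using that by auto
      ultimately have "B \<in> T" unfolding T_def by blast
      then show False using that by blast
    qed
    have nK: "\<not> (x \<in> K \<and> y \<in> K)" and nL: "\<not> (x \<in> L \<and> y \<in> L)" using not_both K L by auto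
    have "\<not> (x \<in> K \<and> y \<in> L)" "\<not> (x \<in> L \<and> y \<in> K)"
      using bad[of K L] bad[of L K] K L KL unfolding mem_Collect_eq Diff_iff by metis+
    then have "x \<in> K \<longleftrightarrow> x \<in> L" "y \<in> K \<longleftrightarrow> y \<in> L" using iff nK nL by auto
    then show "K = L" using KL by blast
  qed
  have img: "(`) r ` ({K. is_clique G K} - T) = {K. is_clique (contract x y w G) K}"
  proof (intro equalityI subsetI)
    fix K assume K: "K \<in> {K. is_clique (contract x y w G) K}"
    have adj: "adjacent G u v" if "u \<in> K" "v \<in> K" "u \<noteq> v" "u \<noteq> w" "v \<noteq> w" for u v
    proof -
      have "adjacent (contract x y w G) u v" using K that by (auto simp: is_clique_def)
      then show ?thesis
        using that by (auto simp: adjacent_contract[OF assms(1)] identify_def split: if_splits)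
    qed
    have vK: "v \<in> fst G \<and> v \<noteq> x \<and> v \<noteq> y" if "v \<in> K" "v \<noteq> w" for v
    proof -
      have "v \<in> identify x y w ` fst G" using K that by (auto simp: is_clique_def contract_def)
      then show ?thesis using that by (auto simp: identify_def split: if_splits)
    qed
    show "K \<in> (`) r ` ({K. is_clique G K} - T)"
    proof (cases "w \<in> K")
      case False
      have "is_clique G K" using adj vK False by (force simp: is_clique_def)
      moreover have "r ` K = K" using vK False by (force simp: img_eq)
      moreover have "y \<notin> K" using vK False assms(5) w by force
      moreover have "K \<notin> T" using calculation(3) by (auto simp: T_def)
      ultimately show ?thesis by (metis DiffI image_eqI mem_Collect_eq)
    next
      case True
      define K0 where "K0 = K - {w}"
      have K0: "is_clique G K0" using adj vK by (force simp: is_clique_def K0_def)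
      have K0xy: "x \<notin> K0" "y \<notin> K0" using vK by (auto simp: K0_def)
      have nb: "adjacent G x v \<or> adjacent G y v" if "v \<in> K0" for v
      proof -
        have "adjacent (contract x y w G) (w) v"
          using K that True by (auto simp: is_clique_def K0_def)
        then obtain u t where uw: "adjacent G u t" "w = identify x y w u" "v = identify x y w t"
          by (auto simp: adjacent_contract[OF assms(1)])
        have "u = x \<or> u = y"
          using uw(2) adjacent_wf(1)[OF assms(1) uw(1)] w by (metis identify_def)
        moreover have "t = v" using uw that by (auto simp: K0_def identify_def split: if_splits)
        ultimately show ?thesis using uw by auto
      qed
      \<comment> \<open>Otherwise some u in \<open>K0\<close> is adjacent to x but not to y and some
        v to y but not to x, and x u v y would be an induced 4-cycle once the edge xy is
        present.\<close>
      have cases: "(\<forall>v\<in>K0. adjacent G x v) \<or> (\<forall>v\<in>K0. adjacent G y v)"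
      proof (rule ccontr)
        assume "\<not> ?thesis"
        then obtain u v where uv: "u \<in> K0" "v \<in> K0" "\<not> adjacent G x v" "\<not> adjacent G y u" by auto
        then have a: "adjacent G x u" "adjacent G y v" "u \<noteq> v" using nb by auto
        have "adjacent G u v" using K0 uv a by (auto simp: is_clique_def)
        then show False
          using chordal_no_4_cycle[OF wf_add_edge[OF assms(1,4,5,6)] assms(3), of x u v y] a uv K0xy
            adjacent_sym[of G v y] adjacent_sym[of G u y] assms(6)
          by (auto simp: adjacent_add_edge doubleton_eq_iff)
      qed
      show ?thesis
      proof (cases "\<forall>v\<in>K0. adjacent G x v")
        case c: True
        have "is_clique G (insert x K0)"
          using c K0 assms(4) adjacent_sym[of G x] unfolding is_clique_def by blast
        moreover have "insert x K0 \<notin> T" using xyN K0xy assms(6) by (auto simp: T_def)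
        moreover have "r ` insert x K0 = K"
          unfolding img_eq using True K0xy by (auto simp: K0_def)
        ultimately show ?thesis by (metis DiffI image_eqI mem_Collect_eq)
      next
        case c: False
        then have c': "\<forall>v\<in>K0. adjacent G y v" using cases by auto
        have "is_clique G (insert y K0)"
          using c' K0 assms(5) adjacent_sym[of G y] unfolding is_clique_def by blast
        moreover have "insert y K0 \<notin> T"
        proof
          assume "insert y K0 \<in> T"
          then obtain L where "L \<subseteq> N" "insert y K0 = insert y L" by (auto simp: T_def)
          then have "K0 \<subseteq> N" using K0xy by (metis subset_insert subset_insertI subset_trans)
          then show False using c by (auto simp: N_def common_nbrs_def)
        qed
        moreover have "r ` insert y K0 = K"
          unfolding img_eq using True K0xy by (auto simp: K0_def)
        ultimately show ?thesis by (metis DiffI image_eqI mem_Collect_eq)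
      qed
    qed
  qed (use clique_img in auto)
  have fT: "finite T" using fN by (simp add: T_def)
  have "clique_poly G = (\<Sum>K\<in>{K. is_clique G K} - T. [:-1, 1:] ^ card K) + (\<Sum>K\<in>T. [:-1, 1:] ^ card K)"
    unfolding clique_poly_def using sum.subset_diff[OF T finite_cliques[OF assms(1)]] .
  also have "(\<Sum>K\<in>{K. is_clique G K} - T. [:-1, 1 :: int:] ^ card K) =
      (\<Sum>K\<in>{K. is_clique G K} - T. [:-1, 1:] ^ card (r ` K))"
    using r_inj by (intro sum.cong) (auto simp: card_image)
  also have "\<dots> = clique_poly (contract x y w G)"
    unfolding clique_poly_def img[symmetric] by (subst sum.reindex[OF inj]) simp
  also have "(\<Sum>K\<in>T. [:-1, 1:] ^ card K) = (\<Sum>K\<in>Pow N. [:-1, 1 :: int:] * [:-1, 1:] ^ card K)"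
  proof -
    have "inj_on (insert y) (Pow N)" using xyN by (auto simp: inj_on_def)
    moreover have "card (insert y K) = Suc (card K)" if "K \<in> Pow N" for K
      using that xyN fN finite_subset by (subst card_insert_disjoint) auto
    ultimately show ?thesis unfolding T_def by (subst sum.reindex) auto
  qed
  also have "\<dots> = [:-1, 1:] * (1 + [:-1, 1:]) ^ card N"
    by (simp only: sum_distrib_left[symmetric] sum_Pow_power_card[OF fN])
  also have "1 + [:-1, 1 :: int:] = monom 1 1"
    by (simp add: monom_altdef one_pCons)
  finally show ?thesis by (simp add: N_def monom_power)
qed

lemma coeff_sum_monom_mset: "coeff (\<Sum>d\<in>#D. monom (1 :: int) d) i = of_nat (count D i)"
  by (induction D) (auto simp: coeff_monom)

text \<open>The factor z cancels in the integral domain of polynomials, and the coefficient of the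
  i-th power counts the exponent i. The exponents thus belong to the graph itself, which lets the
  multisets from the two induction hypotheses be compared.\<close>

lemma clique_exponents_unique:
  assumes "1 + [:-1, 1:] * (\<Sum>d\<in>#C. monom (1 :: int) d) = 1 + [:-1, 1:] * (\<Sum>d\<in>#D. monom 1 d)"
  shows "C = D"
proof -
  have "(\<Sum>d\<in>#C. monom (1 :: int) d) = (\<Sum>d\<in>#D. monom 1 d)"
    using assms by (metis add_left_cancel mult_left_cancel pCons_eq_0_iff zero_neq_one)
  then have "int (count C i) = int (count D i)" for i
    by (metis coeff_sum_monom_mset)
  then show ?thesis by (simp add: multiset_eq_iff)
qed

section \<open>Partitions compatible with the answers so far\<close>

definition consistent :: "'a set \<Rightarrow> 'a set graph \<Rightarrow> 'a set set set" where
  "consistent S G = {\<pi>. partition_on S \<pi> \<and> (\<forall>v\<in>fst G. \<exists>B\<in>\<pi>. v \<subseteq> B) \<and>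
     (\<forall>u v. adjacent G u v \<longrightarrow> \<not> same_block \<pi> u v)}"

lemma partition_onE_nonempty: "partition_on S P \<Longrightarrow> p \<in> P \<Longrightarrow> p \<noteq> {}"
  by (auto dest: partition_onD3)

lemma partition_on_unique: "partition_on S P \<Longrightarrow> p \<in> P \<Longrightarrow> q \<in> P \<Longrightarrow> x \<in> p \<Longrightarrow> x \<in> q \<Longrightarrow> p = q"
  by (metis disjoint_iff disjointD partition_onD2)

lemma finite_consistent: "finite S \<Longrightarrow> finite (consistent S G)"
  by (rule finite_subset[OF _ finitely_many_partition_on[of S]]) (auto simp: consistent_def)

text \<open>This is the finest compatible partition. It witnesses that a graph in the induction is
  reached by some input, so that its chordality may be used.\<close>

lemma vertices_consistent:
  assumes "partition_on S (fst G)" "wf_graph G"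
  shows "fst G \<in> consistent S G"
proof -
  have "\<not> same_block (fst G) u v" if a: "adjacent G u v" for u v
  proof
    assume "same_block (fst G) u v"
    then obtain B where B: "B \<in> fst G" "u \<subseteq> B" "v \<subseteq> B" by (auto simp: same_block_def)
    have uv: "u \<in> fst G" "v \<in> fst G" "u \<noteq> v" using adjacent_wf[OF assms(2) a] by auto
    have "u \<noteq> {}" "v \<noteq> {}" using partition_onE_nonempty[OF assms(1)] uv by auto
    then have "u = B" "v = B"
      using partition_on_unique[OF assms(1)] uv B by (metis ex_in_conv subsetD)+
    then show False using uv by simp
  qed
  then show ?thesis using assms(1) by (auto simp: consistent_def)
qed

lemma consistent_complete:
  assumes "partition_on S (fst G)" "wf_graph G" "complete_graph G"
  shows "consistent S G = {fst G}"
proof (intro equalityI subsetI)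
  fix \<pi> assume \<pi>: "\<pi> \<in> consistent S G"
  then have p: "partition_on S \<pi>" by (simp add: consistent_def)
  have sub: "\<exists>v\<in>fst G. B = v" if B: "B \<in> \<pi>" for B
  proof -
    have *: "\<exists>v\<in>fst G. a \<in> v \<and> v \<subseteq> B" if "a \<in> B" for a
    proof -
      have "a \<in> S" using that B p by (auto simp: partition_on_def)
      then obtain v where v: "v \<in> fst G" "a \<in> v" using assms(1) by (auto simp: partition_on_def)
      then obtain B' where "B' \<in> \<pi>" "v \<subseteq> B'" using \<pi> by (auto simp: consistent_def)
      then have "B' = B" using partition_on_unique[OF p _ B] v that by (metis subsetD)
      then show ?thesis using v \<open>v \<subseteq> B'\<close> by auto
    qed
    obtain a where "a \<in> B" using partition_onE_nonempty[OF p B] by auto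
    then obtain v where v: "v \<in> fst G" "a \<in> v" "v \<subseteq> B" using * by blast
    have "B \<subseteq> v"
    proof
      fix b assume "b \<in> B"
      then obtain w where w: "w \<in> fst G" "b \<in> w" "w \<subseteq> B" using * by blast
      have "same_block \<pi> v w" using v w B by (auto simp: same_block_def)
      then have "\<not> adjacent G v w" using \<pi> by (auto simp: consistent_def)
      then have "v = w" using v w assms(3) by (metis complete_graph_def)
      then show "b \<in> v" using w by simp
    qed
    then show ?thesis using v by blast
  qed
  moreover have "v \<in> \<pi>" if v: "v \<in> fst G" for v
  proof -
    obtain B where B: "B \<in> \<pi>" "v \<subseteq> B" using \<pi> v by (auto simp: consistent_def)
    have "B \<in> fst G" using sub B by auto
    moreover obtain a where "a \<in> v" using partition_onE_nonempty[OF assms(1) v] by auto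
    ultimately show "v \<in> \<pi>" using partition_on_unique[OF assms(1) v, of B a] B by auto
  qed
  ultimately show "\<pi> \<in> {fst G}" by auto
qed (use vertices_consistent[OF assms(1,2)] in auto)

lemma union_not_vertex:
  assumes "partition_on S V" "x \<in> V" "y \<in> V" "x \<noteq> y"
  shows "x \<union> y \<notin> V"
proof
  assume "x \<union> y \<in> V"
  moreover obtain a b where "a \<in> x" "b \<in> y" using partition_onE_nonempty[OF assms(1)] assms by blast
  ultimately have "x = x \<union> y" "y = x \<union> y"
    using partition_on_unique[OF assms(1)] assms by (metis UnI1 UnI2)+
  then show False using assms by simp
qed

lemma vertices_merge:
  assumes "x \<in> fst G" "y \<in> fst G"
  shows "fst (merge_vertices x y G) = insert (x \<union> y) (fst G - {x, y})"
  unfolding merge_vertices_eq contract_def identify_def using assms by auto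

lemma partition_on_merge:
  assumes "partition_on S (fst G)" "x \<in> fst G" "y \<in> fst G" "x \<noteq> y"
  shows "partition_on S (fst (merge_vertices x y G))"
  unfolding vertices_merge[OF assms(2,3)]
proof (rule partition_onI)
  show "\<Union> (insert (x \<union> y) (fst G - {x, y})) = S"
    using assms by (auto simp: partition_on_def)
  show "{} \<notin> insert (x \<union> y) (fst G - {x, y})"
    using partition_onE_nonempty[OF assms(1)] assms by auto
  show "disjnt p p'" if "p \<in> insert (x \<union> y) (fst G - {x, y})" "p' \<in> insert (x \<union> y) (fst G - {x, y})" "p \<noteq> p'" for p p'
  proof -
    have *: "disjnt u v" if "u \<in> fst G" "v \<in> fst G" "u \<noteq> v" for u v
      using partition_on_unique[OF assms(1)] that by (auto simp: disjnt_def)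
    show ?thesis using that *[of p p'] *[of p x] *[of p y] *[of x p'] *[of y p'] assms
      by (elim insertE) (auto simp: disjnt_Un1 disjnt_Un2)
  qed
qed

lemma consistent_add_edge:
  "consistent S (add_edge x y G) = {\<pi> \<in> consistent S G. \<not> same_block \<pi> x y}"
proof -
  have *: "same_block \<pi> u v \<longleftrightarrow> same_block \<pi> x y" if "{u, v} = {x, y}" for \<pi> u v
    using that by (auto simp: doubleton_eq_iff same_block_def Un_commute)
  have "(\<forall>u v. {u, v} = {x, y} \<or> adjacent G u v \<longrightarrow> \<not> same_block \<pi> u v) \<longleftrightarrow>
      \<not> same_block \<pi> x y \<and> (\<forall>u v. adjacent G u v \<longrightarrow> \<not> same_block \<pi> u v)" for \<pi>
    using * by metis
  moreover have "fst (add_edge x y G) = fst G" by (simp add: add_edge_def)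
  ultimately show ?thesis unfolding consistent_def adjacent_add_edge by auto
qed

lemma consistent_merge:
  assumes "partition_on S (fst G)" "wf_graph G" "x \<in> fst G" "y \<in> fst G"
  shows "consistent S (merge_vertices x y G) = {\<pi> \<in> consistent S G. same_block \<pi> x y}"
proof -
  let ?r = "identify x y (x \<union> y)"
  have ne: "v \<noteq> {}" if "v \<in> fst G" for v using partition_onE_nonempty[OF assms(1) that] .
  have verts: "(\<forall>v\<in>fst (merge_vertices x y G). \<exists>B\<in>\<pi>. v \<subseteq> B) \<longleftrightarrow>
      same_block \<pi> x y \<and> (\<forall>v\<in>fst G. \<exists>B\<in>\<pi>. v \<subseteq> B)" for \<pi>
  proof -
    have "(\<forall>v\<in>fst (merge_vertices x y G). \<exists>B\<in>\<pi>. v \<subseteq> B) \<longleftrightarrow>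
        same_block \<pi> x y \<and> (\<forall>v\<in>fst G - {x, y}. \<exists>B\<in>\<pi>. v \<subseteq> B)"
      unfolding vertices_merge[OF assms(3,4)] same_block_def by simp
    also have "\<dots> \<longleftrightarrow> same_block \<pi> x y \<and> (\<forall>v\<in>fst G. \<exists>B\<in>\<pi>. v \<subseteq> B)"
    proof -
      have "\<exists>B\<in>\<pi>. v \<subseteq> B" if "same_block \<pi> x y" "v = x \<or> v = y" for v
        using that by (auto simp: same_block_def)
      then show ?thesis by (metis Diff_iff insert_iff singletonD)
    qed
    finally show ?thesis .
  qed
  \<comment> \<open>The block \<open>B\<close> that contains both x and y is the only one containing
    either, as vertices are non-empty; replacing x or y by the union therefore changes no inclusion
    in a block.\<close>
  have blocks: "same_block \<pi> (?r u) (?r v) \<longleftrightarrow> same_block \<pi> u v"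
    if \<pi>: "partition_on S \<pi>" "same_block \<pi> x y" and uv: "u \<in> fst G" "v \<in> fst G" for \<pi> u v
  proof -
    obtain B where B: "B \<in> \<pi>" "x \<subseteq> B" "y \<subseteq> B" using \<pi>(2) by (auto simp: same_block_def)
    have *: "?r u \<subseteq> C \<longleftrightarrow> u \<subseteq> C" if "C \<in> \<pi>" "u \<in> fst G" for u C
    proof (cases "u = x \<or> u = y")
      case True
      have "C = B" if "u \<subseteq> C"
        using that B \<open>C \<in> \<pi>\<close> True ne[OF \<open>u \<in> fst G\<close>] partition_on_unique[OF \<pi>(1)]
        by (metis ex_in_conv subsetD)
      then show ?thesis using True B by (auto simp: identify_def)
    qed (simp add: identify_def)
    then show ?thesis using uv by (auto simp: same_block_def)
  qed
  have edges: "(\<forall>u v. adjacent (merge_vertices x y G) u v \<longrightarrow> \<not> same_block \<pi> u v) \<longleftrightarrow>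
      (\<forall>u v. adjacent G u v \<longrightarrow> \<not> same_block \<pi> u v)" if "partition_on S \<pi>" "same_block \<pi> x y" for \<pi>
    unfolding merge_vertices_eq adjacent_contract[OF assms(2)]
    using blocks[OF that] adjacent_wf[OF assms(2)] by metis
  have "\<pi> \<in> consistent S (merge_vertices x y G) \<longleftrightarrow> \<pi> \<in> consistent S G \<and> same_block \<pi> x y" for \<pi>
    using verts[of \<pi>] edges[of \<pi>] unfolding consistent_def mem_Collect_eq by argo
  then show ?thesis by blast
qed

section \<open>Induction over the query tree\<close>

lemma clique_poly_complete:
  assumes "wf_graph G" "complete_graph G"
  shows "clique_poly G = 1 + [:-1, 1:] * (\<Sum>d\<in>#mset_set {..<card (fst G)}. monom 1 d)"
proof -
  have fin: "finite (fst G)" using assms(1) by (simp add: wf_graph_def)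
  have "{K. is_clique G K} = Pow (fst G)"
    using assms(2) by (auto simp: is_clique_def complete_graph_def)
  then have "clique_poly G = (1 + [:-1, 1:]) ^ card (fst G)"
    unfolding clique_poly_def using sum_Pow_power_card[OF fin] by simp
  also have "1 + [:-1, 1 :: int:] = monom 1 1"
    by (simp add: monom_altdef one_pCons)
  also have "monom (1 :: int) 1 ^ card (fst G) = 1 + (monom 1 1 - 1) * (\<Sum>i<card (fst G). monom (1 :: int) 1 ^ i)"
    by (simp add: power_diff_1_eq[symmetric])
  also have "monom 1 1 - 1 = [:-1, 1 :: int:]"
    by (simp add: monom_altdef one_pCons)
  finally show ?thesis by (simp add: monom_power sum_unfold_sum_mset)
qed

text \<open>
  For a chordal graph the exponents \<open>D\<close> are the numbers of later neighbours along a perfect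
  elimination ordering. Recovering them from the clique polynomial avoids such orderings.
\<close>

lemma sum_queries_eq:
  fixes \<Phi> :: "nat multiset \<Rightarrow> 'b::comm_ring_1"
  assumes rec: "\<And>d D. \<Phi> (add_mset d D) = q * (\<Phi> (add_mset (Suc d) D) + \<Phi> D)"
    and base: "\<And>k. \<Phi> (mset_set {..<k}) = 1"
    and S: "finite S"
  shows "ac_valid G A \<Longrightarrow> partition_on S (fst G) \<Longrightarrow> wf_graph G \<Longrightarrow>
    (\<And>\<pi> H. \<pi> \<in> consistent S G \<Longrightarrow> H \<in> set (aggregated_graphs \<pi> G A) \<Longrightarrow> chordal H) \<Longrightarrow>
    \<exists>D. clique_poly G = 1 + [:-1, 1:] * (\<Sum>d\<in>#D. monom 1 d) \<and>
        (\<Sum>\<pi>\<in>consistent S G. q ^ num_queries A \<pi>) = \<Phi> D"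
proof (induction A arbitrary: G)
  case Stop
  then show ?case
    using consistent_complete[of S G] clique_poly_complete[of G] base
    by (intro exI[of _ "mset_set {..<card (fst G)}"]) auto
next
  case (Query x y N P)
  let ?Gn = "add_edge x y G" and ?Gp = "merge_vertices x y G"
  have v: "x \<in> fst G" "y \<in> fst G" "x \<noteq> y" "\<not> adjacent G x y"
    and vN: "ac_valid ?Gn N" and vP: "ac_valid ?Gp P"
    using Query.prems(1) by auto
  have w: "x \<union> y \<notin> fst G" using union_not_vertex[OF Query.prems(2) v(1-3)] .
  have pn: "partition_on S (fst ?Gn)" using Query.prems(2) by (simp add: add_edge_def)
  have pp: "partition_on S (fst ?Gp)" using partition_on_merge[OF Query.prems(2) v(1-3)] .
  have wn: "wf_graph ?Gn" using wf_add_edge[OF Query.prems(3) v(1-3)] .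
  have wp: "wf_graph ?Gp" unfolding merge_vertices_eq using wf_contract[OF Query.prems(3) v(3,4) w] .
  have cn: "consistent S ?Gn = {\<pi> \<in> consistent S G. \<not> same_block \<pi> x y}"
    by (rule consistent_add_edge)
  have cp: "consistent S ?Gp = {\<pi> \<in> consistent S G. same_block \<pi> x y}"
    using consistent_merge[OF Query.prems(2,3) v(1,2)] .
  have gn: "chordal H" if "\<pi> \<in> consistent S ?Gn" "H \<in> set (aggregated_graphs \<pi> ?Gn N)" for \<pi> H
    using Query.prems(4)[of \<pi> H] that unfolding cn by simp
  have gp: "chordal H" if "\<pi> \<in> consistent S ?Gp" "H \<in> set (aggregated_graphs \<pi> ?Gp P)" for \<pi> H
    using Query.prems(4)[of \<pi> H] that unfolding cp by simp
  have chG: "chordal G"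
    using Query.prems(4)[OF vertices_consistent[OF Query.prems(2,3)]] by simp
  \<comment> \<open>On the partition into the current vertices this query is answered negatively, so
    the graph with the new edge is really met; its chordality is needed for the merge as
    well.\<close>
  have "?Gn \<in> set (aggregated_graphs (fst ?Gn) ?Gn N)" by (cases N) auto
  then have chn: "chordal ?Gn" using gn[OF vertices_consistent[OF pn wn]] by blast
  obtain Dn where Dn: "clique_poly ?Gn = 1 + [:-1, 1:] * (\<Sum>d\<in>#Dn. monom 1 d)"
      "(\<Sum>\<pi>\<in>consistent S ?Gn. q ^ num_queries N \<pi>) = \<Phi> Dn"
    using Query.IH(1)[OF vN pn wn] gn by blast
  obtain Dp where Dp: "clique_poly ?Gp = 1 + [:-1, 1:] * (\<Sum>d\<in>#Dp. monom 1 d)"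
      "(\<Sum>\<pi>\<in>consistent S ?Gp. q ^ num_queries P \<pi>) = \<Phi> Dp"
    using Query.IH(2)[OF vP pp wp] gp by blast
  define d where "d = card (common_nbrs G x y)"
  have cG: "clique_poly G = clique_poly ?Gp + [:-1, 1:] * monom 1 d"
    unfolding d_def merge_vertices_eq
    by (rule clique_poly_contract[OF Query.prems(3) chG chn v w])
  have cGn: "clique_poly ?Gn = clique_poly G + [:-1, 1:] ^ 2 * monom 1 d"
    unfolding d_def by (rule clique_poly_add_edge[OF Query.prems(3) chG v])
  have D: "clique_poly G = 1 + [:-1, 1:] * (\<Sum>d\<in>#add_mset d Dp. monom 1 d)"
    unfolding cG Dp(1) by (simp add: algebra_simps)
  have z: "[:-1, 1 :: int:] = monom 1 1 - 1"
    by (simp add: monom_altdef one_pCons)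
  have Sd: "monom (1 :: int) (Suc d) = monom 1 1 * monom 1 d" by (simp add: mult_monom)
  \<comment> \<open>With z + 1 = u one has z^2 u^d + z u^d = z u^(d + 1): compared with the graph
    after a positive answer, the one after a negative answer has the single extra exponent d +
    1.\<close>
  have "clique_poly ?Gn = 1 + [:-1, 1:] * (\<Sum>d\<in>#add_mset (Suc d) Dp. monom 1 d)"
    unfolding cGn cG Dp(1) by (simp only: z image_mset_add_mset sum_mset.insert Sd power2_eq_square)
      (simp add: algebra_simps)
  then have "Dn = add_mset (Suc d) Dp" using Dn(1) clique_exponents_unique by metis
  moreover have "(\<Sum>\<pi>\<in>consistent S G. q ^ num_queries (Query x y N P) \<pi>) = q * (\<Phi> Dn + \<Phi> Dp)"
  proof -
    let ?f = "\<lambda>\<pi>. q ^ num_queries (Query x y N P) \<pi>"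
    have eq: "consistent S G = consistent S ?Gn \<union> consistent S ?Gp" unfolding cn cp by auto
    have "(\<Sum>\<pi>\<in>consistent S G. ?f \<pi>) = (\<Sum>\<pi>\<in>consistent S ?Gn. ?f \<pi>) + (\<Sum>\<pi>\<in>consistent S ?Gp. ?f \<pi>)"
      unfolding eq by (rule sum.union_disjoint) (use finite_consistent[OF S] in \<open>auto simp: cn cp\<close>)
    also have "(\<Sum>\<pi>\<in>consistent S ?Gn. ?f \<pi>) = q * \<Phi> Dn"
      unfolding Dn(2)[symmetric] sum_distrib_left by (intro sum.cong refl) (simp add: cn)
    also have "(\<Sum>\<pi>\<in>consistent S ?Gp. ?f \<pi>) = q * \<Phi> Dp"
      unfolding Dp(2)[symmetric] sum_distrib_left by (intro sum.cong refl) (simp add: cp)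
    finally show ?thesis by (simp add: algebra_simps)
  qed
  ultimately have "(\<Sum>\<pi>\<in>consistent S G. q ^ num_queries (Query x y N P) \<pi>) = \<Phi> (add_mset d Dp)"
    by (simp only: rec[of d Dp])
  with D show ?case by blast
qed

lemma sum_queries_chordal:
  fixes \<Phi> :: "nat multiset \<Rightarrow> 'b::comm_ring_1"
  assumes rec: "\<And>d D. \<Phi> (add_mset d D) = q * (\<Phi> (add_mset (Suc d) D) + \<Phi> D)"
    and base: "\<And>k. \<Phi> (mset_set {..<k}) = 1"
    and S: "finite S" and A: "chordal_ac_algorithm S A"
  shows "(\<Sum>\<pi> | partition_on S \<pi>. q ^ num_queries A \<pi>) = \<Phi> (replicate_mset (card S) 0)"
proof -
  let ?G = "initial_graph S"
  have G: "fst ?G = (\<lambda>s. {s}) ` S" "\<not> adjacent ?G u v" for u v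
    by (auto simp: initial_graph_def adjacent_def)
  have wf: "wf_graph ?G" using S by (auto simp: wf_graph_def initial_graph_def)
  have p: "partition_on S (fst ?G)"
    unfolding G by (rule partition_onI) auto
  have cons: "consistent S ?G = {\<pi>. partition_on S \<pi>}"
    unfolding consistent_def using G by (auto simp: partition_on_def)
  obtain D where D: "clique_poly ?G = 1 + [:-1, 1:] * (\<Sum>d\<in>#D. monom 1 d)"
      "(\<Sum>\<pi>\<in>consistent S ?G. q ^ num_queries A \<pi>) = \<Phi> D"
    using sum_queries_eq[OF rec base S, of ?G A] A wf p cons
    by (auto simp: chordal_ac_algorithm_def ac_algorithm_def)
  have cl: "{K. is_clique ?G K} = insert {} ((\<lambda>s. {{s}}) ` S)"
  proof (intro equalityI subsetI)
    fix K assume K: "K \<in> {K. is_clique ?G K}"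
    then have "u = v" if "u \<in> K" "v \<in> K" for u v using that G(2) by (auto simp: is_clique_def)
    then have "K = {} \<or> (\<exists>u. K = {u})" by blast
    moreover have "K \<subseteq> fst ?G" using K by (simp add: is_clique_def)
    ultimately show "K \<in> insert {} ((\<lambda>s. {{s}}) ` S)" unfolding G by auto
  qed (auto simp: is_clique_def G)
  have inj: "inj_on (\<lambda>s. {{s}}) S" by (auto simp: inj_on_def)
  have "clique_poly ?G = 1 + (\<Sum>K\<in>(\<lambda>s. {{s}}) ` S. [:-1, 1:] ^ card K)"
    unfolding clique_poly_def cl using S by (subst sum.insert) auto
  also have "(\<Sum>K\<in>(\<lambda>s. {{s}}) ` S. [:-1, 1:] ^ card K) = of_nat (card S) * [:-1, 1 :: int:]"
    by (subst sum.reindex[OF inj]) simp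
  also have "\<dots> = [:-1, 1:] * (\<Sum>d\<in>#replicate_mset (card S) 0. monom 1 d)"
    by (simp add: monom_0 one_pCons[symmetric] mult.commute)
  finally have "D = replicate_mset (card S) 0" using D(1) clique_exponents_unique by metis
  then show ?thesis using D(2) cons by simp
qed

section \<open>The generating function\<close>

lemma q_int_Suc: "q_int q (Suc n) = q_int q n + q ^ n"
  by (simp add: q_int_def)

lemma q_int_0 [simp]: "q_int q 0 = 0"
  by (simp add: q_int_def)

lemma q_int_add: "q_int q (m + k) = q_int q m + q ^ m * q_int q k"
  by (induction k) (simp_all add: q_int_Suc power_add algebra_simps)

lemma q_int_geometric: "q \<noteq> 1 \<Longrightarrow> q_int q n = (1 - q ^ n) / (1 - q)" for q :: "'a::field"
  by (simp add: q_int_def sum_gp_strict)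

lemma q_fact_Suc: "q_fact q (Suc n) = q_fact q n * q_int q (Suc n)"
  by (simp add: q_fact_def)

lemma q_fact_0 [simp]: "q_fact q 0 = 1"
  by (simp add: q_fact_def)

text \<open>The polynomial in \<open>x = [m]\<^sub>q\<close> whose value is \<open>q [m - d]\<^sub>q\<close>.\<close>

definition q_factor :: "complex \<Rightarrow> nat \<Rightarrow> complex poly" where
  "q_factor q d = smult (q / q ^ d) [:- q_int q d, 1:]"

lemma q_factor_rec: "q \<noteq> 0 \<Longrightarrow> q_factor q d = smult q (q_factor q (Suc d) + 1)"
  by (simp add: q_factor_def q_int_Suc one_pCons field_simps)

lemma q_factor_0: "q_factor q 0 = [:0, q:]"
  by (simp add: q_factor_def)

text \<open>For nonzero q the product over \<open>d < k\<close> has degree k, so these products form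
  a basis and the base condition determines \<open>L\<close>. Both formulas therefore evaluate the
  same functional at the polynomial (q [m])^n.\<close>

lemma sum_queries_functional:
  fixes L :: "complex poly \<Rightarrow> complex"
  assumes q: "q \<noteq> 0"
    and add: "\<And>p r. L (p + r) = L p + L r" and smult: "\<And>c p. L (smult c p) = c * L p"
    and base: "\<And>k. L (\<Prod>d<k. q_factor q d) = 1"
    and S: "finite S" and A: "chordal_ac_algorithm S A"
  shows "(\<Sum>\<pi> | partition_on S \<pi>. q ^ num_queries A \<pi>) = L ([:0, q:] ^ card S)"
proof -
  define \<Phi> where "\<Phi> D = L (\<Prod>d\<in>#D. q_factor q d)" for D
  have "\<Phi> (add_mset d D) = q * (\<Phi> (add_mset (Suc d) D) + \<Phi> D)" for d D
  proof -
    have "(\<Prod>d\<in>#add_mset d D. q_factor q d) =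
        smult q ((\<Prod>d\<in>#add_mset (Suc d) D. q_factor q d) + (\<Prod>d\<in>#D. q_factor q d))"
      by (subst image_mset_add_mset, subst prod_mset.insert, subst q_factor_rec[OF q])
        (simp add: algebra_simps smult_add_right)
    then show ?thesis by (simp add: \<Phi>_def add smult)
  qed
  moreover have "\<Phi> (mset_set {..<k}) = 1" for k
    using base[of k] by (simp add: \<Phi>_def prod_unfold_prod_mset)
  ultimately have "(\<Sum>\<pi> | partition_on S \<pi>. q ^ num_queries A \<pi>) = \<Phi> (replicate_mset (card S) 0)"
    using sum_queries_chordal[OF _ _ S A] by blast
  then show ?thesis by (simp add: \<Phi>_def q_factor_0)
qed

section \<open>The q-Pochhammer functional\<close>

definition poch_functional :: "complex \<Rightarrow> complex \<Rightarrow> complex poly \<Rightarrow> complex" where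
  "poch_functional a q p = (\<Sum>k\<le>degree p. coeff p k * q_pochhammer a q k)"

lemma poch_functional_bound:
  assumes "degree p \<le> N"
  shows "poch_functional a q p = (\<Sum>k\<le>N. coeff p k * q_pochhammer a q k)"
  unfolding poch_functional_def using assms
  by (intro sum.mono_neutral_left) (auto simp: coeff_eq_0)

lemma poch_functional_add: "poch_functional a q (p + r) = poch_functional a q p + poch_functional a q r"
proof -
  define N where "N = max (degree p) (degree r)"
  have "degree (p + r) \<le> N" "degree p \<le> N" "degree r \<le> N"
    by (auto simp: N_def degree_add_le)
  then show ?thesis
    by (simp add: poch_functional_bound[of _ N] sum.distrib algebra_simps)
qed

lemma poch_functional_smult: "poch_functional a q (smult c p) = c * poch_functional a q p"
  by (simp add: poch_functional_bound[of "smult c p" "degree p"] poch_functional_def degree_smult_le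
      sum_distrib_left mult.assoc)

text \<open>This is \<open>(a; q)_k - (a; q)_(k+1) = a q^k (a; q)_k\<close> summed against the
  coefficients of \<open>p\<close>: the factor 1 - y is traded for the substitution of q y for
  y.\<close>

lemma poch_functional_shift:
  "poch_functional a q ([:1, -1:] * p) = a * poch_functional a q (pcompose p [:0, q:])"
proof -
  let ?N = "degree p"
  have "poch_functional a q (pCons 0 p) = (\<Sum>k\<le>Suc ?N. coeff (pCons 0 p) k * q_pochhammer a q k)"
    by (intro poch_functional_bound) (rule degree_pCons_le)
  also have "\<dots> = (\<Sum>k\<le>?N. coeff p k * q_pochhammer a q (Suc k))"
    by (subst sum.atMost_Suc_shift) simp
  also have "\<dots> = (\<Sum>k\<le>?N. coeff p k * q_pochhammer a q k) -
      a * (\<Sum>k\<le>?N. coeff (pcompose p [:0, q:]) k * q_pochhammer a q k)"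
    by (simp add: q_pochhammer_def coeff_pcompose_linear sum_distrib_left sum_subtractf algebra_simps)
  also have "(\<Sum>k\<le>?N. coeff (pcompose p [:0, q:]) k * q_pochhammer a q k) =
      poch_functional a q (pcompose p [:0, q:])"
    by (rule poch_functional_bound[symmetric]) (simp add: degree_pcompose)
  also have "(\<Sum>k\<le>?N. coeff p k * q_pochhammer a q k) = poch_functional a q p"
    by (simp add: poch_functional_def)
  finally have 1: "poch_functional a q (pCons 0 p) =
      poch_functional a q p - a * poch_functional a q (pcompose p [:0, q:])" .
  have "[:1, -1:] * p = p + smult (-1) (pCons 0 p)" by simp
  then show ?thesis
    using 1 by (simp only: poch_functional_add poch_functional_smult) simp
qed

text \<open>The variable y stands for q^m. The shift removes the factor with d = 0 at the cost of a,
  and the substitution moves each remaining zero from q^(d + 1) to q^d, which leaves the same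
  product with one factor less.\<close>

lemma poch_functional_prod:
  assumes "q \<noteq> 0"
  shows "poch_functional a q (\<Prod>d<k. [:1, - (1 / q ^ d):]) = a ^ k"
proof (induction k)
  case 0
  then show ?case by (simp add: poch_functional_def q_pochhammer_def)
next
  case (Suc k)
  have "(\<Prod>d<Suc k. [:1, - (1 / q ^ d):]) = [:1, -1:] * (\<Prod>d<k. [:1, - (1 / q ^ Suc d):])"
    by (subst prod.lessThan_Suc_shift) simp
  moreover have "pcompose (\<Prod>d<k. [:1, - (1 / q ^ Suc d):]) [:0, q:] = (\<Prod>d<k. [:1, - (1 / q ^ d):])"
    using assms by (simp add: pcompose_prod pcompose_pCons)
  ultimately show ?case using Suc by (simp only: poch_functional_shift power_Suc)
qed

lemma sum_queries_pochhammer: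
  fixes q :: complex
  assumes q: "q \<noteq> 0" "q \<noteq> 1" and S: "finite S" and A: "chordal_ac_algorithm S A"
  shows "(\<Sum>\<pi> | partition_on S \<pi>. q ^ num_queries A \<pi>) =
    (q / (1 - q)) ^ card S * (\<Sum>k=0..card S. of_nat (card S choose k) * (-1) ^ k * q_pochhammer ((1 - q) / q) q k)"
proof -
  \<comment> \<open>\<open>s\<close> substitutes (1 - y) / (1 - q) for [m], where y = q^m. It turns
    \<open>q_factor q d\<close> into q / (1 - q) times 1 - y / q^d, so the value a^k from
    \<open>poch_functional_prod\<close> is normalised to 1 exactly when a = (1 - q) / q.\<close>
  define a where "a = (1 - q) / q"
  define s where "s = [:1 / (1 - q), - 1 / (1 - q):]"
  define L where "L p = poch_functional a q (pcompose p s)" for p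
  have base: "L (\<Prod>d<k. q_factor q d) = 1" for k
  proof -
    have *: "q / (q ^ d * r) - q * ((1 - q ^ d) / r) / q ^ d = q / r" if "r \<noteq> 0" for d r
      using q that by (simp add: field_simps)
    have "pcompose (q_factor q d) s = smult (q / (1 - q)) [:1, - (1 / q ^ d):]" for d
      using q *[of "1 - q" d]
      by (simp add: q_factor_def s_def pcompose_smult pcompose_pCons q_int_geometric mult.commute[of "1 - q"])
    then have "pcompose (\<Prod>d<k. q_factor q d) s = smult ((q / (1 - q)) ^ k) (\<Prod>d<k. [:1, - (1 / q ^ d):])"
      by (simp add: pcompose_prod prod_smult del: smult_pCons)
    then show ?thesis
      using q by (simp add: L_def poch_functional_smult poch_functional_prod[OF q(1)] a_def
          power_mult_distrib[symmetric])
  qed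
  have "(\<Sum>\<pi> | partition_on S \<pi>. q ^ num_queries A \<pi>) = L ([:0, q:] ^ card S)"
    by (rule sum_queries_functional[where L = L, OF q(1) _ _ base S A])
      (simp_all add: L_def pcompose_add pcompose_smult poch_functional_add poch_functional_smult)
  also have "pcompose ([:0, q:] ^ card S) s = smult ((q / (1 - q)) ^ card S) ([:1, -1:] ^ card S)"
  proof -
    have "pcompose [:0, q:] s = smult (q / (1 - q)) [:1, -1:]"
      by (simp add: s_def pcompose_pCons)
    moreover have "pcompose (p ^ n) s = pcompose p s ^ n" for p n
      by (induction n) (simp_all add: pcompose_mult pcompose_1)
    ultimately show ?thesis by (simp only: smult_power)
  qed
  then have "L ([:0, q:] ^ card S) = (q / (1 - q)) ^ card S * poch_functional a q ([:1, -1:] ^ card S)"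
    by (simp add: L_def poch_functional_smult)
  also have "poch_functional a q ([:1, -1:] ^ card S) =
      (\<Sum>k\<le>card S. coeff ([:1, -1:] ^ card S) k * q_pochhammer a q k)"
    using degree_power_le[of "[:1, -1 :: complex:]" "card S"] by (intro poch_functional_bound) simp
  also have "\<dots> = (\<Sum>k\<le>card S. of_nat (card S choose k) * (-1) ^ k * q_pochhammer a q k)"
    by (intro sum.cong refl) (simp add: coeff_linear_poly_power)
  finally show ?thesis by (simp add: a_def atLeast0AtMost)
qed

section \<open>The Dobinski functional\<close>

context
  fixes q :: complex
  assumes adm: "q_exp_admissible q"
begin

definition dobinski_weight :: "nat \<Rightarrow> complex" where
  "dobinski_weight m = (1 / q) ^ m / q_fact q m"

lemma q_nonzero: "q \<noteq> 0" and q_int_nonzero: "m \<ge> 1 \<Longrightarrow> q_int q m \<noteq> 0"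
  and summable_weight: "summable dobinski_weight" and suminf_weight: "suminf dobinski_weight \<noteq> 0"
  using adm unfolding q_exp_admissible_def q_exp_def dobinski_weight_def[abs_def] by auto

text \<open>At [m] the factor with index k is q [m - k], which cancels against the denominator of
  the weight at m - k and moves it to m - k - 1. For m = k it is zero, as [k] is the root of
  \<open>q_factor q k\<close>. The sum over m is then the same for all k.\<close>

lemma weight_falling:
  "poly (\<Prod>d<k. q_factor q d) (q_int q m) * dobinski_weight m =
     (if m < k then 0 else dobinski_weight (m - k))"
proof (induction k)
  case (Suc k)
  have "poly (\<Prod>d<Suc k. q_factor q d) (q_int q m) * dobinski_weight m =
      poly (q_factor q k) (q_int q m) * (if m < k then 0 else dobinski_weight (m - k))"
    unfolding Suc.IH[symmetric] by (simp add: mult_ac)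
  also have "\<dots> = (if m < Suc k then 0 else dobinski_weight (m - Suc k))"
  proof (cases "m < Suc k")
    case True
    then show ?thesis by (cases "m = k") (auto simp: q_factor_def)
  next
    case False
    then obtain j where m: "m = k + Suc j" by (metis add_Suc_right less_iff_Suc_add not_less_eq)
    have "q_int q m = q_int q k + q ^ k * q_int q (Suc j)"
      unfolding m by (rule q_int_add)
    then have "poly (q_factor q k) (q_int q m) = q * q_int q (Suc j)"
      using q_nonzero by (simp add: q_factor_def field_simps)
    moreover have "q * q_int q (Suc j) * dobinski_weight (Suc j) = dobinski_weight j"
      using q_nonzero q_int_nonzero[of "Suc j"]
      by (simp add: dobinski_weight_def q_fact_Suc)
    ultimately show ?thesis by (simp add: m)
  qed
  finally show ?case .
qed simp

lemma sums_weight_falling: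
  "(\<lambda>m. poly (\<Prod>d<k. q_factor q d) (q_int q m) * dobinski_weight m) sums suminf dobinski_weight"
proof -
  have "(\<lambda>m. (if m + k < k then 0 else dobinski_weight (m + k - k))) sums suminf dobinski_weight"
    using summable_weight by (simp add: summable_sums)
  then show ?thesis
    unfolding weight_falling by (subst (asm) sums_iff_shift) simp
qed

text \<open>Growth estimates for [m] with complex q are avoided: multiplication by [m] turns the
  product for k into a linear combination of the products for k + 1 and k. Induction on the
  polynomial, for all k at once, reduces everything to shifts of the convergent weight
  series.\<close>

lemma summable_poly_weight:
  "summable (\<lambda>m. poly p (q_int q m) * (poly (\<Prod>d<k. q_factor q d) (q_int q m) * dobinski_weight m))"
proof (induction p arbitrary: k)
  case (pCons c p)
  let ?b = "\<lambda>k m. poly (\<Prod>d<k. q_factor q d) (q_int q m) * dobinski_weight m"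
  have 1: "q_int q m * ?b k m = q ^ k / q * ?b (Suc k) m + q_int q k * ?b k m" for m
    using q_nonzero by (simp add: q_factor_def field_simps)
  have 2: "poly (pCons c p) x * A = c * A + poly p x * (x * A)" for x A
    by (simp add: algebra_simps)
  have eq: "poly (pCons c p) (q_int q m) * ?b k m = c * ?b k m +
      q ^ k / q * (poly p (q_int q m) * ?b (Suc k) m) + q_int q k * (poly p (q_int q m) * ?b k m)" for m
    unfolding 2 1 by (simp only: distrib_left mult.left_commute[of "poly p _"] add.assoc)
  show ?case unfolding eq
    by (intro summable_add summable_mult pCons.IH) (use sums_weight_falling sums_summable in blast)
qed simp

lemma sum_queries_dobinski:
  assumes S: "finite S" and A: "chordal_ac_algorithm S A"
  shows "summable (\<lambda>m. q_int q m ^ card S / q_fact q m * q powi (int (card S) - int m))"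
    and "(\<Sum>\<pi> | partition_on S \<pi>. q ^ num_queries A \<pi>) =
      1 / q_exp q (1 / q) * (\<Sum>m. q_int q m ^ card S / q_fact q m * q powi (int (card S) - int m))"
proof -
  define n where "n = card S"
  have sm: "summable (\<lambda>m. poly p (q_int q m) * dobinski_weight m)" for p
    using summable_poly_weight[of p 0] by simp
  define L where "L p = (\<Sum>m. poly p (q_int q m) * dobinski_weight m) / suminf dobinski_weight" for p
  have eq: "q_int q m ^ n / q_fact q m * q powi (int n - int m) = poly ([:0, q:] ^ n) (q_int q m) * dobinski_weight m" for m
    using q_nonzero
    by (simp add: dobinski_weight_def power_int_diff poly_power power_mult_distrib power_one_over field_simps)
  show "summable (\<lambda>m. q_int q m ^ card S / q_fact q m * q powi (int (card S) - int m))"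
    unfolding n_def[symmetric] eq by (rule sm)
  have "(\<Sum>\<pi> | partition_on S \<pi>. q ^ num_queries A \<pi>) = L ([:0, q:] ^ card S)"
  proof (rule sum_queries_functional[where L = L, OF q_nonzero _ _ _ S A])
    show "L (p + r) = L p + L r" for p r
      unfolding L_def add_divide_distrib[symmetric] using suminf_add[OF sm[of p] sm[of r]]
      by (simp add: algebra_simps)
    show "L (smult c p) = c * L p" for c p
      unfolding L_def using suminf_mult[OF sm[of p], of c] by (simp add: mult.assoc)
    show "L (\<Prod>d<k. q_factor q d) = 1" for k
      using sums_weight_falling[of k] suminf_weight unfolding L_def by (simp add: sums_iff)
  qed
  also have "\<dots> = 1 / q_exp q (1 / q) * (\<Sum>m. q_int q m ^ card S / q_fact q m * q powi (int (card S) - int m))"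
    unfolding n_def[symmetric] eq L_def q_exp_def dobinski_weight_def by simp
  finally show "(\<Sum>\<pi> | partition_on S \<pi>. q ^ num_queries A \<pi>) =
      1 / q_exp q (1 / q) * (\<Sum>m. q_int q m ^ card S / q_fact q m * q powi (int (card S) - int m))" .
qed

end

section \<open>Averages over uniform random partitions\<close>

lemma card_partitions_eq_bell:
  assumes "finite S"
  shows "card {\<pi>. partition_on S \<pi>} = bell (card S)"
proof -
  have le: "card {\<pi>. partition_on X \<pi>} \<le> card {\<pi>. partition_on Y \<pi>}"
    if "bij_betw f X Y" "finite Y" for f :: "'c \<Rightarrow> 'd" and X Y
  proof (rule card_inj_on_le)
    have inj: "inj_on f X" and im: "f ` X = Y" using that by (auto simp: bij_betw_def)
    show "finite {\<pi>. partition_on Y \<pi>}" using that finitely_many_partition_on by auto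
    show "(`) ((`) f) ` {\<pi>. partition_on X \<pi>} \<subseteq> {\<pi>. partition_on Y \<pi>}"
    proof (intro image_subsetI)
      fix \<pi> assume "\<pi> \<in> {\<pi>. partition_on X \<pi>}"
      then have p: "partition_on X \<pi>" by simp
      then have "(`) f ` \<pi> - {{}} = (`) f ` \<pi>" by (auto simp: partition_on_def)
      then show "(`) f ` \<pi> \<in> {\<pi>. partition_on Y \<pi>}"
        using partition_on_inj_image[OF p inj] im by simp
    qed
    have "inj_on ((`) f) (Pow X)" using inj by (rule inj_on_image_Pow)
    then have "inj_on ((`) ((`) f)) (Pow (Pow X))" by (rule inj_on_image_Pow)
    then show "inj_on ((`) ((`) f)) {\<pi>. partition_on X \<pi>}"
      by (rule inj_on_subset) (auto simp: partition_on_def)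
  qed
  obtain f where f: "bij_betw f {..<card S} S"
    using assms by (metis ex_bij_betw_nat_finite lessThan_atLeast0)
  then have "bij_betw (inv_into {..<card S} f) S {..<card S}" by (rule bij_betw_inv_into)
  then show ?thesis
    using le[OF f assms] le[of "inv_into {..<card S} f" S "{..<card S}"] by (simp add: bell_def)
qed

lemma partitions_nonempty: "finite S \<Longrightarrow> finite {\<pi>. partition_on S \<pi>}" "{\<pi>. partition_on S \<pi>} \<noteq> {}"
proof -
  have "partition_on S ((\<lambda>s. {s}) ` S)" by (rule partition_onI) auto
  then show "{\<pi>. partition_on S \<pi>} \<noteq> {}" by blast
qed (rule finitely_many_partition_on)

lemma expectation_random_partition:
  fixes f :: "'a set set \<Rightarrow> 'b::{banach, second_countable_topology, real_normed_field}"
  assumes "finite S"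
  shows "measure_pmf.expectation (random_partition S) f =
    1 / of_nat (bell (card S)) * (\<Sum>\<pi> | partition_on S \<pi>. f \<pi>)"
  unfolding random_partition_def using partitions_nonempty[of S] assms
  by (subst integral_measure_pmf[of "{\<pi>. partition_on S \<pi>}"])
    (simp_all add: card_partitions_eq_bell scaleR_conv_of_real sum_distrib_left)

section \<open>Convergence of moment generating functions\<close>

text \<open>Curtiss's continuity theorem for finitely supported laws, whose transforms
  \<open>\<phi> n\<close> are entire. The values at R and -R bound \<open>\<phi> n\<close> on the
  whole disc of radius R, which gives the local boundedness required by Montel's theorem.\<close>

lemma mgf_convergence_imp_weak_conv:
  fixes p :: "nat \<Rightarrow> 'a pmf" and X :: "nat \<Rightarrow> 'a \<Rightarrow> real"
  assumes fin: "\<And>n. finite (set_pmf (p n))"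
    and lim: "\<And>t. (\<lambda>n. measure_pmf.expectation (p n) (\<lambda>\<omega>. exp (t * X n \<omega>))) \<longlonglongrightarrow> exp (t\<^sup>2 / 2)"
  shows "weak_conv_m (\<lambda>n. distr (measure_pmf (p n)) borel (X n)) std_normal_distribution"
proof (rule levy_continuity)
  show "real_distribution (distr (measure_pmf (p n)) borel (X n))" for n
    by (rule prob_space.real_distribution_distr[OF measure_pmf.prob_space_axioms]) simp
  show "real_distribution std_normal_distribution"
    by (rule real_dist_normal_dist)
  define \<phi> where "\<phi> n z = (\<Sum>\<omega>\<in>set_pmf (p n). of_real (pmf (p n) \<omega>) * exp (z * of_real (X n \<omega>)))" for n and z :: complex
  define m where "m n t = measure_pmf.expectation (p n) (\<lambda>\<omega>. exp (t * X n \<omega>))" for n t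
  have m: "m n t = (\<Sum>\<omega>\<in>set_pmf (p n). pmf (p n) \<omega> * exp (t * X n \<omega>))" for n t
    unfolding m_def by (subst integral_measure_pmf[OF fin[of n]]) auto
  have \<phi>m: "\<phi> n (of_real t) = of_real (m n t)" for n t
    by (simp add: \<phi>_def m exp_of_real[symmetric])
  have char: "char (distr (measure_pmf (p n)) borel (X n)) t = \<phi> n (\<i> * of_real t)" for n t
    unfolding char_def \<phi>_def
    by (subst integral_distr, simp, simp, subst integral_measure_pmf[OF fin[of n]])
       (auto simp: scaleR_conv_of_real mult_ac)
  have hol: "\<phi> n holomorphic_on UNIV" for n
    unfolding \<phi>_def by (intro holomorphic_intros)
  have bd: "norm (\<phi> n z) \<le> m n R + m n (- R)" if "norm z \<le> R" for n z R
  proof -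
    have "norm (\<phi> n z) \<le> (\<Sum>\<omega>\<in>set_pmf (p n). pmf (p n) \<omega> * (exp (R * X n \<omega>) + exp (- R * X n \<omega>)))"
      unfolding \<phi>_def
    proof (rule sum_norm_le)
      fix \<omega>
      have "\<bar>Re z * X n \<omega>\<bar> \<le> R * \<bar>X n \<omega>\<bar>"
        using that abs_Re_le_cmod[of z] by (simp add: abs_mult mult_right_mono)
      then have "exp (Re z * X n \<omega>) \<le> exp (R * X n \<omega>) \<or> exp (Re z * X n \<omega>) \<le> exp (- R * X n \<omega>)"
        by (cases "X n \<omega> \<ge> 0") auto
      then have "exp (Re z * X n \<omega>) \<le> exp (R * X n \<omega>) + exp (- R * X n \<omega>)"
        by (meson add_increasing add_increasing2 exp_ge_zero order_trans)
      then show "norm (of_real (pmf (p n) \<omega>) * exp (z * of_real (X n \<omega>))) \<le>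
          pmf (p n) \<omega> * (exp (R * X n \<omega>) + exp (- R * X n \<omega>))"
        by (simp add: norm_mult mult_left_mono)
    qed
    also have "\<dots> = m n R + m n (- R)"
      by (simp add: m distrib_left sum.distrib)
    finally show ?thesis .
  qed
  have m_bd: "\<exists>B. \<forall>n. m n t \<le> B" for t
  proof -
    have "Bseq (\<lambda>n. m n t)" unfolding m_def using lim by (intro convergent_imp_Bseq convergentI)
    then show ?thesis by (auto simp: Bseq_def) (meson abs_le_D1)
  qed
  show "(\<lambda>n. char (distr (measure_pmf (p n)) borel (X n)) t) \<longlonglongrightarrow> char std_normal_distribution t" for t
    unfolding char char_std_normal_distribution
  proof (rule ccontr)
    \<comment> \<open>Failure of convergence leaves a subsequence at distance at least e. Montel's
      theorem extracts a convergent one from it, and the known values on the real axis identify its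
      limit as exp (z^2 / 2).\<close>
    assume "\<not> (\<lambda>n. \<phi> n (\<i> * of_real t)) \<longlonglongrightarrow> of_real (exp (- (t\<^sup>2) / 2))"
    then obtain e where e: "e > 0"
        "\<not> (\<forall>\<^sub>F n in sequentially. dist (\<phi> n (\<i> * of_real t)) (of_real (exp (- (t\<^sup>2) / 2))) < e)"
      unfolding tendsto_iff by blast
    then obtain r :: "nat \<Rightarrow> nat" where r: "strict_mono r"
        "\<And>n. \<not> dist (\<phi> (r n) (\<i> * of_real t)) (of_real (exp (- (t\<^sup>2) / 2))) < e"
      using not_eventually_sequentiallyD by metis
    have bounded: "\<exists>B. \<forall>h\<in>range \<phi>. \<forall>z\<in>K. norm (h z) \<le> B" if K: "compact K" for K
    proof -
      obtain R where R: "\<And>z. z \<in> K \<Longrightarrow> norm z \<le> R"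
        using compact_imp_bounded[OF K] by (auto simp: bounded_iff)
      obtain B C where "\<And>n. m n R \<le> B" "\<And>n. m n (- R) \<le> C" using m_bd by metis
      then have "norm (\<phi> n z) \<le> B + C" if "z \<in> K" for n z
        using bd[OF R[OF that], of n] by (meson add_mono order_trans)
      then show ?thesis by blast
    qed
    obtain g r' where g: "g holomorphic_on UNIV" and r': "strict_mono (r' :: nat \<Rightarrow> nat)"
      and conv: "\<And>z. (\<lambda>k. \<phi> (r (r' k)) z) \<longlonglongrightarrow> g z"
      by (rule Montel[of UNIV "range \<phi>" "\<lambda>k. \<phi> (r k)"]) (use hol bounded in auto)
    have sub: "strict_mono (\<lambda>k. r (r' k))" using r r' by (simp add: strict_mono_def)
    have real: "g (of_real x) = exp (of_real x ^ 2 / 2)" for x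
    proof (rule LIMSEQ_unique[OF conv])
      have "(\<lambda>k. m (r (r' k)) x) \<longlonglongrightarrow> exp (x\<^sup>2 / 2)"
        using LIMSEQ_subseq_LIMSEQ[OF lim[of x] sub] by (simp add: m_def o_def)
      then show "(\<lambda>k. \<phi> (r (r' k)) (of_real x)) \<longlonglongrightarrow> exp (of_real x ^ 2 / 2)"
        unfolding \<phi>m by (subst of_real_power[symmetric], subst of_real_numeral[symmetric],
          subst of_real_divide[symmetric], subst exp_of_real) (rule tendsto_of_real)
    qed
    have "g (\<i> * of_real t) - exp ((\<i> * of_real t)\<^sup>2 / 2) = 0"
    proof (rule analytic_continuation[of "\<lambda>z. g z - exp (z\<^sup>2 / 2)" UNIV \<real> 0])
      show "(\<lambda>z. g z - exp (z\<^sup>2 / 2)) holomorphic_on UNIV"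
        using g by (intro holomorphic_intros) auto
      show "0 islimpt (\<real> :: complex set)"
        unfolding islimpt_approachable
      proof (intro allI impI)
        fix e :: real assume "e > 0"
        then show "\<exists>x'\<in>\<real>. x' \<noteq> (0 :: complex) \<and> dist x' 0 < e"
          by (intro bexI[of _ "of_real (e / 2)"]) auto
      qed
      show "g z - exp (z\<^sup>2 / 2) = 0" if "z \<in> \<real>" for z
        using that real by (auto elim!: Reals_cases)
    qed auto
    then have "g (\<i> * of_real t) = of_real (exp (- (t\<^sup>2) / 2))"
      by (simp add: power_mult_distrib exp_of_real[symmetric])
    then have "(\<lambda>k. \<phi> (r (r' k)) (\<i> * of_real t)) \<longlonglongrightarrow> of_real (exp (- (t\<^sup>2) / 2))"
      using conv[of "\<i> * of_real t"] by simp
    then have "\<forall>\<^sub>F k in sequentially. dist (\<phi> (r (r' k)) (\<i> * of_real t)) (of_real (exp (- (t\<^sup>2) / 2))) < e"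
      using e(1) by (rule tendstoD)
    then show False using r(2) by (auto dest: eventually_happens)
  qed
qed

section \<open>Sums with approximately Gaussian ratios\<close>

text \<open>Write c (K - 1) as c K - c: every step costs c, and only the first p steps may gain c K.
  Both one-sided tail bounds in \<open>h_bound\<close> are instances.\<close>

lemma eventual_decrease_bound:
  fixes f :: "nat \<Rightarrow> real"
  assumes "\<And>k. k < N \<Longrightarrow> f (Suc k) - f k \<le> c * (K - 1)"
    and "\<And>k. p \<le> k \<Longrightarrow> k < N \<Longrightarrow> f (Suc k) - f k \<le> - c"
    and "c \<ge> 0" "K \<ge> 0"
  shows "k \<le> N \<Longrightarrow> f k - f 0 \<le> c * K * p - c * k"
proof -
  have "k \<le> N \<Longrightarrow> f k - f 0 \<le> c * K * min k p - c * k"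
  proof (induction k)
    case (Suc k)
    then have IH: "f k - f 0 \<le> c * K * min k p - c * k" by simp
    show ?case
    proof (cases "p \<le> k")
      case True
      then have "min (Suc k) p = min k p" by simp
      then show ?thesis using IH assms(2)[OF True] Suc.prems by (simp add: algebra_simps)
    next
      case False
      then have "min (Suc k) p = Suc k" "min k p = k" by simp_all
      then show ?thesis using IH assms(1)[of k] Suc.prems by (simp add: algebra_simps)
    qed
  qed simp
  moreover assume "k \<le> N"
  moreover have "c * K * min k p \<le> c * K * p" using assms(3,4) by (intro mult_left_mono) auto
  ultimately show ?thesis by linarith
qed

text \<open>For u < 0 the index is truncated to 0, so \<open>f 0 = 0\<close> keeps the negative
  half-line from contributing. In \<open>ennreal\<close> no summability is required; it follows
  later from the finiteness of the integral.\<close>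

lemma nn_integral_step_function:
  fixes f :: "nat \<Rightarrow> real"
  assumes "f 0 = 0" "\<And>m. 0 \<le> f m"
  shows "(\<integral>\<^sup>+(u::real). ennreal (f (nat \<lfloor>u\<rfloor>)) \<partial>lborel) = (\<Sum>m. ennreal (f m))"
proof -
  have "ennreal (f (nat \<lfloor>u\<rfloor>)) = (\<Sum>m. ennreal (f m) * indicator {real m..<real m + 1} u)" for u
  proof -
    have "ennreal (f m) * indicator {real m..<real m + 1} u =
        (if m = nat \<lfloor>u\<rfloor> then ennreal (f (nat \<lfloor>u\<rfloor>)) else 0)" for m
    proof (cases "u \<ge> 0")
      case True
      have "u \<in> {real m..<real m + 1} \<longleftrightarrow> m = nat \<lfloor>u\<rfloor>"
        using True by (auto simp: nat_eq_iff2 floor_eq_iff)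
      then show ?thesis by (auto simp: indicator_def)
    next
      case False
      then show ?thesis using assms(1) by (auto simp: indicator_def)
    qed
    then show ?thesis
      using suminf_finite[of "{nat \<lfloor>u\<rfloor>}" "\<lambda>m. ennreal (f m) * indicator {real m..<real m + 1} u"]
      by simp
  qed
  then have "(\<integral>\<^sup>+(u::real). ennreal (f (nat \<lfloor>u\<rfloor>)) \<partial>lborel) =
      (\<Sum>m. \<integral>\<^sup>+u. ennreal (f m) * indicator {real m..<real m + 1} u \<partial>lborel)"
    by (simp add: nn_integral_suminf)
  also have "\<dots> = (\<Sum>m. ennreal (f m))"
    by (simp add: nn_integral_cmult)
  finally show ?thesis .
qed

lemma integrable_inverse_1_plus_sq: "integrable lborel (\<lambda>x::real. inverse (1 + x\<^sup>2))"
  using integrable_inverse_1_plus_square by (simp add: set_integrable_def)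

text \<open>Exchanges the exponential tail for one of Cauchy type, whose integrability is
  \<open>integrable_inverse_1_plus_sq\<close>.\<close>

lemma exp_minus_abs_le: "exp (- \<bar>x\<bar>) \<le> 2 * inverse (1 + x\<^sup>2)" for x :: real
proof -
  have "1 + \<bar>x\<bar> + x\<^sup>2 / 2 \<le> exp \<bar>x\<bar>"
    using exp_lower_Taylor_quadratic[of "\<bar>x\<bar>"] by simp
  then have "(1 + x\<^sup>2) / 2 \<le> exp \<bar>x\<bar>" by simp
  moreover have "0 < (1 + x\<^sup>2) / 2" by (simp add: add_pos_nonneg)
  ultimately have "inverse (exp \<bar>x\<bar>) \<le> inverse ((1 + x\<^sup>2) / 2)" by (rule le_imp_inverse_le)
  then show ?thesis by (simp add: exp_minus field_simps)
qed

lemma gaussian_shift_integral: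
  "(\<integral>x. exp (\<beta> * x - x\<^sup>2 / 2) \<partial>lborel) = sqrt (2 * pi) * exp (\<beta>\<^sup>2 / 2)"
proof -
  have "exp (\<beta> * x - x\<^sup>2 / 2) = sqrt (2 * pi) * exp (\<beta>\<^sup>2 / 2) * normal_density \<beta> 1 x" for x
    by (simp add: normal_density_def exp_add[symmetric] power2_eq_square field_simps)
  then show ?thesis by (simp add: integral_normal_density)
qed

text \<open>Laplace's method for sums, in terms of the logarithms \<open>l\<close> of the ratios of
  consecutive terms. The slope -1 / s^2 near \<mu> gives a Gaussian of width s, and the offset
  \<beta> / s displaces its maximum by \<beta> s. The linear approximation is available in windows
  of a fixed multiple of s; beyond them the monotonicity of \<open>l\<close> controls the
  terms.\<close>

locale gaussian_ratios =
  fixes a l :: "nat \<Rightarrow> nat \<Rightarrow> real" and \<mu> s :: "nat \<Rightarrow> real" and \<beta> :: real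
  assumes a_0: "a n 0 = 0"
    and a_pos: "m \<ge> 1 \<Longrightarrow> a n m > 0"
    and a_step: "m \<ge> 1 \<Longrightarrow> a n (Suc m) = a n m * exp (l n m)"
    and l_decreasing: "1 \<le> i \<Longrightarrow> i \<le> j \<Longrightarrow> l n j \<le> l n i"
    and s_pos: "s n > 0"
    and s_lim: "filterlim s at_top sequentially"
    and \<mu>_lim: "filterlim (\<lambda>n. \<mu> n / s n) at_top sequentially"
    and l_approx: "\<epsilon> > 0 \<Longrightarrow> eventually (\<lambda>n. \<forall>j. \<bar>real j - \<mu> n\<bar> \<le> K * s n \<longrightarrow>
        \<bar>s n * l n j - (\<beta> - (real j - \<mu> n) / s n)\<bar> \<le> \<epsilon>) sequentially"
begin

definition m0 :: "nat \<Rightarrow> nat" where "m0 n = nat \<lfloor>\<mu> n\<rfloor>"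

text \<open>Discrete antiderivative of the approximate log-ratios, see \<open>Q_step\<close>.\<close>

definition Q :: "nat \<Rightarrow> nat \<Rightarrow> real" where
  "Q n k = \<beta> * real k / s n - ((real k - \<mu> n)\<^sup>2 - real k) / (2 * (s n)\<^sup>2)"

lemma Q_step: "Q n (Suc k) - Q n k = (\<beta> - (real k - \<mu> n) / s n) / s n"
  using s_pos[of n] by (simp add: Q_def field_simps power2_eq_square)

lemma ln_a_step: "m \<ge> 1 \<Longrightarrow> ln (a n (Suc m)) - ln (a n m) = l n m"
  using a_pos[of m n] by (simp add: a_step ln_mult)

lemma a_nonneg: "a n m \<ge> 0"
  using a_pos[of m n] a_0[of n] by (cases m) (auto intro: less_imp_le)

lemma eventually_\<mu>_ge: "eventually (\<lambda>n. K * s n + c \<le> \<mu> n) sequentially"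
proof -
  have "eventually (\<lambda>n. s n \<ge> \<bar>c\<bar>) sequentially" "eventually (\<lambda>n. \<mu> n / s n \<ge> K + 1) sequentially"
    using s_lim \<mu>_lim by (auto simp: filterlim_at_top)
  then show ?thesis
  proof eventually_elim
    case (elim n)
    have "(K + 1) * s n \<le> \<mu> n" using elim(2) s_pos[of n] by (simp add: field_simps)
    then show ?case using elim(1) by (simp add: algebra_simps)
  qed
qed

text \<open>Telescoping: each of the k - i steps has an error of at most \<epsilon> / s, and a
  window contains of the order of s steps, so the total error is of order \<epsilon>.\<close>

lemma ln_a_approx:
  assumes "\<forall>j. \<bar>real j - \<mu> n\<bar> \<le> K * s n \<longrightarrow> \<bar>s n * l n j - (\<beta> - (real j - \<mu> n) / s n)\<bar> \<le> \<epsilon>"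
    and i: "i \<ge> 1" "\<bar>real i - \<mu> n\<bar> \<le> K * s n"
  shows "i \<le> k \<Longrightarrow> \<bar>real k - \<mu> n\<bar> \<le> K * s n \<Longrightarrow>
    \<bar>(ln (a n k) - ln (a n i)) - (Q n k - Q n i)\<bar> \<le> \<epsilon> * (real k - real i) / s n"
proof (induction k rule: dec_induct)
  case (step k)
  have k: "\<bar>real k - \<mu> n\<bar> \<le> K * s n" using step i by (auto simp: abs_le_iff)
  have "\<bar>s n * l n k - (\<beta> - (real k - \<mu> n) / s n)\<bar> \<le> \<epsilon>" using assms(1) k by blast
  then have "\<bar>l n k - (\<beta> - (real k - \<mu> n) / s n) / s n\<bar> \<le> \<epsilon> / s n"
    using s_pos[of n] by (simp add: abs_le_iff field_simps)
  then have "\<bar>(ln (a n (Suc k)) - ln (a n k)) - (Q n (Suc k) - Q n k)\<bar> \<le> \<epsilon> / s n"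
    using ln_a_step[of k n] Q_step[of n k] i(1) step(1) by simp
  moreover have "\<epsilon> * (real (Suc k) - real i) / s n = \<epsilon> * (real k - real i) / s n + \<epsilon> / s n"
    using s_pos[of n] by (simp add: field_simps)
  ultimately show ?case using step.IH[OF k] by linarith
qed simp

lemma floor_div_tendsto:
  "(\<lambda>n. (real (nat \<lfloor>\<mu> n + x * s n\<rfloor>) - \<mu> n) / s n) \<longlonglongrightarrow> x"
proof (rule tendsto_sandwich)
  have inv: "(\<lambda>n. 1 / s n) \<longlonglongrightarrow> 0"
    using s_lim by (intro tendsto_divide_0[OF tendsto_const] filterlim_at_top_imp_at_infinity)
  show "(\<lambda>n. x - 1 / s n) \<longlonglongrightarrow> x" using tendsto_diff[OF tendsto_const inv, of x] by simp
  show "(\<lambda>n. x) \<longlonglongrightarrow> x" by simp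
  have ev: "eventually (\<lambda>n. 0 \<le> \<mu> n + x * s n) sequentially"
    using eventually_\<mu>_ge[of "-x" 0] by eventually_elim simp
  show "eventually (\<lambda>n. x - 1 / s n \<le> (real (nat \<lfloor>\<mu> n + x * s n\<rfloor>) - \<mu> n) / s n) sequentially"
    using ev
  proof eventually_elim
    case (elim n)
    have "x * s n - 1 \<le> real (nat \<lfloor>\<mu> n + x * s n\<rfloor>) - \<mu> n" using elim by linarith
    then have "(x * s n - 1) / s n \<le> (real (nat \<lfloor>\<mu> n + x * s n\<rfloor>) - \<mu> n) / s n"
      using s_pos[of n] by (intro divide_right_mono) auto
    then show ?case using s_pos[of n] by (simp add: diff_divide_distrib)
  qed
  show "eventually (\<lambda>n. (real (nat \<lfloor>\<mu> n + x * s n\<rfloor>) - \<mu> n) / s n \<le> x) sequentially"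
    using ev
  proof eventually_elim
    case (elim n)
    have "real (nat \<lfloor>\<mu> n + x * s n\<rfloor>) - \<mu> n \<le> x * s n" using elim by linarith
    then show ?case using s_pos[of n] by (simp add: pos_divide_le_eq)
  qed
qed

definition h :: "nat \<Rightarrow> real \<Rightarrow> real" where
  "h n x = a n (nat \<lfloor>\<mu> n + x * s n\<rfloor>) / a n (m0 n)"

lemma eventually_m0_ge_1: "eventually (\<lambda>n. m0 n \<ge> 1) sequentially"
  using eventually_\<mu>_ge[of 0 1] unfolding m0_def by eventually_elim linarith

lemma h_tendsto: "(\<lambda>n. h n x) \<longlonglongrightarrow> exp (\<beta> * x - x\<^sup>2 / 2)"
proof -
  define m where "m n = nat \<lfloor>\<mu> n + x * s n\<rfloor>" for n
  define d where "d n = (real (m n) - real (m0 n)) / s n" for n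
  have m_lim: "(\<lambda>n. (real (m n) - \<mu> n) / s n) \<longlonglongrightarrow> x"
    unfolding m_def by (rule floor_div_tendsto)
  have m0_lim: "(\<lambda>n. (real (m0 n) - \<mu> n) / s n) \<longlonglongrightarrow> 0"
    unfolding m0_def using floor_div_tendsto[of 0] by simp
  have d_lim: "d \<longlonglongrightarrow> x"
    using tendsto_diff[OF m_lim m0_lim] by (simp add: d_def[abs_def] diff_divide_distrib)
  have inv: "(\<lambda>n. 1 / s n) \<longlonglongrightarrow> 0"
    using s_lim by (intro tendsto_divide_0[OF tendsto_const] filterlim_at_top_imp_at_infinity)
  have Q_lim: "(\<lambda>n. Q n (m n) - Q n (m0 n)) \<longlonglongrightarrow> \<beta> * x - x\<^sup>2 / 2"
  proof -
    have "Q n (m n) - Q n (m0 n) = \<beta> * d n - (((real (m n) - \<mu> n) / s n)\<^sup>2 - ((real (m0 n) - \<mu> n) / s n)\<^sup>2 - d n * (1 / s n)) / 2" for n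
      using s_pos[of n] by (simp add: Q_def d_def field_simps power2_eq_square)
    moreover have "(\<lambda>n. \<beta> * d n - (((real (m n) - \<mu> n) / s n)\<^sup>2 - ((real (m0 n) - \<mu> n) / s n)\<^sup>2 - d n * (1 / s n)) / 2)
        \<longlonglongrightarrow> \<beta> * x - (x\<^sup>2 - 0\<^sup>2 - x * 0) / 2"
      by (intro tendsto_intros d_lim m_lim m0_lim inv) simp_all
    ultimately show ?thesis by simp
  qed
  define K where "K = \<bar>x\<bar> + 1"
  have in_window: "eventually (\<lambda>n. \<bar>real (m n) - \<mu> n\<bar> \<le> K * s n \<and> \<bar>real (m0 n) - \<mu> n\<bar> \<le> K * s n \<and> \<bar>d n\<bar> \<le> K) sequentially"
  proof -
    have "eventually (\<lambda>n. \<bar>(real (m n) - \<mu> n) / s n\<bar> < K) sequentially"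
      "eventually (\<lambda>n. \<bar>(real (m0 n) - \<mu> n) / s n\<bar> < K) sequentially"
      "eventually (\<lambda>n. \<bar>d n\<bar> < K) sequentially"
      using order_tendstoD(2)[OF tendsto_rabs[OF m_lim], of K] order_tendstoD(2)[OF tendsto_rabs[OF m0_lim], of K]
        order_tendstoD(2)[OF tendsto_rabs[OF d_lim], of K] by (auto simp: K_def)
    then show ?thesis
    proof eventually_elim
      case (elim n)
      then show ?case using s_pos[of n] by (simp add: abs_divide pos_divide_less_eq)
    qed
  qed
  have m_ge: "eventually (\<lambda>n. m n \<ge> 1) sequentially"
    using eventually_\<mu>_ge[of "-x" 1] unfolding m_def by eventually_elim linarith
  have "(\<lambda>n. (ln (a n (m n)) - ln (a n (m0 n))) - (Q n (m n) - Q n (m0 n))) \<longlonglongrightarrow> 0"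
    unfolding tendsto_iff
  proof (intro allI impI)
    fix e :: real assume e: "e > 0"
    \<comment> \<open>The accumulated error is at most \<epsilon> times |d n|, hence at most
      \<epsilon> K = e / 2.\<close>
    define \<epsilon> where "\<epsilon> = e / (2 * K)"
    have K: "K > 0" by (simp add: K_def)
    have \<epsilon>: "\<epsilon> > 0" using e K by (simp add: \<epsilon>_def)
    show "eventually (\<lambda>n. dist ((ln (a n (m n)) - ln (a n (m0 n))) - (Q n (m n) - Q n (m0 n))) 0 < e) sequentially"
      using l_approx[OF \<epsilon>, of K] in_window m_ge eventually_m0_ge_1
    proof eventually_elim
      case (elim n)
      have "\<bar>(ln (a n (m n)) - ln (a n (m0 n))) - (Q n (m n) - Q n (m0 n))\<bar> \<le> \<epsilon> * \<bar>d n\<bar>"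
      proof (cases "m0 n \<le> m n")
        case True
        then have "\<bar>d n\<bar> = (real (m n) - real (m0 n)) / s n" using s_pos[of n] by (simp add: d_def)
        then show ?thesis using ln_a_approx[OF elim(1) elim(4) _ True] elim(2) by simp
      next
        case False
        then have "\<bar>d n\<bar> = (real (m0 n) - real (m n)) / s n" using s_pos[of n] by (simp add: d_def abs_divide)
        then show ?thesis using ln_a_approx[OF elim(1) elim(3), of "m0 n"] elim(2) False
          by (simp add: abs_le_iff)
      qed
      also have "\<dots> \<le> \<epsilon> * K" using elim(2) \<epsilon> by (intro mult_left_mono) auto
      also have "\<dots> < e" using e K by (simp add: \<epsilon>_def)
      finally show ?case by simp
    qed
  qed
  from tendsto_add[OF this Q_lim]
  have "(\<lambda>n. ln (a n (m n)) - ln (a n (m0 n))) \<longlonglongrightarrow> \<beta> * x - x\<^sup>2 / 2" by simp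
  then have "(\<lambda>n. exp (ln (a n (m n)) - ln (a n (m0 n)))) \<longlonglongrightarrow> exp (\<beta> * x - x\<^sup>2 / 2)"
    by (rule tendsto_exp)
  moreover have "eventually (\<lambda>n. exp (ln (a n (m n)) - ln (a n (m0 n))) = h n x) sequentially"
    using m_ge eventually_m0_ge_1
    by eventually_elim (simp add: h_def m_def[symmetric] exp_diff a_pos)
  ultimately show ?thesis by (rule Lim_transform_eventually)
qed

lemma h_bound:
  obtains C where "eventually (\<lambda>n. \<forall>x. h n x \<le> C * exp (- \<bar>x\<bar>)) sequentially"
proof -
  \<comment> \<open>At distance (|\<beta>| + 2) s from the centre, the linear approximation of s l
    is at most -2 on the right and at least 2 on the left. The error 1 leaves -1 and 1, and by
    monotonicity these bounds persist outwards. The window exceeds this distance by 2 s to absorb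
    rounding, and K - 1 bounds |s l| at \<open>m0 n\<close>.\<close>
  define K where "K = \<bar>\<beta>\<bar> + 4"
  \<comment> \<open>Decay sets in after at most (K + 1) s steps from \<open>m0 n\<close>, and the
    gain before that is at most K (K + 1). The summand 2 pays for the two roundings, of the centre
    to \<open>m0 n\<close> and of \<mu> + x s to \<open>m\<close>.\<close>
  define C where "C = exp (K * (K + 1) + 2)"
  have "eventually (\<lambda>n. s n \<ge> 1) sequentially" using s_lim by (auto simp: filterlim_at_top)
  then have "eventually (\<lambda>n. \<forall>x. h n x \<le> C * exp (- \<bar>x\<bar>)) sequentially"
    using l_approx[of 1 K, OF zero_less_one] eventually_m0_ge_1 eventually_\<mu>_ge[of K 1]
  proof eventually_elim
    case (elim n)
    note s1 = elim(1) and ap = elim(2)[rule_format] and m01 = elim(3) and \<mu>K = elim(4)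
    have s: "s n > 0" by (rule s_pos)
    have Ks: "K * s n \<ge> K" using s1 mult_left_mono[of 1 "s n" K] by (simp add: K_def)
    then have \<mu>4: "\<mu> n \<ge> 4" using \<mu>K by (simp add: K_def)
    have m0: "\<mu> n - 1 \<le> real (m0 n)" "real (m0 n) \<le> \<mu> n"
      using \<mu>4 unfolding m0_def by linarith+
    have l_m0: "\<bar>s n * l n (m0 n) - (\<beta> - (real (m0 n) - \<mu> n) / s n)\<bar> \<le> 1"
      using m0 Ks by (intro ap) (simp add: K_def)
    have frac: "0 \<le> - (real (m0 n) - \<mu> n) / s n" "- (real (m0 n) - \<mu> n) / s n \<le> 1"
      using m0 s s1 by (simp_all add: divide_simps)
    define c where "c = 1 / s n"
    have c: "c > 0" "c \<le> 1" using s s1 by (auto simp: c_def)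
    define p where "p = nat \<lceil>\<mu> n + (\<bar>\<beta>\<bar> + 2) * s n\<rceil> - m0 n"
    define pl where "pl = m0 n - nat \<lfloor>\<mu> n - (\<bar>\<beta>\<bar> + 2) * s n\<rfloor>"
    have up: "real (nat \<lceil>\<mu> n + (\<bar>\<beta>\<bar> + 2) * s n\<rceil>) \<ge> \<mu> n + (\<bar>\<beta>\<bar> + 2) * s n"
      "real (nat \<lceil>\<mu> n + (\<bar>\<beta>\<bar> + 2) * s n\<rceil>) \<le> \<mu> n + (\<bar>\<beta>\<bar> + 2) * s n + 1"
    proof -
      have "\<mu> n + (\<bar>\<beta>\<bar> + 2) * s n \<ge> 0" using \<mu>4 s by simp
      then show "real (nat \<lceil>\<mu> n + (\<bar>\<beta>\<bar> + 2) * s n\<rceil>) \<ge> \<mu> n + (\<bar>\<beta>\<bar> + 2) * s n"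
        "real (nat \<lceil>\<mu> n + (\<bar>\<beta>\<bar> + 2) * s n\<rceil>) \<le> \<mu> n + (\<bar>\<beta>\<bar> + 2) * s n + 1" by linarith+
    qed
    have lo: "real (nat \<lfloor>\<mu> n - (\<bar>\<beta>\<bar> + 2) * s n\<rfloor>) \<le> \<mu> n - (\<bar>\<beta>\<bar> + 2) * s n"
      "real (nat \<lfloor>\<mu> n - (\<bar>\<beta>\<bar> + 2) * s n\<rfloor>) \<ge> \<mu> n - (\<bar>\<beta>\<bar> + 2) * s n - 1"
      "nat \<lfloor>\<mu> n - (\<bar>\<beta>\<bar> + 2) * s n\<rfloor> \<ge> 1"
    proof -
      have "\<mu> n - (\<bar>\<beta>\<bar> + 2) * s n \<ge> 1" using \<mu>K s by (simp add: K_def algebra_simps)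
      then show "real (nat \<lfloor>\<mu> n - (\<bar>\<beta>\<bar> + 2) * s n\<rfloor>) \<le> \<mu> n - (\<bar>\<beta>\<bar> + 2) * s n"
        "real (nat \<lfloor>\<mu> n - (\<bar>\<beta>\<bar> + 2) * s n\<rfloor>) \<ge> \<mu> n - (\<bar>\<beta>\<bar> + 2) * s n - 1"
        "nat \<lfloor>\<mu> n - (\<bar>\<beta>\<bar> + 2) * s n\<rfloor> \<ge> 1" by linarith+
    qed
    let ?u = "nat \<lceil>\<mu> n + (\<bar>\<beta>\<bar> + 2) * s n\<rceil>" and ?v = "nat \<lfloor>\<mu> n - (\<bar>\<beta>\<bar> + 2) * s n\<rfloor>"
    have bs: "0 \<le> (\<bar>\<beta>\<bar> + 2) * s n" using s by simp
    have Ksplit: "K * s n = (\<bar>\<beta>\<bar> + 2) * s n + 2 * s n" by (simp add: K_def algebra_simps)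
    have lu: "s n * l n ?u \<le> - 1"
    proof -
      have "\<bar>s n * l n ?u - (\<beta> - (real ?u - \<mu> n) / s n)\<bar> \<le> 1"
        by (rule ap) (use up s1 bs Ksplit in linarith)
      moreover have "(real ?u - \<mu> n) / s n \<ge> \<bar>\<beta>\<bar> + 2" using up(1) s by (simp add: field_simps)
      ultimately show ?thesis by linarith
    qed
    have lv: "s n * l n ?v \<ge> 1"
    proof -
      have "\<bar>s n * l n ?v - (\<beta> - (real ?v - \<mu> n) / s n)\<bar> \<le> 1"
        by (rule ap) (use lo s1 bs Ksplit in linarith)
      moreover have "(real ?v - \<mu> n) / s n \<le> - (\<bar>\<beta>\<bar> + 2)" using lo(1) s by (simp add: field_simps)
      ultimately show ?thesis by linarith
    qed
    have sl: "l n j = c * (s n * l n j)" for j using s by (simp add: c_def)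
    have pu: "c * K * real p \<le> K * (K + 1)"
    proof -
      have "real p \<le> (K + 1) * s n"
        using up m0 s1 Ksplit bs unfolding p_def by (simp add: of_nat_diff_if algebra_simps K_def split: if_splits, linarith?)
      then have "c * real p \<le> K + 1" using s by (simp add: c_def field_simps)
      then show ?thesis using mult_left_mono[of "c * real p" "K + 1" K] by (simp add: K_def mult_ac)
    qed
    have pv: "c * K * real pl \<le> K * (K + 1)"
    proof -
      have "real pl \<le> (K + 1) * s n"
        using lo m0 s1 Ksplit bs unfolding pl_def by (simp add: of_nat_diff_if algebra_simps K_def split: if_splits, linarith?)
      then have "c * real pl \<le> K + 1" using s by (simp add: c_def field_simps)
      then show ?thesis using mult_left_mono[of "c * real pl" "K + 1" K] by (simp add: K_def mult_ac)
    qed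
    have right: "ln (a n (m0 n + k)) - ln (a n (m0 n)) \<le> K * (K + 1) - c * k" for k
    proof -
      have "ln (a n (m0 n + k)) - ln (a n (m0 n + 0)) \<le> c * K * p - c * k"
      proof (rule eventual_decrease_bound[where f = "\<lambda>k. ln (a n (m0 n + k))" and N = k])
        fix j assume "j < k"
        have eq: "ln (a n (m0 n + Suc j)) - ln (a n (m0 n + j)) = c * (s n * l n (m0 n + j))"
          using ln_a_step[of "m0 n + j" n] m01 sl[of "m0 n + j"] by simp
        have "s n * l n (m0 n + j) \<le> s n * l n (m0 n)"
          using l_decreasing[of "m0 n" "m0 n + j" n] m01 s by simp
        also have "\<dots> \<le> K - 1" using l_m0 frac by (simp add: K_def abs_le_iff, linarith?)
        finally show "ln (a n (m0 n + Suc j)) - ln (a n (m0 n + j)) \<le> c * (K - 1)"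
          unfolding eq using c by (intro mult_left_mono) auto
        assume "p \<le> j"
        then have "?u \<le> m0 n + j" unfolding p_def by linarith
        moreover have "?u \<ge> 1" using up \<mu>4 bs by linarith
        ultimately have "s n * l n (m0 n + j) \<le> s n * l n ?u"
          using l_decreasing[of ?u "m0 n + j" n] s by simp
        then have "s n * l n (m0 n + j) \<le> - 1" using lu by simp
        from mult_left_mono[OF this, of c]
        show "ln (a n (m0 n + Suc j)) - ln (a n (m0 n + j)) \<le> - c"
          unfolding eq using c by simp
      qed (use c in \<open>auto simp: K_def\<close>)
      then show ?thesis using pu by simp
    qed
    have left: "ln (a n (m0 n - k)) - ln (a n (m0 n)) \<le> K * (K + 1) - c * k" if "k \<le> m0 n - 1" for k
    proof -
      have "ln (a n (m0 n - k)) - ln (a n (m0 n - 0)) \<le> c * K * pl - c * k"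
      proof (rule eventual_decrease_bound[where f = "\<lambda>k. ln (a n (m0 n - k))" and N = "m0 n - 1"])
        fix j assume j: "j < m0 n - 1"
        then have "m0 n - j = Suc (m0 n - Suc j)" and g: "m0 n - Suc j \<ge> 1" by simp_all
        then have "ln (a n (m0 n - Suc j)) - ln (a n (m0 n - j)) = - l n (m0 n - Suc j)"
          using ln_a_step[OF g, of n] by simp
        also have "\<dots> = c * - (s n * l n (m0 n - Suc j))"
          by (subst sl) simp
        finally have eq: "ln (a n (m0 n - Suc j)) - ln (a n (m0 n - j)) = c * - (s n * l n (m0 n - Suc j))" .
        have "s n * l n (m0 n) \<le> s n * l n (m0 n - Suc j)"
          using l_decreasing[of "m0 n - Suc j" "m0 n" n] j s by simp
        moreover have "- (K - 1) \<le> s n * l n (m0 n)" using l_m0 frac by (simp add: K_def abs_le_iff, linarith?)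
        ultimately have "- (s n * l n (m0 n - Suc j)) \<le> K - 1" by linarith
        then show "ln (a n (m0 n - Suc j)) - ln (a n (m0 n - j)) \<le> c * (K - 1)"
          unfolding eq using c by (intro mult_left_mono) auto
        assume "pl \<le> j"
        then have "m0 n - Suc j \<le> ?v" unfolding pl_def by linarith
        then have "s n * l n ?v \<le> s n * l n (m0 n - Suc j)"
          using l_decreasing[of "m0 n - Suc j" ?v n] j s by simp
        then have "- (s n * l n (m0 n - Suc j)) \<le> - 1" using lv by simp
        from mult_left_mono[OF this, of c]
        show "ln (a n (m0 n - Suc j)) - ln (a n (m0 n - j)) \<le> - c"
          unfolding eq using c by simp
      qed (use c that in \<open>auto simp: K_def\<close>)
      then show ?thesis using pv by simp
    qed
    have both: "ln (a n m) - ln (a n (m0 n)) \<le> K * (K + 1) - c * \<bar>real m - real (m0 n)\<bar>" if "m \<ge> 1" for m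
    proof (cases "m0 n \<le> m")
      case True
      then show ?thesis using right[of "m - m0 n"] by simp
    next
      case False
      then show ?thesis using left[of "m0 n - m"] that by simp
    qed
    show ?case
    proof
      fix x
      define m where "m = nat \<lfloor>\<mu> n + x * s n\<rfloor>"
      show "h n x \<le> C * exp (- \<bar>x\<bar>)"
      proof (cases "m = 0")
        \<comment> \<open>Far to the left the index is truncated to 0, and there
          \<open>a n 0 = 0\<close> makes the bound trivial.\<close>
        case True
        then show ?thesis by (simp add: h_def m_def[symmetric] a_0 C_def)
      next
        case False
        then have "\<mu> n + x * s n \<ge> 1" unfolding m_def by linarith
        then have "\<bar>real m - (\<mu> n + x * s n)\<bar> \<le> 1" unfolding m_def by linarith
        then have "\<bar>x * s n\<bar> \<le> \<bar>real m - real (m0 n)\<bar> + 2" using m0 by linarith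
        then have "c * \<bar>x * s n\<bar> \<le> c * (\<bar>real m - real (m0 n)\<bar> + 2)" using c by (intro mult_left_mono) auto
        then have "\<bar>x\<bar> \<le> c * \<bar>real m - real (m0 n)\<bar> + 2"
          using s c(2) mult_right_mono[of c 1 2] by (simp add: c_def abs_mult distrib_left)
        then have "ln (a n m) - ln (a n (m0 n)) \<le> K * (K + 1) + 2 - \<bar>x\<bar>"
          using both[of m] False by linarith
        then have "exp (ln (a n m) - ln (a n (m0 n))) \<le> exp (K * (K + 1) + 2 - \<bar>x\<bar>)" by simp
        then show ?thesis
          using False m01 by (simp add: h_def m_def[symmetric] C_def exp_diff exp_minus a_pos divide_inverse)
      qed
    qed
  qed
  then show ?thesis by (rule that)
qed

text \<open>The sum is the integral of a step function. Substituting u = \<mu> + s x extracts the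
  factor s and, after division by the term at \<open>m0 n\<close>, leaves the integral of
  \<open>h n\<close>, to which \<open>h_tendsto\<close> and the domination from
  \<open>h_bound\<close> apply.\<close>

lemma sum_asymptotics: "(\<lambda>n. (\<Sum>m. a n m) / (s n * a n (m0 n))) \<longlonglongrightarrow> sqrt (2 * pi) * exp (\<beta>\<^sup>2 / 2)"
proof -
  obtain C where "eventually (\<lambda>n. \<forall>x. h n x \<le> C * exp (- \<bar>x\<bar>)) sequentially" by (rule h_bound)
  with eventually_m0_ge_1 have "eventually (\<lambda>n. m0 n \<ge> 1 \<and> (\<forall>x. h n x \<le> C * exp (- \<bar>x\<bar>))) sequentially"
    by eventually_elim simp
  then obtain N where N: "\<And>n. n \<ge> N \<Longrightarrow> m0 n \<ge> 1" "\<And>n x. n \<ge> N \<Longrightarrow> h n x \<le> C * exp (- \<bar>x\<bar>)"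
    unfolding eventually_sequentially by blast
  have h_nonneg: "h n x \<ge> 0" for n x by (simp add: h_def a_nonneg)
  have C: "C \<ge> 0" using N(2)[of N 0] h_nonneg[of N 0] by simp
  have [measurable]: "h n \<in> borel_measurable borel" for n
    unfolding h_def[abs_def] by measurable
  have w: "integrable lborel (\<lambda>x::real. 2 * C * inverse (1 + x\<^sup>2))"
    using integrable_inverse_1_plus_sq by simp
  have hw: "norm (h n x) \<le> 2 * C * inverse (1 + x\<^sup>2)" if "n \<ge> N" for n x
  proof -
    have "h n x \<le> C * exp (- \<bar>x\<bar>)" using N(2)[OF that] .
    also have "\<dots> \<le> C * (2 * inverse (1 + x\<^sup>2))" using C exp_minus_abs_le by (intro mult_left_mono) auto
    finally show ?thesis using h_nonneg[of n x] by simp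
  qed
  have int: "integrable lborel (h n)" if "n \<ge> N" for n
  proof (rule Bochner_Integration.integrable_bound[OF w])
    have "norm (h n x) \<le> norm (2 * C * inverse (1 + x\<^sup>2))" for x
      using order_trans[OF hw[OF that, of x] abs_ge_self] by simp
    then show "AE x in lborel. norm (h n x) \<le> norm (2 * C * inverse (1 + x\<^sup>2))" by simp
  qed simp
  have eq: "(\<Sum>m. a n m) / (s n * a n (m0 n)) = (\<integral>x. h n x \<partial>lborel)" if n: "n \<ge> N" for n
  proof -
    let ?A = "a n (m0 n)"
    have A: "?A > 0" using a_pos N(1)[OF n] by blast
    have "(\<integral>\<^sup>+(u::real). ennreal (a n (nat \<lfloor>u\<rfloor>)) \<partial>lborel) =
        \<bar>s n\<bar> * (\<integral>\<^sup>+x. ennreal (a n (nat \<lfloor>\<mu> n + s n * x\<rfloor>)) \<partial>lborel)"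
      using s_pos[of n] by (intro nn_integral_real_affine) auto
    also have "(\<integral>\<^sup>+x. ennreal (a n (nat \<lfloor>\<mu> n + s n * x\<rfloor>)) \<partial>lborel) = (\<integral>\<^sup>+x. ennreal ?A * ennreal (h n x) \<partial>lborel)"
      using A a_nonneg by (intro nn_integral_cong) (simp add: h_def ennreal_mult[symmetric] mult.commute)
    also have "\<dots> = ennreal ?A * (\<integral>\<^sup>+x. ennreal (h n x) \<partial>lborel)"
      by (rule nn_integral_cmult) simp
    also have "(\<integral>\<^sup>+x. ennreal (h n x) \<partial>lborel) = ennreal (\<integral>x. h n x \<partial>lborel)"
      using h_nonneg int[OF n] by (intro nn_integral_eq_integral) auto
    also have "(\<integral>\<^sup>+(u::real). ennreal (a n (nat \<lfloor>u\<rfloor>)) \<partial>lborel) = (\<Sum>m. ennreal (a n m))"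
      by (rule nn_integral_step_function) (simp_all add: a_0 a_nonneg)
    finally have sum: "(\<Sum>m. ennreal (a n m)) = ennreal (s n * ?A * (\<integral>x. h n x \<partial>lborel))"
      using s_pos[of n] A h_nonneg by (simp add: ennreal_mult[symmetric] mult.assoc integral_nonneg_AE)
    then have "(\<Sum>m. ennreal (a n m)) = ennreal (\<Sum>m. a n m)"
      by (intro suminf_ennreal) (simp_all add: a_nonneg)
    with sum have "(\<Sum>m. a n m) = s n * ?A * (\<integral>x. h n x \<partial>lborel)"
    proof -
      have "summable (a n)" using sum by (intro summable_suminf_not_top) (simp_all add: a_nonneg)
      then have "(\<Sum>m. a n m) \<ge> 0" using a_nonneg by (rule suminf_nonneg)
      moreover have "s n * ?A * (\<integral>x. h n x \<partial>lborel) \<ge> 0"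
        using s_pos[of n] A h_nonneg by (simp add: integral_nonneg_AE)
      ultimately show ?thesis
        using \<open>(\<Sum>m. ennreal (a n m)) = ennreal (\<Sum>m. a n m)\<close> sum by (simp add: ennreal_inj)
    qed
    then show ?thesis using s_pos[of n] A by simp
  qed
  have "(\<lambda>n. \<integral>x. h (n + N) x \<partial>lborel) \<longlonglongrightarrow> (\<integral>x. exp (\<beta> * x - x\<^sup>2 / 2) \<partial>lborel)"
  proof (rule integral_dominated_convergence[OF _ _ w])
    show "AE x in lborel. (\<lambda>n. h (n + N) x) \<longlonglongrightarrow> exp (\<beta> * x - x\<^sup>2 / 2)"
      using LIMSEQ_ignore_initial_segment[OF h_tendsto] by (intro AE_I2) simp
    show "AE x in lborel. norm (h (n + N) x) \<le> 2 * C * inverse (1 + x\<^sup>2)" for n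
      using hw[of "n + N"] by auto
  qed auto
  then have "(\<lambda>n. (\<Sum>m. a (n + N) m) / (s (n + N) * a (n + N) (m0 (n + N)))) \<longlonglongrightarrow> sqrt (2 * pi) * exp (\<beta>\<^sup>2 / 2)"
    by (simp add: eq gaussian_shift_integral)
  then show ?thesis by (rule LIMSEQ_offset)
qed

end

section \<open>Asymptotic scales\<close>

text \<open>The cumulant generating function of the uniform law on [0, 1], extended continuously to
  0. With q = exp \<delta>, the number [k] is k times exp (f(k \<delta>) - f(\<delta>)) for this
  function f, so f carries the whole dependence of [k] on q.\<close>

definition ln_expm1_quot :: "real \<Rightarrow> real" where
  "ln_expm1_quot x = (if x = 0 then 0 else ln ((exp x - 1) / x))"

lemma ln_expm1_quot_bound_of_bigo:
  assumes "(\<lambda>x. ln ((exp x - 1) / x) - p x) \<in> O[at (0::real)](\<lambda>x. x ^ k)" "p 0 = 0"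
  obtains r C where "r > 0" "C \<ge> 0" "\<And>x. \<bar>x\<bar> \<le> r \<Longrightarrow> \<bar>ln_expm1_quot x - p x\<bar> \<le> C * \<bar>x\<bar> ^ k"
proof -
  obtain C where C: "C > 0" "eventually (\<lambda>x. norm (ln ((exp x - 1) / x) - p x) \<le> C * norm (x ^ k)) (at 0)"
    using landau_o.bigE[OF assms(1)] by blast
  then obtain d where d: "d > 0" "\<And>x. x \<noteq> 0 \<Longrightarrow> \<bar>x\<bar> < d \<Longrightarrow> norm (ln ((exp x - 1) / x) - p x) \<le> C * norm (x ^ k)"
    unfolding eventually_at by (auto simp: dist_real_def)
  have "\<bar>ln_expm1_quot x - p x\<bar> \<le> C * \<bar>x\<bar> ^ k" if "\<bar>x\<bar> \<le> d / 2" for x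
    using d(1) d(2)[of x] that C(1) assms(2) by (cases "x = 0") (auto simp: ln_expm1_quot_def power_abs)
  then show ?thesis using C(1) d(1) by (intro that[of "d / 2" C]) auto
qed

lemma ln_expm1_quot_cubic_bound:
  obtains r C where "r > 0" "C \<ge> 0" "\<And>x. \<bar>x\<bar> \<le> r \<Longrightarrow> \<bar>ln_expm1_quot x - (x / 2 + x\<^sup>2 / 24)\<bar> \<le> C * \<bar>x\<bar> ^ 3"
proof (rule ln_expm1_quot_bound_of_bigo)
  show "(\<lambda>x. ln ((exp x - 1) / x) - (x / 2 + x\<^sup>2 / 24)) \<in> O[at (0::real)](\<lambda>x. x ^ 3)" by real_asymp
qed (use that in auto)

lemma ln_expm1_quot_quadratic_bound:
  obtains r C where "r > 0" "C \<ge> 0" "\<And>x. \<bar>x\<bar> \<le> r \<Longrightarrow> \<bar>ln_expm1_quot x - x / 2\<bar> \<le> C * \<bar>x\<bar> ^ 2"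
proof (rule ln_expm1_quot_bound_of_bigo)
  show "(\<lambda>x. ln ((exp x - 1) / x) - x / 2) \<in> O[at (0::real)](\<lambda>x. x ^ 2)" by real_asymp
qed (use that in auto)

lemma expm1_quot_pos: "x \<noteq> 0 \<Longrightarrow> (exp x - 1) / x > 0" for x :: real
  by (cases "x > 0") (auto simp: divide_pos_pos divide_neg_neg)

lemma ln_expm1_quot_has_derivative:
  assumes "x \<noteq> 0"
  shows "(ln_expm1_quot has_real_derivative exp x / (exp x - 1) - 1 / x) (at x)"
proof -
  have ne: "exp x - 1 \<noteq> 0" using assms by simp
  have "((\<lambda>x. ln ((exp x - 1) / x)) has_real_derivative
      ((exp x * x - (exp x - 1)) / (x * x)) / ((exp x - 1) / x)) (at x)"
    using assms expm1_quot_pos[OF assms] by (auto intro!: derivative_eq_intros)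
  also have "((exp x * x - (exp x - 1)) / (x * x)) / ((exp x - 1) / x) = exp x / (exp x - 1) - 1 / x"
    using assms ne by (simp add: divide_simps)
  finally show ?thesis
    by (rule DERIV_cong_ev[THEN iffD1, rotated -1, OF _ refl _ refl])
      (use eventually_nhds_in_open[of "- {0}" x] assms in \<open>auto simp: ln_expm1_quot_def elim!: eventually_mono\<close>)
qed

text \<open>In a log ratio this increment is multiplied by n. Bounding the two values separately
  would leave an error of order n (j \<delta>)^2, which does not vanish at the scale of the limit
  law. The mean value theorem with derivative 1/2 + O(x) gives n j \<delta>^2 instead; for j >= 1
  the interval avoids 0.\<close>

lemma ln_expm1_quot_increment_bound:
  obtains r C where "r > 0" "C \<ge> 0"
    "\<And>\<delta> j. j \<ge> 1 \<Longrightarrow> real (Suc j) * \<bar>\<delta>\<bar> \<le> r \<Longrightarrow>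
      \<bar>ln_expm1_quot (real (Suc j) * \<delta>) - ln_expm1_quot (real j * \<delta>) - \<delta> / 2\<bar> \<le> C * (real (Suc j) * \<delta>\<^sup>2)"
proof -
  let ?g = "\<lambda>x::real. exp x / (exp x - 1) - 1 / x"
  have "(\<lambda>x. ?g x - 1 / 2) \<in> O[at (0::real)](\<lambda>x. x)" by real_asymp
  then obtain C where C: "C > 0" "eventually (\<lambda>x. norm (?g x - 1 / 2) \<le> C * norm x) (at 0)"
    using landau_o.bigE by blast
  then obtain d where d: "d > 0" "\<And>x. x \<noteq> 0 \<Longrightarrow> \<bar>x\<bar> < d \<Longrightarrow> \<bar>?g x - 1 / 2\<bar> \<le> C * \<bar>x\<bar>"
    unfolding eventually_at by (auto simp: dist_real_def)
  have ordered: "\<bar>ln_expm1_quot y - ln_expm1_quot x - (y - x) / 2\<bar> \<le> C * R * (y - x)"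
    if xy: "x < y" "x * y > 0" "\<bar>x\<bar> \<le> R" "\<bar>y\<bar> \<le> R" "R < d" for x y R
  proof -
    have nz: "z \<noteq> 0" "\<bar>z\<bar> \<le> R" if "x \<le> z" "z \<le> y" for z
      using that xy by (auto simp: zero_less_mult_iff)
    obtain z where z: "x < z" "z < y" "ln_expm1_quot y - ln_expm1_quot x = (y - x) * ?g z"
      using MVT2[of x y ln_expm1_quot ?g] xy(1) ln_expm1_quot_has_derivative nz by (metis less_imp_le)
    have "\<bar>?g z - 1 / 2\<bar> \<le> C * \<bar>z\<bar>" using d(2)[of z] nz[of z] z xy(5) by auto
    also have "\<dots> \<le> C * R" using nz[of z] z C(1) by (intro mult_left_mono) auto
    finally have "\<bar>?g z - 1 / 2\<bar> * (y - x) \<le> C * R * (y - x)" using xy(1) by (intro mult_right_mono) auto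
    moreover have "ln_expm1_quot y - ln_expm1_quot x - (y - x) / 2 = (?g z - 1 / 2) * (y - x)"
      using z(3) by (simp add: algebra_simps)
    ultimately show ?thesis using xy(1) by (simp add: abs_mult)
  qed
  show ?thesis
  proof (rule that[of "d / 2" C])
    fix \<delta> :: real and j :: nat assume j: "j \<ge> 1" "real (Suc j) * \<bar>\<delta>\<bar> \<le> d / 2"
    let ?x = "real j * \<delta>" and ?y = "real (Suc j) * \<delta>" and ?R = "real (Suc j) * \<bar>\<delta>\<bar>"
    have R: "\<bar>?x\<bar> \<le> ?R" "\<bar>?y\<bar> \<le> ?R" "?R < d" using j d(1) by (auto simp: abs_mult mult_right_mono)
    have pos: "?x * ?y > 0" if "\<delta> \<noteq> 0"
    proof -
      have "?x * ?y = real j * real (Suc j) * \<delta>\<^sup>2" by (simp add: power2_eq_square)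
      also have "\<dots> > 0" using that j(1) by (intro mult_pos_pos) auto
      finally show ?thesis .
    qed
    consider "\<delta> = 0" | "\<delta> > 0" | "\<delta> < 0" by linarith
    then show "\<bar>ln_expm1_quot ?y - ln_expm1_quot ?x - \<delta> / 2\<bar> \<le> C * (real (Suc j) * \<delta>\<^sup>2)"
    proof cases
      case 2
      have "\<bar>ln_expm1_quot ?y - ln_expm1_quot ?x - (?y - ?x) / 2\<bar> \<le> C * ?R * (?y - ?x)"
        using 2 pos by (intro ordered R) (auto simp: mult.commute)
      then show ?thesis using 2 by (simp add: power2_eq_square algebra_simps)
    next
      case 3
      have "\<bar>ln_expm1_quot ?x - ln_expm1_quot ?y - (?x - ?y) / 2\<bar> \<le> C * ?R * (?x - ?y)"
        using 3 pos by (intro ordered R) (auto simp: mult.commute)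
      moreover have "?x - ?y = - \<delta>" by (simp add: algebra_simps)
      moreover have "\<bar>ln_expm1_quot ?y - ln_expm1_quot ?x - \<delta> / 2\<bar> = \<bar>ln_expm1_quot ?x - ln_expm1_quot ?y - (- \<delta>) / 2\<bar>" by (simp add: abs_if)
      ultimately show ?thesis using 3 by (simp add: power2_eq_square mult.assoc)
    qed simp
  qed (use C d in auto)
qed

section \<open>Positivity, monotonicity and logarithms of q-integers\<close>

lemma q_int_pos: "r > 0 \<Longrightarrow> m \<ge> 1 \<Longrightarrow> q_int (r::real) m > 0"
  unfolding q_int_def by (intro sum_pos) (auto simp: lessThan_empty_iff)

lemma q_fact_pos: "r > 0 \<Longrightarrow> q_fact (r::real) m > 0"
  unfolding q_fact_def by (intro prod_pos) (auto intro: q_int_pos)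

lemma q_int_mono: "r > 0 \<Longrightarrow> i \<le> j \<Longrightarrow> q_int (r::real) i \<le> q_int r j"
  unfolding q_int_def by (intro sum_mono2) auto

lemma q_int_Suc': "q_int q (Suc n) = 1 + q * q_int q n"
  unfolding q_int_def by (subst sum.lessThan_Suc_shift) (simp add: sum_distrib_left)

lemma ln_q_int_exp:
  assumes "k \<ge> 1"
  shows "ln (q_int (exp \<delta>) k) = ln (real k) + ln_expm1_quot (real k * \<delta>) - ln_expm1_quot \<delta>"
proof (cases "\<delta> = 0")
  case True
  then show ?thesis by (simp add: q_int_def ln_expm1_quot_def)
next
  case False
  have k: "real k * \<delta> \<noteq> 0" "real k > 0" using False assms by auto
  have "q_int (exp \<delta>) k = (exp (real k * \<delta>) - 1) / (exp \<delta> - 1)"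
    using False by (simp add: q_int_geometric exp_of_nat_mult[symmetric] divide_simps) (simp add: algebra_simps)
  also have "\<dots> = real k * ((exp (real k * \<delta>) - 1) / (real k * \<delta>)) / ((exp \<delta> - 1) / \<delta>)"
    using False k by (simp add: field_simps)
  finally have eq: "q_int (exp \<delta>) k = real k * ((exp (real k * \<delta>) - 1) / (real k * \<delta>)) / ((exp \<delta> - 1) / \<delta>)" .
  have "ln (real k * X / Y) = ln (real k) + ln X - ln Y" if "X > 0" "Y > 0" for X Y
    using k that by (simp add: ln_div ln_mult)
  from this[OF expm1_quot_pos[OF k(1)] expm1_quot_pos[OF False]]
  show ?thesis unfolding eq ln_expm1_quot_def using k False by simp
qed

section \<open>The Lambert function and the scales of the limit law\<close>

lemma
  assumes "x \<ge> 0"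
  shows lambert_W_nonneg: "lambert_W x \<ge> 0" and lambert_W_eq: "lambert_W x * exp (lambert_W x) = x"
proof -
  have "\<exists>w. 0 \<le> w \<and> w \<le> x \<and> w * exp w = x"
    using assms mult_left_mono[of 1 "exp x" x]
    by (intro IVT') (auto intro!: continuous_intros)
  then obtain w where w: "0 \<le> w" "w * exp w = x" by blast
  have uniq: "v = w" if v: "v * exp v = x" for v
  proof -
    have "v \<ge> 0" using v assms by (metis exp_gt_zero linorder_not_le mult_neg_pos)
    then have "v * exp v < w * exp w" if "v < w" using that by (intro mult_strict_mono) auto
    moreover have "w * exp w < v * exp v" if "w < v" using that w by (intro mult_strict_mono) auto
    ultimately show ?thesis using v w by (cases v w rule: linorder_cases) auto
  qed
  have "lambert_W x = w" unfolding lambert_W_def by (rule the_equality) (fact w(2), fact uniq)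
  then show "lambert_W x \<ge> 0" "lambert_W x * exp (lambert_W x) = x" using w by auto
qed

lemma lambert_W_at_top: "filterlim lambert_W at_top at_top"
  unfolding filterlim_at_top
proof
  fix Z :: real
  show "eventually (\<lambda>x. Z \<le> lambert_W x) at_top"
    using eventually_ge_at_top[of "max 0 (\<bar>Z\<bar> * exp \<bar>Z\<bar>)"]
  proof eventually_elim
    case (elim x)
    have "\<not> lambert_W x < \<bar>Z\<bar>"
    proof
      assume "lambert_W x < \<bar>Z\<bar>"
      then have "lambert_W x * exp (lambert_W x) < \<bar>Z\<bar> * exp \<bar>Z\<bar>"
        using lambert_W_nonneg[of x] elim by (intro mult_strict_mono) auto
      then show False using lambert_W_eq[of x] elim by simp
    qed
    then show ?case by linarith
  qed
qed

text \<open>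
  Since \<open>n = w exp w\<close> for \<open>w = W(n)\<close>, all scales are elementary functions of \<open>w\<close>. The terms
  of the Dobinski sum are concentrated around \<open>centre n\<close>, with standard deviation \<open>spread n\<close>.
\<close>

definition sigma_fun :: "real \<Rightarrow> real" where
  "sigma_fun w = 1/3 * sqrt ((3 * w\<^sup>2 - 4 * w + 2) / (w + 1) * exp (3 * w))"

text \<open>For q = 1 the log ratio is close to n / x - ln x. At x = exp w this vanishes because n =
  w exp w, and its slope there is -(n / x^2 + 1 / x) = -(w + 1) exp (-w), the negative inverse of
  the square of this function.\<close>

definition spread_fun :: "real \<Rightarrow> real" where
  "spread_fun w = sqrt (exp w / (w + 1))"

definition W_seq :: "nat \<Rightarrow> real" where "W_seq n = lambert_W (real n)"

definition centre :: "nat \<Rightarrow> real" where "centre n = exp (W_seq n)"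

definition spread :: "nat \<Rightarrow> real" where "spread n = spread_fun (W_seq n)"

lemma sigma_asymp_eq: "sigma_asymp n = sigma_fun (W_seq n)"
  by (simp add: sigma_asymp_def sigma_fun_def W_seq_def)

lemma W_seq_nonneg: "W_seq n \<ge> 0"
  by (simp add: W_seq_def lambert_W_nonneg)

lemma n_eq: "real n = W_seq n * exp (W_seq n)"
  by (simp add: W_seq_def lambert_W_eq)

lemma sigma_pos: "sigma_asymp n > 0"
proof -
  have "3 * w\<^sup>2 - 4 * w + 2 > 0" for w :: real
  proof -
    have "3 * w\<^sup>2 - 4 * w + 2 = 3 * (w - 2 / 3)\<^sup>2 + 2 / 3" by (simp add: power2_eq_square algebra_simps)
    then show ?thesis by (simp add: add_nonneg_pos)
  qed
  then show ?thesis
    using W_seq_nonneg[of n] by (simp add: sigma_asymp_eq sigma_fun_def)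
qed

lemma spread_pos: "spread n > 0"
  using W_seq_nonneg[of n] by (simp add: spread_def spread_fun_def)

lemma centre_ge_1: "centre n \<ge> 1"
  using W_seq_nonneg[of n] by (simp add: centre_def)

lemma lambert_limit:
  assumes "filterlim f F at_top"
  shows "filterlim (\<lambda>n. f (W_seq n)) F sequentially"
  unfolding W_seq_def by (rule filterlim_compose[OF assms])
    (rule filterlim_compose[OF lambert_W_at_top filterlim_real_sequentially])

lemmas scale_unfolds = sigma_asymp_eq spread_def centre_def n_eq spread_fun_def sigma_fun_def

text \<open>In terms of w, \<open>sigma_asymp n\<close> squared is asymptotic to w exp (3 w) / 3.
  There are three finite nonzero limits: sqrt 3 yields \<beta> = t sqrt 3 / 2, the limit 3 yields 3
  t^2 / 24 = t^2 / 8, and -1 is the normalised slope of the log ratios. The limits 0 dispose of the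
  error terms.\<close>

lemma
  shows spread_at_top: "filterlim spread at_top sequentially"
    and sigma_at_top: "filterlim sigma_asymp at_top sequentially"
    and centre_div_spread: "filterlim (\<lambda>n. centre n / spread n) at_top sequentially"
    and mean_shift_tendsto: "(\<lambda>n. spread n * (real n - centre n) / sigma_asymp n) \<longlonglongrightarrow> sqrt 3"
    and spread_n_centre_tendsto_0: "(\<lambda>n. spread n * real n * centre n / sigma_asymp n ^ 2) \<longlonglongrightarrow> 0"
    and spread_sq_tendsto_0: "(\<lambda>n. spread n ^ 2 / sigma_asymp n) \<longlonglongrightarrow> 0"
    and spread_tendsto_0: "(\<lambda>n. spread n / sigma_asymp n) \<longlonglongrightarrow> 0"
    and spread_centre_sq_tendsto_0: "(\<lambda>n. spread n * centre n ^ 2 / sigma_asymp n ^ 2) \<longlonglongrightarrow> 0"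
    and centre_tendsto_0: "(\<lambda>n. centre n / sigma_asymp n) \<longlonglongrightarrow> 0"
    and n_tendsto_0: "(\<lambda>n. real n / sigma_asymp n) \<longlonglongrightarrow> 0"
    and n_centre_sq_tendsto: "(\<lambda>n. real n * centre n ^ 2 / sigma_asymp n ^ 2) \<longlonglongrightarrow> 3"
    and n_centre_tendsto_0: "(\<lambda>n. real n * centre n / sigma_asymp n ^ 2) \<longlonglongrightarrow> 0"
    and n_sigma_sq_tendsto_0: "(\<lambda>n. real n / sigma_asymp n ^ 2) \<longlonglongrightarrow> 0"
    and centre_cube_tendsto_0: "(\<lambda>n. centre n ^ 3 / sigma_asymp n ^ 2) \<longlonglongrightarrow> 0"
    and n_centre_cube_tendsto_0: "(\<lambda>n. real n * centre n ^ 3 / sigma_asymp n ^ 3) \<longlonglongrightarrow> 0"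
    and centre_fourth_tendsto_0: "(\<lambda>n. centre n ^ 4 / sigma_asymp n ^ 3) \<longlonglongrightarrow> 0"
    and log_ratio_centre_tendsto_0: "(\<lambda>n. spread n * (real n * ln (1 + 1 / centre n) - ln (centre n + 1))) \<longlonglongrightarrow> 0"
    and log_ratio_slope_tendsto: "(\<lambda>n. spread n ^ 2 * (- real n / ((centre n + K * spread n) * (centre n + K * spread n + 1))
        - 1 / (centre n + K * spread n + 1))) \<longlonglongrightarrow> -1"
proof -
  \<comment> \<open>The expansions deliver their constants in terms of
    \<open>3 powr (1 / 2)\<close>; these equations bring the expected limits into that
    shape.\<close>
  have p3: "3 powr (1 / 2) = sqrt (3 :: real)" by (rule powr_half_sqrt) simp
  have s3: "3 / 3 powr (1 / 2) = sqrt (3 :: real)" unfolding p3 by (rule real_div_sqrt) simp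
  have s3': "inverse ((3 powr (1 / 2) / 3)\<^sup>2) = (3 :: real)" unfolding p3 power_divide by simp
  show "filterlim spread at_top sequentially"
    unfolding scale_unfolds[abs_def] by (rule lambert_limit) real_asymp
  show "filterlim sigma_asymp at_top sequentially"
    unfolding scale_unfolds[abs_def] by (rule lambert_limit) real_asymp
  show "filterlim (\<lambda>n. centre n / spread n) at_top sequentially"
    unfolding scale_unfolds by (rule lambert_limit) real_asymp
  show "(\<lambda>n. spread n * (real n - centre n) / sigma_asymp n) \<longlonglongrightarrow> sqrt 3"
    unfolding scale_unfolds s3[symmetric] by (rule lambert_limit) real_asymp
  show "(\<lambda>n. spread n * real n * centre n / sigma_asymp n ^ 2) \<longlonglongrightarrow> 0"
    unfolding scale_unfolds by (rule lambert_limit) real_asymp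
  show "(\<lambda>n. spread n ^ 2 / sigma_asymp n) \<longlonglongrightarrow> 0"
    unfolding scale_unfolds by (rule lambert_limit) real_asymp
  show "(\<lambda>n. spread n / sigma_asymp n) \<longlonglongrightarrow> 0"
    unfolding scale_unfolds by (rule lambert_limit) real_asymp
  show "(\<lambda>n. spread n * centre n ^ 2 / sigma_asymp n ^ 2) \<longlonglongrightarrow> 0"
    unfolding scale_unfolds by (rule lambert_limit) real_asymp
  show "(\<lambda>n. centre n / sigma_asymp n) \<longlonglongrightarrow> 0"
    unfolding scale_unfolds by (rule lambert_limit) real_asymp
  show "(\<lambda>n. real n / sigma_asymp n) \<longlonglongrightarrow> 0"
    unfolding scale_unfolds by (rule lambert_limit) real_asymp
  show "(\<lambda>n. real n * centre n ^ 2 / sigma_asymp n ^ 2) \<longlonglongrightarrow> 3"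
    unfolding scale_unfolds by (subst s3'[symmetric], rule lambert_limit) real_asymp
  show "(\<lambda>n. real n * centre n / sigma_asymp n ^ 2) \<longlonglongrightarrow> 0"
    unfolding scale_unfolds by (rule lambert_limit) real_asymp
  show "(\<lambda>n. real n / sigma_asymp n ^ 2) \<longlonglongrightarrow> 0"
    unfolding scale_unfolds by (rule lambert_limit) real_asymp
  show "(\<lambda>n. centre n ^ 3 / sigma_asymp n ^ 2) \<longlonglongrightarrow> 0"
    unfolding scale_unfolds by (rule lambert_limit) real_asymp
  show "(\<lambda>n. real n * centre n ^ 3 / sigma_asymp n ^ 3) \<longlonglongrightarrow> 0"
    unfolding scale_unfolds by (rule lambert_limit) real_asymp
  show "(\<lambda>n. centre n ^ 4 / sigma_asymp n ^ 3) \<longlonglongrightarrow> 0"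
    unfolding scale_unfolds by (rule lambert_limit) real_asymp
  show "(\<lambda>n. spread n * (real n * ln (1 + 1 / centre n) - ln (centre n + 1))) \<longlonglongrightarrow> 0"
    unfolding scale_unfolds by (rule lambert_limit) real_asymp
  show "(\<lambda>n. spread n ^ 2 * (- real n / ((centre n + K * spread n) * (centre n + K * spread n + 1))
        - 1 / (centre n + K * spread n + 1))) \<longlonglongrightarrow> -1"
    unfolding scale_unfolds by (rule lambert_limit) real_asymp
qed

section \<open>Ratios of the Dobinski terms\<close>

definition dobinski_term :: "nat \<Rightarrow> real \<Rightarrow> nat \<Rightarrow> real" where
  "dobinski_term n q m = q_int q m ^ n / q_fact q m * q powi (int n - int m)"

definition log_ratio :: "nat \<Rightarrow> real \<Rightarrow> nat \<Rightarrow> real" where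
  "log_ratio n \<delta> j = real n * (ln (q_int (exp \<delta>) (Suc j)) - ln (q_int (exp \<delta>) j)) -
     ln (q_int (exp \<delta>) (Suc j)) - \<delta>"

lemma ln_diff_eq: "a > 0 \<Longrightarrow> b > 0 \<Longrightarrow> ln a - ln b = ln (a / b)" for a b :: real
  by (simp add: ln_div)

lemma dobinski_term_pos: "q > 0 \<Longrightarrow> m \<ge> 1 \<Longrightarrow> dobinski_term n q m > 0"
  unfolding dobinski_term_def by (intro mult_pos_pos divide_pos_pos zero_less_power q_int_pos q_fact_pos) auto

lemma dobinski_term_Suc:
  assumes "m \<ge> 1"
  shows "dobinski_term n (exp \<delta>) (Suc m) = dobinski_term n (exp \<delta>) m * exp (log_ratio n \<delta> m)"
proof -
  let ?q = "exp \<delta>"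
  have p: "q_int ?q m > 0" "q_int ?q (Suc m) > 0" "q_fact ?q m > 0"
    using assms by (auto intro: q_int_pos q_fact_pos)
  have "exp (log_ratio n \<delta> m) = (q_int ?q (Suc m) / q_int ?q m) ^ n / q_int ?q (Suc m) / ?q"
    using p by (simp add: log_ratio_def exp_diff exp_of_nat_mult)
  moreover have "?q powi (int n - int (Suc m)) = ?q powi (int n - int m) / ?q"
    using power_int_diff[of ?q "int n - int m" 1] by (simp add: algebra_simps)
  moreover have "X ^ n / (F * X) * (P / e) = Y ^ n / F * P * ((X / Y) ^ n / X / e)"
    if "X > 0" "Y > 0" "F > 0" for X Y F P e :: real
    using that by (simp add: power_divide mult_ac)
  ultimately show ?thesis
    unfolding dobinski_term_def q_fact_Suc using p by metis
qed

text \<open>For every q > 0 the quotient [j + 1] / [j] = q + 1 / [j] decreases in j, while [j + 1]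
  increases. The terms are thus log-concave for tilts of either sign.\<close>

lemma log_ratio_decreasing:
  assumes "1 \<le> i" "i \<le> j"
  shows "log_ratio n \<delta> j \<le> log_ratio n \<delta> i"
proof -
  let ?q = "exp \<delta>"
  have p: "q_int ?q k > 0" if "k \<ge> 1" for k using that by (auto intro: q_int_pos)
  have frac: "ln (q_int ?q (Suc k)) - ln (q_int ?q k) = ln (1 / q_int ?q k + ?q)" if "k \<ge> 1" for k
  proof -
    have "q_int ?q (Suc k) / q_int ?q k = 1 / q_int ?q k + ?q"
      using p[OF that] by (simp add: q_int_Suc' field_simps)
    then show ?thesis using ln_diff_eq[OF p[of "Suc k"] p[OF that]] by simp
  qed
  have "1 / q_int ?q j \<le> 1 / q_int ?q i"
    using p[of i] assms q_int_mono[of ?q i j] by (intro divide_left_mono mult_pos_pos p) auto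
  then have "ln (1 / q_int ?q j + ?q) \<le> ln (1 / q_int ?q i + ?q)"
    using p[of j] assms by (intro ln_mono add_pos_pos add_right_mono) auto
  then have "real n * (ln (q_int ?q (Suc j)) - ln (q_int ?q j)) \<le> real n * (ln (q_int ?q (Suc i)) - ln (q_int ?q i))"
    using frac[of i] frac[of j] assms by (intro mult_left_mono) auto
  moreover have "ln (q_int ?q (Suc i)) \<le> ln (q_int ?q (Suc j))"
    using assms q_int_mono[of ?q "Suc i" "Suc j"] by (intro ln_mono p) auto
  ultimately show ?thesis
    unfolding log_ratio_def by linarith
qed

lemma log_ratio_eq:
  assumes "j \<ge> 1"
  shows "log_ratio n \<delta> j = (real n * ln (1 + 1 / real j) - ln (real j + 1)) +
    (real n * (ln_expm1_quot (real (Suc j) * \<delta>) - ln_expm1_quot (real j * \<delta>)) - ln_expm1_quot (real (Suc j) * \<delta>) + ln_expm1_quot \<delta> - \<delta>)"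
proof -
  have "ln (1 + 1 / real j) = ln (real (Suc j)) - ln (real j)"
    using assms by (subst ln_diff_eq) (auto simp: field_simps)
  moreover have "ln (real j + 1) = ln (real (Suc j))" by (simp add: add.commute)
  ultimately show ?thesis
    using assms by (simp only: log_ratio_def ln_q_int_exp le_SucI) (simp add: algebra_simps)
qed

text \<open>The part of the log ratio for q = 1 is compared with its value at the centre by the mean
  value theorem. Its derivative \<open>f'\<close> is increasing, so within the window it lies
  between its values at the two ends, and uniformity in j reduces to limits at two points.\<close>

lemma log_ratio_zero_approx:
  fixes n :: nat and K :: real
  defines "f' \<equiv> \<lambda>x. - real n / (x * (x + 1)) - 1 / (x + 1)"
  assumes K: "K \<ge> 0" "K * spread n + 1 \<le> centre n" and j: "\<bar>real j - centre n\<bar> \<le> K * spread n"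
  shows "\<bar>spread n * (real n * ln (1 + 1 / real j) - ln (real j + 1)) + (real j - centre n) / spread n\<bar> \<le>
    \<bar>spread n * (real n * ln (1 + 1 / centre n) - ln (centre n + 1))\<bar> +
    K * (\<bar>1 + spread n ^ 2 * f' (centre n - K * spread n)\<bar> + \<bar>1 + spread n ^ 2 * f' (centre n + K * spread n)\<bar>)"
proof -
  let ?f = "\<lambda>x. real n * ln (1 + 1 / x) - ln (x + 1)"
  let ?s = "spread n" and ?\<mu> = "centre n"
  let ?lo = "?\<mu> - K * ?s" and ?hi = "?\<mu> + K * ?s"
  have s: "?s > 0" by (rule spread_pos)
  have lo: "?lo \<ge> 1" using K by simp
  have der: "(?f has_real_derivative f' x) (at x)" if "x > 0" for x
  proof -
    have "(?f has_real_derivative real n * ((0 - 1) / (x * x) / (1 + 1 / x)) - 1 / (x + 1)) (at x)"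
      using that by (auto intro!: derivative_eq_intros simp: add_pos_pos power2_eq_square)
    moreover have "real n * ((0 - 1) / (x * x) / (1 + 1 / x)) - 1 / (x + 1) = f' x"
      using that unfolding f'_def by (simp add: divide_simps, (simp add: algebra_simps)?)
    ultimately show ?thesis by simp
  qed
  have mono: "f' x \<le> f' y" if "0 < x" "x \<le> y" for x y
  proof -
    have "real n / (y * (y + 1)) \<le> real n / (x * (x + 1))"
      using that by (intro divide_left_mono mult_mono mult_pos_pos) auto
    moreover have "1 / (y + 1) \<le> 1 / (x + 1)" using that by (intro divide_left_mono mult_pos_pos) auto
    ultimately show ?thesis by (simp add: f'_def)
  qed
  have in_range: "?lo \<le> real j" "real j \<le> ?hi" "?lo \<le> ?\<mu>" "?\<mu> \<le> ?hi"
    using j K s by (auto simp: abs_le_iff)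
  have mvt: "\<exists>x>u. x < v \<and> ?f v - ?f u = (v - u) * f' x" if "u < v" "?lo \<le> u" for u v
    by (rule MVT2[OF that(1)]) (use der that(2) lo in force)
  obtain x where x: "?lo \<le> x" "x \<le> ?hi" "?f (real j) - ?f ?\<mu> = (real j - ?\<mu>) * f' x"
  proof -
    consider "real j < ?\<mu>" | "real j = ?\<mu>" | "?\<mu> < real j" by linarith
    then show thesis
    proof cases
      case 1
      obtain x where "real j < x" "x < ?\<mu>" "?f ?\<mu> - ?f (real j) = (?\<mu> - real j) * f' x"
        using mvt[OF 1 in_range(1)] by blast
      then show thesis using in_range by (intro that[of x]) (auto simp: algebra_simps)
    next
      case 2
      then show thesis using in_range by (intro that[of ?\<mu>]) auto
    next
      case 3
      obtain x where "?\<mu> < x" "x < real j" "?f (real j) - ?f ?\<mu> = (real j - ?\<mu>) * f' x"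
        using mvt[OF 3 in_range(3)] by blast
      then show thesis using in_range by (intro that[of x]) auto
    qed
  qed
  have "\<bar>1 + ?s ^ 2 * f' x\<bar> \<le> \<bar>1 + ?s ^ 2 * f' ?lo\<bar> + \<bar>1 + ?s ^ 2 * f' ?hi\<bar>"
  proof -
    have "?s ^ 2 * f' ?lo \<le> ?s ^ 2 * f' x" "?s ^ 2 * f' x \<le> ?s ^ 2 * f' ?hi"
      using mono[of ?lo x] mono[of x ?hi] x lo by (auto intro!: mult_left_mono)
    then show ?thesis by linarith
  qed
  moreover have "\<bar>(real j - ?\<mu>) / ?s\<bar> \<le> K"
    using j s by (simp add: abs_divide pos_divide_le_eq)
  ultimately have "\<bar>(real j - ?\<mu>) / ?s * (1 + ?s ^ 2 * f' x)\<bar> \<le> K * (\<bar>1 + ?s ^ 2 * f' ?lo\<bar> + \<bar>1 + ?s ^ 2 * f' ?hi\<bar>)"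
    unfolding abs_mult using K by (intro mult_mono) auto
  moreover have "?s * ?f (real j) + (real j - ?\<mu>) / ?s = ?s * ?f ?\<mu> + (real j - ?\<mu>) / ?s * (1 + ?s ^ 2 * f' x)"
  proof -
    have "?f (real j) = ?f ?\<mu> + (real j - ?\<mu>) * f' x" using x(3) by simp
    moreover have "?s * (A + d * g) + d / ?s = ?s * A + d / ?s * (1 + ?s ^ 2 * g)" for A d g
      using s by (simp add: field_simps power2_eq_square)
    ultimately show ?thesis by (simp only:)
  qed
  ultimately show ?thesis by linarith
qed

lemma eventually_spread_le_centre: "eventually (\<lambda>n. K * spread n + 1 \<le> centre n) sequentially"
proof -
  have "eventually (\<lambda>n. spread n \<ge> 1) sequentially" "eventually (\<lambda>n. centre n / spread n \<ge> K + 1) sequentially"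
    using spread_at_top centre_div_spread by (auto simp: filterlim_at_top)
  then show ?thesis
  proof eventually_elim
    case (elim n)
    have "(K + 1) * spread n \<le> centre n" using elim(2) spread_pos[of n] by (simp add: field_simps)
    then show ?case using elim(1) by (simp add: algebra_simps)
  qed
qed

lemma log_ratio_approx:
  fixes t K \<epsilon> :: real
  assumes \<epsilon>: "\<epsilon> > 0"
  shows "eventually (\<lambda>n. \<forall>j. \<bar>real j - centre n\<bar> \<le> K * spread n \<longrightarrow>
    \<bar>spread n * log_ratio n (t / sigma_asymp n) j - (t * sqrt 3 / 2 - (real j - centre n) / spread n)\<bar> \<le> \<epsilon>) sequentially"
proof -
  define k where "k = \<bar>K\<bar>"
  define \<delta> where "\<delta> n = t / sigma_asymp n" for n
  obtain r1 C1 where 1: "r1 > 0" "C1 \<ge> 0" "\<And>\<delta> j. j \<ge> 1 \<Longrightarrow> real (Suc j) * \<bar>\<delta>\<bar> \<le> r1 \<Longrightarrow>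
      \<bar>ln_expm1_quot (real (Suc j) * \<delta>) - ln_expm1_quot (real j * \<delta>) - \<delta> / 2\<bar> \<le> C1 * (real (Suc j) * \<delta>\<^sup>2)"
    by (rule ln_expm1_quot_increment_bound) blast
  obtain r2 C2 where 2: "r2 > 0" "C2 \<ge> 0" "\<And>x. \<bar>x\<bar> \<le> r2 \<Longrightarrow> \<bar>ln_expm1_quot x - x / 2\<bar> \<le> C2 * \<bar>x\<bar> ^ 2"
    by (rule ln_expm1_quot_quadratic_bound) blast
  let ?f' = "\<lambda>n x. - real n / (x * (x + 1)) - 1 / (x + 1)"
  \<comment> \<open>\<open>E1\<close> bounds the error for q = 1 and \<open>E2\<close> that of the
    perturbation. Of the perturbation only \<delta> (n - \<open>centre n\<close>) / 2 survives;
    multiplied by the spread it tends to t sqrt 3 / 2.\<close>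
  define E1 where "E1 n = \<bar>spread n * (real n * ln (1 + 1 / centre n) - ln (centre n + 1))\<bar> +
    k * (\<bar>1 + spread n ^ 2 * ?f' n (centre n - k * spread n)\<bar> + \<bar>1 + spread n ^ 2 * ?f' n (centre n + k * spread n)\<bar>)" for n
  define E2 where "E2 n = \<bar>t / 2 * (spread n * (real n - centre n) / sigma_asymp n) - t * sqrt 3 / 2\<bar> +
    k * \<bar>t\<bar> / 2 * (spread n ^ 2 / sigma_asymp n) + \<bar>t\<bar> * (spread n / sigma_asymp n) +
    2 * C1 * t\<^sup>2 * (spread n * real n * centre n / sigma_asymp n ^ 2) +
    8 * C2 * t\<^sup>2 * (spread n * centre n ^ 2 / sigma_asymp n ^ 2)" for n
  have "(\<lambda>n. E1 n + E2 n) \<longlonglongrightarrow>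
      (\<bar>0\<bar> + k * (\<bar>1 + - 1\<bar> + \<bar>1 + - 1\<bar>)) +
      (\<bar>t / 2 * sqrt 3 - t * sqrt 3 / 2\<bar> + k * \<bar>t\<bar> / 2 * 0 + \<bar>t\<bar> * 0 + 2 * C1 * t\<^sup>2 * 0 + 8 * C2 * t\<^sup>2 * 0)"
    unfolding E1_def E2_def using log_ratio_slope_tendsto[of "- k"]
    by (intro tendsto_intros log_ratio_centre_tendsto_0 log_ratio_slope_tendsto mean_shift_tendsto spread_n_centre_tendsto_0 spread_sq_tendsto_0 spread_tendsto_0 spread_centre_sq_tendsto_0) simp
  then have "(\<lambda>n. E1 n + E2 n) \<longlonglongrightarrow> 0" by simp
  then have ev1: "eventually (\<lambda>n. E1 n + E2 n < \<epsilon>) sequentially"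
    using \<epsilon> by (rule order_tendstoD)
  have "(\<lambda>n. 2 * \<bar>t\<bar> * (centre n / sigma_asymp n)) \<longlonglongrightarrow> 2 * \<bar>t\<bar> * 0"
    by (intro tendsto_intros centre_tendsto_0)
  then have ev2: "eventually (\<lambda>n. 2 * \<bar>t\<bar> * (centre n / sigma_asymp n) < min r1 r2) sequentially"
    using 1(1) 2(1) by (intro order_tendstoD) auto
  show ?thesis
    using ev1 ev2 eventually_spread_le_centre[of k]
  proof eventually_elim
    case (elim n)
    show ?case
    proof (intro allI impI)
      fix j :: nat assume j: "\<bar>real j - centre n\<bar> \<le> K * spread n"
      let ?s = "spread n" and ?\<mu> = "centre n" and ?\<delta> = "\<delta> n"
      have s: "?s > 0" and \<sigma>: "sigma_asymp n > 0" and \<mu>1: "?\<mu> \<ge> 1"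
        by (auto intro: spread_pos sigma_pos centre_ge_1)
      have "K * ?s \<le> k * ?s" using s by (simp add: k_def)
      then have jk: "\<bar>real j - ?\<mu>\<bar> \<le> k * ?s" using j by linarith
      have j1: "j \<ge> 1" and j2: "real (Suc j) \<le> 2 * ?\<mu>"
      proof -
        have "real j \<ge> 1" using jk elim(3) by linarith
        then show "j \<ge> 1" by simp
        show "real (Suc j) \<le> 2 * ?\<mu>" using jk elim(3) by simp
      qed
      have ad: "\<bar>?\<delta>\<bar> = \<bar>t\<bar> / sigma_asymp n" using \<sigma> by (simp add: \<delta>_def abs_divide)
      have small: "2 * ?\<mu> * \<bar>?\<delta>\<bar> < min r1 r2" using elim(2) by (simp add: ad mult_ac)
      have Sj: "real (Suc j) * \<bar>?\<delta>\<bar> \<le> 2 * ?\<mu> * \<bar>?\<delta>\<bar>" using j2 by (intro mult_right_mono) auto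
      \<comment> \<open>\<open>e1\<close> is multiplied by n below and therefore needs the increment
        bound; for \<open>e2\<close> and \<open>e3\<close>, remainders of single values, the
        quadratic bound suffices.\<close>
      define e1 where "e1 = ln_expm1_quot (real (Suc j) * ?\<delta>) - ln_expm1_quot (real j * ?\<delta>) - ?\<delta> / 2"
      define e2 where "e2 = ln_expm1_quot (real (Suc j) * ?\<delta>) - real (Suc j) * ?\<delta> / 2"
      define e3 where "e3 = ln_expm1_quot ?\<delta> - ?\<delta> / 2"
      have b1: "\<bar>e1\<bar> \<le> C1 * (2 * ?\<mu> * ?\<delta>\<^sup>2)"
      proof -
        have "\<bar>e1\<bar> \<le> C1 * (real (Suc j) * ?\<delta>\<^sup>2)" unfolding e1_def using j1 Sj small by (intro 1) auto
        also have "\<dots> \<le> C1 * (2 * ?\<mu> * ?\<delta>\<^sup>2)" using j2 1(2) by (intro mult_left_mono mult_right_mono) auto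
        finally show ?thesis .
      qed
      have b2: "\<bar>e2\<bar> \<le> C2 * (2 * ?\<mu> * \<bar>?\<delta>\<bar>)\<^sup>2"
      proof -
        have "\<bar>e2\<bar> \<le> C2 * \<bar>real (Suc j) * ?\<delta>\<bar> ^ 2" unfolding e2_def using Sj small by (intro 2) (auto simp: abs_mult)
        also have "\<dots> \<le> C2 * (2 * ?\<mu> * \<bar>?\<delta>\<bar>)\<^sup>2"
          using Sj 2(2) by (intro mult_left_mono power_mono) (auto simp: abs_mult)
        finally show ?thesis .
      qed
      have d1: "\<bar>?\<delta>\<bar> \<le> 2 * ?\<mu> * \<bar>?\<delta>\<bar>" using mult_right_mono[of 1 "2 * ?\<mu>" "\<bar>?\<delta>\<bar>"] \<mu>1 by simp
      have b3: "\<bar>e3\<bar> \<le> C2 * (2 * ?\<mu> * \<bar>?\<delta>\<bar>)\<^sup>2"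
      proof -
        have "\<bar>e3\<bar> \<le> C2 * \<bar>?\<delta>\<bar> ^ 2" unfolding e3_def using d1 small by (intro 2) auto
        also have "\<dots> \<le> C2 * (2 * ?\<mu> * \<bar>?\<delta>\<bar>)\<^sup>2"
          using d1 2(2) by (intro mult_left_mono power_mono) auto
        finally show ?thesis .
      qed
      have lr: "log_ratio n ?\<delta> j = (real n * ln (1 + 1 / real j) - ln (real j + 1)) +
          (?\<delta> * (real n - real j) / 2 - ?\<delta> + real n * e1 - e2 + e3)"
        unfolding log_ratio_eq[OF j1] e1_def e2_def e3_def by (simp add: field_simps)
      have "?s * log_ratio n ?\<delta> j - (t * sqrt 3 / 2 - (real j - ?\<mu>) / ?s) =
          (?s * (real n * ln (1 + 1 / real j) - ln (real j + 1)) + (real j - ?\<mu>) / ?s) +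
          (?s * ?\<delta> * (real n - ?\<mu>) / 2 - t * sqrt 3 / 2) - ?s * ?\<delta> * (real j - ?\<mu>) / 2 - ?s * ?\<delta> +
          ?s * real n * e1 - ?s * e2 + ?s * e3"
        unfolding lr by (simp add: algebra_simps add_divide_distrib diff_divide_distrib)
      then have "\<bar>?s * log_ratio n ?\<delta> j - (t * sqrt 3 / 2 - (real j - ?\<mu>) / ?s)\<bar> \<le>
          \<bar>?s * (real n * ln (1 + 1 / real j) - ln (real j + 1)) + (real j - ?\<mu>) / ?s\<bar> +
          \<bar>?s * ?\<delta> * (real n - ?\<mu>) / 2 - t * sqrt 3 / 2\<bar> + \<bar>?s * ?\<delta> * (real j - ?\<mu>) / 2\<bar> + \<bar>?s * ?\<delta>\<bar> +
          \<bar>?s * real n * e1\<bar> + \<bar>?s * e2\<bar> + \<bar>?s * e3\<bar>" by linarith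
      also have "\<bar>?s * (real n * ln (1 + 1 / real j) - ln (real j + 1)) + (real j - ?\<mu>) / ?s\<bar> \<le> E1 n"
        unfolding E1_def using log_ratio_zero_approx[of k n j] elim(3) jk by (simp add: k_def)
      also have "\<bar>?s * ?\<delta> * (real n - ?\<mu>) / 2 - t * sqrt 3 / 2\<bar> =
          \<bar>t / 2 * (spread n * (real n - centre n) / sigma_asymp n) - t * sqrt 3 / 2\<bar>"
        by (simp add: \<delta>_def field_simps)
      also have "\<bar>?s * ?\<delta> * (real j - ?\<mu>) / 2\<bar> \<le> k * \<bar>t\<bar> / 2 * (spread n ^ 2 / sigma_asymp n)"
      proof -
        have "\<bar>?s * ?\<delta> * (real j - ?\<mu>) / 2\<bar> = ?s * \<bar>?\<delta>\<bar> / 2 * \<bar>real j - ?\<mu>\<bar>"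
          using s by (simp add: abs_mult)
        also have "\<dots> \<le> ?s * \<bar>?\<delta>\<bar> / 2 * (k * ?s)" using jk s by (intro mult_left_mono) auto
        finally show ?thesis by (simp add: ad power2_eq_square mult_ac)
      qed
      also have "\<bar>?s * ?\<delta>\<bar> = \<bar>t\<bar> * (spread n / sigma_asymp n)" using s by (simp add: abs_mult ad)
      also have "\<bar>?s * real n * e1\<bar> \<le> 2 * C1 * t\<^sup>2 * (spread n * real n * centre n / sigma_asymp n ^ 2)"
      proof -
        have "\<bar>?s * real n * e1\<bar> \<le> ?s * real n * (C1 * (2 * ?\<mu> * ?\<delta>\<^sup>2))"
          unfolding abs_mult using s b1 by (intro mult_mono) auto
        then show ?thesis by (simp add: \<delta>_def power_divide mult_ac)
      qed
      also have "\<bar>?s * e2\<bar> \<le> ?s * (C2 * (2 * ?\<mu> * \<bar>?\<delta>\<bar>)\<^sup>2)"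
        unfolding abs_mult using s b2 by (intro mult_mono) auto
      also have "\<bar>?s * e3\<bar> \<le> ?s * (C2 * (2 * ?\<mu> * \<bar>?\<delta>\<bar>)\<^sup>2)"
        unfolding abs_mult using s b3 by (intro mult_mono) auto
      finally have "\<bar>?s * log_ratio n ?\<delta> j - (t * sqrt 3 / 2 - (real j - ?\<mu>) / ?s)\<bar> \<le> E1 n + E2 n"
        by (simp add: E2_def \<delta>_def power_divide power_mult_distrib mult_ac)
      then show "\<bar>?s * log_ratio n (t / sigma_asymp n) j - (t * sqrt 3 / 2 - (real j - ?\<mu>) / ?s)\<bar> \<le> \<epsilon>"
        using elim(1) by (simp add: \<delta>_def)
    qed
  qed
qed

definition mode :: "nat \<Rightarrow> nat" where "mode n = nat \<lfloor>centre n\<rfloor>"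

lemma dobinski_term_sum_asymptotics:
  "(\<lambda>n. (\<Sum>m. dobinski_term n (exp (t / sigma_asymp n)) m) / (spread n * dobinski_term n (exp (t / sigma_asymp n)) (mode n)))
     \<longlonglongrightarrow> sqrt (2 * pi) * exp ((t * sqrt 3 / 2)\<^sup>2 / 2)"
proof -
  \<comment> \<open>The index is shifted because for n = 0 the term at m = 0 equals 1, by 0^0 = 1,
    whereas the locale requires it to vanish.\<close>
  interpret g: gaussian_ratios "\<lambda>n. dobinski_term (Suc n) (exp (t / sigma_asymp (Suc n)))"
    "\<lambda>n. log_ratio (Suc n) (t / sigma_asymp (Suc n))" "\<lambda>n. centre (Suc n)" "\<lambda>n. spread (Suc n)" "t * sqrt 3 / 2"
  proof
    show "dobinski_term (Suc n) q 0 = 0" for n q by (simp add: dobinski_term_def)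
    show "filterlim (\<lambda>n. spread (Suc n)) at_top sequentially"
      using filterlim_compose[OF spread_at_top filterlim_Suc] by simp
    show "filterlim (\<lambda>n. centre (Suc n) / spread (Suc n)) at_top sequentially"
      using filterlim_compose[OF centre_div_spread filterlim_Suc] by simp
    show "eventually (\<lambda>n. \<forall>j. \<bar>real j - centre (Suc n)\<bar> \<le> K * spread (Suc n) \<longrightarrow>
      \<bar>spread (Suc n) * log_ratio (Suc n) (t / sigma_asymp (Suc n)) j -
        (t * sqrt 3 / 2 - (real j - centre (Suc n)) / spread (Suc n))\<bar> \<le> \<epsilon>) sequentially" if "\<epsilon> > 0" for \<epsilon> K
      using log_ratio_approx[OF that, of K t] by (subst (asm) eventually_sequentially_Suc[symmetric])
  qed (auto intro: dobinski_term_pos dobinski_term_Suc log_ratio_decreasing spread_pos)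
  show ?thesis
    using g.sum_asymptotics unfolding g.m0_def mode_def[symmetric] by (rule LIMSEQ_imp_Suc)
qed

section \<open>The limit law\<close>

lemma ln_dobinski_term:
  assumes "m \<ge> 1"
  shows "ln (dobinski_term n (exp \<delta>) m) = real n * ln (q_int (exp \<delta>) m) - (\<Sum>k=1..m. ln (q_int (exp \<delta>) k)) +
    (real n - real m) * \<delta>"
proof -
  let ?q = "exp \<delta>"
  have p: "q_int ?q k > 0" if "k \<ge> 1" for k using that by (auto intro: q_int_pos)
  have "ln (q_fact ?q m) = (\<Sum>k=1..m. ln (q_int ?q k))"
    unfolding q_fact_def by (rule ln_prod) (simp, metis p less_irrefl atLeastAtMost_iff)
  moreover have "?q powi (int n - int m) = exp ((real n - real m) * \<delta>)"
    by (simp add: exp_power_int)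
  ultimately show ?thesis
    using p[OF assms] q_fact_pos[of ?q m] by (simp add: dobinski_term_def ln_mult ln_div ln_realpow)
qed

lemma ln_dobinski_term_diff:
  assumes "m \<ge> 1"
  shows "ln (dobinski_term n (exp \<delta>) m) - ln (dobinski_term n 1 m) =
    real n * (ln_expm1_quot (real m * \<delta>) - ln_expm1_quot \<delta>) - (\<Sum>k=1..m. ln_expm1_quot (real k * \<delta>) - ln_expm1_quot \<delta>) + (real n - real m) * \<delta>"
proof -
  have lq0: "ln_expm1_quot 0 = 0" by (simp add: ln_expm1_quot_def)
  have 1: "(\<Sum>k=1..m. ln (q_int (exp \<delta>) k)) = (\<Sum>k=1..m. ln (real k)) + (\<Sum>k=1..m. ln_expm1_quot (real k * \<delta>) - ln_expm1_quot \<delta>)" for \<delta>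
    unfolding sum.distrib[symmetric] by (intro sum.cong refl) (simp add: ln_q_int_exp)
  show ?thesis
    using ln_dobinski_term[OF assms, of n \<delta>] ln_dobinski_term[OF assms, of n 0] 1[of \<delta>] 1[of 0]
      ln_q_int_exp[OF assms, of \<delta>] ln_q_int_exp[OF assms, of 0]
    by (simp add: lq0 algebra_simps)
qed

lemma sum_taylor:
  "(\<Sum>k=1..m. (real k * \<delta> / 2 + (real k * \<delta>)\<^sup>2 / 24) - (\<delta> / 2 + \<delta>\<^sup>2 / 24)) =
    \<delta> * (real m * (real m + 1) / 4 - real m / 2) +
    \<delta>\<^sup>2 * (real m * (real m + 1) * (2 * real m + 1) / 6 - real m) / 24"
  by (induction m) (simp_all add: power2_eq_square field_simps)

text \<open>The linear coefficient is the source of \<open>E_asymp\<close>, the quadratic one of the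
  factor exp (t^2 / 8). The remainder consists of n + m differences of cubic errors, each error
  being at most C (m |\<delta>|)^3; hence the factor 2.\<close>

lemma ln_dobinski_term_diff_approx:
  assumes C: "C \<ge> 0" "\<And>x. \<bar>x\<bar> \<le> r \<Longrightarrow> \<bar>ln_expm1_quot x - (x / 2 + x\<^sup>2 / 24)\<bar> \<le> C * \<bar>x\<bar> ^ 3"
    and m: "m \<ge> 1" "real m * \<bar>\<delta>\<bar> \<le> r"
  shows "\<bar>(ln (dobinski_term n (exp \<delta>) m) - ln (dobinski_term n 1 m)) -
      (\<delta> * (real n * real m / 2 + real n / 2 - real m * (real m + 1) / 4 - real m / 2) +
       \<delta>\<^sup>2 * ((real n * ((real m)\<^sup>2 - 1) - real m * (real m + 1) * (2 * real m + 1) / 6 + real m) / 24))\<bar> \<le>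
    2 * C * \<bar>\<delta>\<bar> ^ 3 * (real n * real m ^ 3 + real m ^ 4)"
proof -
  define T where "T x = x / 2 + x\<^sup>2 / 24" for x :: real
  define e where "e k = ln_expm1_quot (real k * \<delta>) - T (real k * \<delta>)" for k
  define B where "B = C * (real m * \<bar>\<delta>\<bar>) ^ 3"
  have e: "\<bar>e k\<bar> \<le> B" if "1 \<le> k" "k \<le> m" for k
  proof -
    have km: "real k * \<bar>\<delta>\<bar> \<le> real m * \<bar>\<delta>\<bar>" using that by (intro mult_right_mono) auto
    have "\<bar>e k\<bar> \<le> C * \<bar>real k * \<delta>\<bar> ^ 3"
      unfolding e_def T_def using km m by (intro C) (simp add: abs_mult)
    also have "\<dots> \<le> B" unfolding B_def using km C(1) by (intro mult_left_mono power_mono) (auto simp: abs_mult)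
    finally show ?thesis .
  qed
  have e1: "\<bar>e 1\<bar> \<le> B" and em: "\<bar>e m\<bar> \<le> B" using e m by auto
  have S: "\<bar>\<Sum>k=1..m. e k - e 1\<bar> \<le> real m * (2 * B)"
  proof -
    have "\<bar>\<Sum>k=1..m. e k - e 1\<bar> \<le> (\<Sum>k=1..m. \<bar>e k - e 1\<bar>)" by (rule sum_abs)
    also have "\<dots> \<le> (\<Sum>k=1..m. 2 * B)"
    proof (rule sum_mono)
      fix k assume "k \<in> {1..m}"
      then show "\<bar>e k - e 1\<bar> \<le> 2 * B" using e[of k] e1 by simp
    qed
    finally show ?thesis by simp
  qed
  have n: "\<bar>real n * (e m - e 1)\<bar> \<le> real n * (2 * B)"
    unfolding abs_mult using em e1 by (intro mult_mono) auto
  have "(ln (dobinski_term n (exp \<delta>) m) - ln (dobinski_term n 1 m)) =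
      real n * (T (real m * \<delta>) - T \<delta>) - (\<Sum>k=1..m. T (real k * \<delta>) - T \<delta>) + (real n - real m) * \<delta> +
      (real n * (e m - e 1) - (\<Sum>k=1..m. e k - e 1))"
  proof -
    have "ln_expm1_quot (real k * \<delta>) - ln_expm1_quot \<delta> = (T (real k * \<delta>) - T \<delta>) + (e k - e 1)" for k
      by (simp add: e_def)
    then show ?thesis unfolding ln_dobinski_term_diff[OF m(1)] by (simp only: sum.distrib distrib_left)
  qed
  moreover have "real n * (T (real m * \<delta>) - T \<delta>) - (\<Sum>k=1..m. T (real k * \<delta>) - T \<delta>) + (real n - real m) * \<delta> =
      \<delta> * (real n * real m / 2 + real n / 2 - real m * (real m + 1) / 4 - real m / 2) +
       \<delta>\<^sup>2 * ((real n * ((real m)\<^sup>2 - 1) - real m * (real m + 1) * (2 * real m + 1) / 6 + real m) / 24)"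
    unfolding T_def sum_taylor by (simp add: power2_eq_square field_simps)
  moreover have "2 * C * \<bar>\<delta>\<bar> ^ 3 * (real n * real m ^ 3 + real m ^ 4) = real n * (2 * B) + real m * (2 * B)"
    by (simp add: B_def power_mult_distrib algebra_simps power_add[symmetric] eval_nat_numeral)
  ultimately show ?thesis using n S by linarith
qed

text \<open>By n = W(n) exp W(n), the centring constant is the leading part n m / 2 - m^2 / 4 of the
  linear coefficient in \<open>ln_dobinski_term_diff_approx\<close>, taken at m =
  \<open>centre n\<close>.\<close>

lemma E_asymp_eq: "E_asymp n = real n * centre n / 2 - centre n ^ 2 / 4"
proof -
  have "E_asymp n = 1 / 4 * (2 * W_seq n - 1) * centre n ^ 2"
    by (simp add: E_asymp_def W_seq_def centre_def exp_double)
  also have "\<dots> = (W_seq n * centre n) * centre n / 2 - centre n ^ 2 / 4"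
    by (simp add: power2_eq_square algebra_simps)
  also have "W_seq n * centre n = real n" unfolding centre_def by (rule n_eq[symmetric])
  finally show ?thesis .
qed

lemma mode_bounds: "centre n - 1 \<le> real (mode n)" "real (mode n) \<le> centre n" "mode n \<ge> 1"
  using centre_ge_1[of n] unfolding mode_def by linarith+

lemma mode_term_asymptotics:
  "(\<lambda>n. exp (- (t / sigma_asymp n) * E_asymp n) *
      (dobinski_term n (exp (t / sigma_asymp n)) (mode n) / dobinski_term n 1 (mode n))) \<longlonglongrightarrow> exp (t\<^sup>2 / 8)"
proof -
  define \<delta> where "\<delta> n = t / sigma_asymp n" for n
  obtain r C where C: "r > 0" "C \<ge> 0" "\<And>x. \<bar>x\<bar> \<le> r \<Longrightarrow> \<bar>ln_expm1_quot x - (x / 2 + x\<^sup>2 / 24)\<bar> \<le> C * \<bar>x\<bar> ^ 3"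
    by (rule ln_expm1_quot_cubic_bound) blast
  define D where "D n = ln (dobinski_term n (exp (\<delta> n)) (mode n)) - ln (dobinski_term n 1 (mode n)) - \<delta> n * E_asymp n" for n
  define E where "E n = \<bar>t\<bar> * (real n / sigma_asymp n + 2 * (centre n / sigma_asymp n)) +
    t\<^sup>2 * (2 * (real n * centre n / sigma_asymp n ^ 2) + real n / sigma_asymp n ^ 2 + 2 * (centre n ^ 3 / sigma_asymp n ^ 2)) +
    2 * C * \<bar>t\<bar> ^ 3 * (real n * centre n ^ 3 / sigma_asymp n ^ 3 + centre n ^ 4 / sigma_asymp n ^ 3)" for n
  have "E \<longlonglongrightarrow> \<bar>t\<bar> * (0 + 2 * 0) + t\<^sup>2 * (2 * 0 + 0 + 2 * 0) + 2 * C * \<bar>t\<bar> ^ 3 * (0 + 0)"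
    unfolding E_def[abs_def] by (intro tendsto_intros centre_tendsto_0 n_tendsto_0 n_centre_tendsto_0 n_sigma_sq_tendsto_0 centre_cube_tendsto_0 n_centre_cube_tendsto_0 centre_fourth_tendsto_0)
  then have E0: "E \<longlonglongrightarrow> 0" by simp
  have "(\<lambda>n. \<bar>t\<bar> * (centre n / sigma_asymp n)) \<longlonglongrightarrow> \<bar>t\<bar> * 0"
    by (intro tendsto_intros centre_tendsto_0)
  then have ev: "eventually (\<lambda>n. \<bar>t\<bar> * (centre n / sigma_asymp n) < r) sequentially"
    using C(1) by (intro order_tendstoD) auto
  have "eventually (\<lambda>n. norm (D n - t\<^sup>2 / 24 * (real n * centre n ^ 2 / sigma_asymp n ^ 2)) \<le> E n) sequentially"
    using ev
  proof eventually_elim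
    case (elim n)
    let ?\<delta> = "\<delta> n" and ?\<mu> = "centre n" and ?m = "real (mode n)" and ?N = "real n"
    have \<sigma>: "sigma_asymp n > 0" by (rule sigma_pos)
    have ad: "\<bar>?\<delta>\<bar> = \<bar>t\<bar> / sigma_asymp n" using \<sigma> by (simp add: \<delta>_def abs_divide)
    have \<mu>: "?\<mu> \<ge> 1" by (rule centre_ge_1)
    have m: "?\<mu> - 1 \<le> ?m" "?m \<le> ?\<mu>" "?m \<ge> 1" using mode_bounds[of n] by auto
    have "?m * \<bar>?\<delta>\<bar> \<le> ?\<mu> * \<bar>?\<delta>\<bar>" using m by (intro mult_right_mono) auto
    then have small: "?m * \<bar>?\<delta>\<bar> \<le> r" using elim by (simp add: ad mult_ac)
    \<comment> \<open>\<open>P\<close> and \<open>R\<close> are what remains of the linear and the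
      quadratic coefficient after \<open>E_asymp n\<close> and n \<mu>^2 / 24 are removed. Rounding
      the centre to the mode is harmless: it leaves \<open>P\<close> of order n + \<mu>, which is
      negligible against \<open>sigma_asymp n\<close>.\<close>
    define P where "P = ?N * ?m / 2 + ?N / 2 - ?m * (?m + 1) / 4 - ?m / 2 - (?N * ?\<mu> / 2 - ?\<mu> ^ 2 / 4)"
    define R where "R = (?N * (?m\<^sup>2 - 1) - ?m * (?m + 1) * (2 * ?m + 1) / 6 + ?m) / 24 - ?N * ?\<mu>\<^sup>2 / 24"
    have sq: "0 \<le> ?\<mu>\<^sup>2 - ?m\<^sup>2" "?\<mu>\<^sup>2 - ?m\<^sup>2 \<le> 2 * ?\<mu>"
    proof -
      have eq: "?\<mu>\<^sup>2 - ?m\<^sup>2 = (?\<mu> - ?m) * (?\<mu> + ?m)" by (simp add: power2_eq_square algebra_simps)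
      show "0 \<le> ?\<mu>\<^sup>2 - ?m\<^sup>2" unfolding eq using m \<mu> by (intro mult_nonneg_nonneg) auto
      have "(?\<mu> - ?m) * (?\<mu> + ?m) \<le> 1 * (2 * ?\<mu>)" using m \<mu> by (intro mult_mono) auto
      then show "?\<mu>\<^sup>2 - ?m\<^sup>2 \<le> 2 * ?\<mu>" unfolding eq by simp
    qed
    have P: "\<bar>P\<bar> \<le> ?N + 2 * ?\<mu>"
    proof -
      have "P = ?N * (1 - (?\<mu> - ?m)) / 2 + (?\<mu>\<^sup>2 - ?m\<^sup>2) / 4 - 3 * ?m / 4"
        by (simp add: P_def power2_eq_square field_simps)
      moreover have "0 \<le> ?N * (1 - (?\<mu> - ?m))" using m by simp
      moreover have "?N * (1 - (?\<mu> - ?m)) \<le> ?N * 1" by (rule mult_left_mono) (use m in auto)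
      moreover have "\<bar>A / 2 + B / 4 - 3 * x / 4\<bar> \<le> N + 2 * u"
        if "0 \<le> A" "A \<le> N * 1" "0 \<le> B" "B \<le> 2 * u" "1 \<le> x" "x \<le> u" for A B x N u :: real
        using that by (simp add: abs_le_iff)
      ultimately show ?thesis using sq m by presburger
    qed
    have R: "\<bar>R\<bar> \<le> 2 * (?N * ?\<mu>) + ?N + 2 * ?\<mu> ^ 3"
    proof -
      have eq: "R = (- (?N * (?\<mu>\<^sup>2 - ?m\<^sup>2)) - ?N - ?m * (?m + 1) * (2 * ?m + 1) / 6 + ?m) / 24"
        by (simp add: R_def field_simps)
      have A: "0 \<le> ?N * (?\<mu>\<^sup>2 - ?m\<^sup>2)" using sq by simp
      have "?N * (?\<mu>\<^sup>2 - ?m\<^sup>2) \<le> ?N * (2 * ?\<mu>)" using sq by (intro mult_left_mono) auto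
      then have A': "?N * (?\<mu>\<^sup>2 - ?m\<^sup>2) \<le> 2 * (?N * ?\<mu>)" by (simp only: mult.left_commute)
      have B: "0 \<le> ?m * (?m + 1) * (2 * ?m + 1)" using m by simp
      have "?m * (?m + 1) * (2 * ?m + 1) \<le> ?\<mu> * (2 * ?\<mu>) * (3 * ?\<mu>)"
        using m \<mu> by (intro mult_mono mult_nonneg_nonneg) auto
      then have B': "?m * (?m + 1) * (2 * ?m + 1) \<le> 6 * ?\<mu> ^ 3" by (simp add: eval_nat_numeral)
      have c: "?m \<le> ?\<mu> ^ 3" using m power_increasing[of 1 3 ?\<mu>] \<mu> by simp
      have "\<bar>(- A - N - B / 6 + x) / 24\<bar> \<le> 2 * c + N + 2 * u"
        if "0 \<le> A" "A \<le> 2 * c" "0 \<le> B" "B \<le> 6 * u" "x \<le> u" "1 \<le> x" "0 \<le> N" for A B x N u c :: real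
        using that by (simp add: abs_le_iff)
      from this[OF A A' B B' c m(3) of_nat_0_le_iff] show ?thesis unfolding eq .
    qed
    have "\<bar>(ln (dobinski_term n (exp ?\<delta>) (mode n)) - ln (dobinski_term n 1 (mode n))) -
        (?\<delta> * (?N * ?m / 2 + ?N / 2 - ?m * (?m + 1) / 4 - ?m / 2) +
         ?\<delta>\<^sup>2 * ((?N * (?m\<^sup>2 - 1) - ?m * (?m + 1) * (2 * ?m + 1) / 6 + ?m) / 24))\<bar> \<le>
        2 * C * \<bar>?\<delta>\<bar> ^ 3 * (?N * ?m ^ 3 + ?m ^ 4)"
      by (rule ln_dobinski_term_diff_approx[OF C(2,3) _ small]) (use mode_bounds in auto)
    also have "(ln (dobinski_term n (exp ?\<delta>) (mode n)) - ln (dobinski_term n 1 (mode n))) -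
        (?\<delta> * (?N * ?m / 2 + ?N / 2 - ?m * (?m + 1) / 4 - ?m / 2) +
         ?\<delta>\<^sup>2 * ((?N * (?m\<^sup>2 - 1) - ?m * (?m + 1) * (2 * ?m + 1) / 6 + ?m) / 24)) =
        D n - t\<^sup>2 / 24 * (?N * ?\<mu> ^ 2 / sigma_asymp n ^ 2) - ?\<delta> * P - ?\<delta>\<^sup>2 * R"
    proof -
      have "t\<^sup>2 / 24 * (?N * ?\<mu> ^ 2 / sigma_asymp n ^ 2) = ?\<delta>\<^sup>2 * (?N * ?\<mu>\<^sup>2 / 24)"
        by (simp add: \<delta>_def power_divide)
      then show ?thesis unfolding D_def P_def R_def E_asymp_eq by (simp only: algebra_simps)
    qed
    also have "2 * C * \<bar>?\<delta>\<bar> ^ 3 * (?N * ?m ^ 3 + ?m ^ 4) \<le> 2 * C * \<bar>?\<delta>\<bar> ^ 3 * (?N * ?\<mu> ^ 3 + ?\<mu> ^ 4)"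
      using m C(2) by (intro mult_left_mono add_mono power_mono) auto
    finally have "\<bar>D n - t\<^sup>2 / 24 * (?N * ?\<mu> ^ 2 / sigma_asymp n ^ 2)\<bar> \<le>
        \<bar>?\<delta> * P\<bar> + \<bar>?\<delta>\<^sup>2 * R\<bar> + 2 * C * \<bar>?\<delta>\<bar> ^ 3 * (?N * ?\<mu> ^ 3 + ?\<mu> ^ 4)" by linarith
    also have "\<bar>?\<delta> * P\<bar> \<le> \<bar>?\<delta>\<bar> * (?N + 2 * ?\<mu>)"
      unfolding abs_mult using P by (intro mult_left_mono) auto
    also have "\<bar>?\<delta>\<^sup>2 * R\<bar> \<le> ?\<delta>\<^sup>2 * (2 * (?N * ?\<mu>) + ?N + 2 * ?\<mu> ^ 3)"
      unfolding abs_mult using R by (simp add: mult_left_mono)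
    also have "\<bar>?\<delta>\<bar> * (?N + 2 * ?\<mu>) + ?\<delta>\<^sup>2 * (2 * (?N * ?\<mu>) + ?N + 2 * ?\<mu> ^ 3) +
        2 * C * \<bar>?\<delta>\<bar> ^ 3 * (?N * ?\<mu> ^ 3 + ?\<mu> ^ 4) = E n"
      unfolding E_def ad by (simp add: \<delta>_def power_divide add_divide_distrib distrib_left mult.assoc)
    finally show ?case by simp
  qed
  then have "(\<lambda>n. D n - t\<^sup>2 / 24 * (real n * centre n ^ 2 / sigma_asymp n ^ 2)) \<longlonglongrightarrow> 0"
    using E0 by (rule Lim_null_comparison)
  moreover have "(\<lambda>n. t\<^sup>2 / 24 * (real n * centre n ^ 2 / sigma_asymp n ^ 2)) \<longlonglongrightarrow> t\<^sup>2 / 24 * 3"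
    by (intro tendsto_intros n_centre_sq_tendsto)
  ultimately have "(\<lambda>n. (D n - t\<^sup>2 / 24 * (real n * centre n ^ 2 / sigma_asymp n ^ 2)) +
      t\<^sup>2 / 24 * (real n * centre n ^ 2 / sigma_asymp n ^ 2)) \<longlonglongrightarrow> 0 + t\<^sup>2 / 24 * 3"
    by (rule tendsto_add)
  then have "D \<longlonglongrightarrow> t\<^sup>2 / 8" by simp
  then have "(\<lambda>n. exp (D n)) \<longlonglongrightarrow> exp (t\<^sup>2 / 8)" by (rule tendsto_exp)
  moreover have "exp (D n) = exp (- (t / sigma_asymp n) * E_asymp n) *
      (dobinski_term n (exp (t / sigma_asymp n)) (mode n) / dobinski_term n 1 (mode n))" for n
    using dobinski_term_pos[of "exp (\<delta> n)" "mode n" n] dobinski_term_pos[of 1 "mode n" n] mode_bounds(3)[of n]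
    unfolding D_def by (simp add: exp_diff exp_minus exp_add \<delta>_def field_simps)
  ultimately show ?thesis by simp
qed

section \<open>The normalising constant and its continuity at q = 1\<close>

definition real_q_exp :: "real \<Rightarrow> real" where
  "real_q_exp r = (\<Sum>m. (1 / r) ^ m / q_fact r m)"

lemma of_real_q_int: "q_int (complex_of_real r) m = of_real (q_int r m)"
  by (simp add: q_int_def)

lemma of_real_q_fact: "q_fact (complex_of_real r) m = of_real (q_fact r m)"
  by (simp add: q_fact_def of_real_q_int)

lemma summable_real_q_exp:
  fixes r :: real
  assumes "r > 1 / 2"
  shows "summable (\<lambda>m. (1 / r) ^ m / q_fact r m)"
proof -
  have "summable (\<lambda>m. (1 / complex_of_real r) ^ m / q_fact (complex_of_real r) m)"
    using q_exp_admissible_real[OF assms] by (simp add: q_exp_admissible_def)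
  then have "summable (\<lambda>m. Re ((1 / complex_of_real r) ^ m / q_fact (complex_of_real r) m))"
    by (rule summable_Re)
  moreover have "(1 / complex_of_real r) ^ m / q_fact (complex_of_real r) m = of_real ((1 / r) ^ m / q_fact r m)" for m
    by (simp add: of_real_q_fact)
  ultimately show ?thesis by simp
qed

lemma sum_queries_real:
  fixes r :: real
  assumes r: "r > 1 / 2" and S: "finite S" "card S = n" and A: "chordal_ac_algorithm S A"
  shows "(\<Sum>\<pi> | partition_on S \<pi>. r ^ num_queries A \<pi>) = 1 / real_q_exp r * (\<Sum>m. dobinski_term n r m)"
proof -
  let ?q = "complex_of_real r"
  have adm: "q_exp_admissible ?q" by (rule q_exp_admissible_real[OF r])
  have eq: "q_int ?q m ^ n / q_fact ?q m * ?q powi (int n - int m) = of_real (dobinski_term n r m)" for m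
    by (simp add: dobinski_term_def of_real_q_int of_real_q_fact)
  have "summable (\<lambda>m. complex_of_real (dobinski_term n r m))"
    using sum_queries_dobinski(1)[OF adm S(1) A] unfolding S(2) eq .
  then have sm: "summable (\<lambda>m. dobinski_term n r m)" using summable_Re by fastforce
  have qe: "q_exp ?q (1 / ?q) = of_real (real_q_exp r)"
    unfolding q_exp_def real_q_exp_def using suminf_of_real[OF summable_real_q_exp[OF r], where 'a = complex]
    by (simp add: of_real_q_fact)
  have "complex_of_real (\<Sum>\<pi> | partition_on S \<pi>. r ^ num_queries A \<pi>) =
      of_real (1 / real_q_exp r * (\<Sum>m. dobinski_term n r m))"
    using sum_queries_dobinski(2)[OF adm S(1) A] suminf_of_real[OF sm, where 'a = complex]
    unfolding S(2) eq qe by simp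
  then show ?thesis by (simp only: of_real_eq_iff)
qed

lemma real_q_exp_pos:
  assumes "r > 1 / 2"
  shows "real_q_exp r > 0"
  unfolding real_q_exp_def using assms
  by (intro suminf_pos summable_real_q_exp divide_pos_pos zero_less_power q_fact_pos) auto

text \<open>Tannery's theorem. Every term decreases in q, so the series at q = 3/4 eventually
  dominates; any number strictly between 1/2 and 1 could replace 3/4.\<close>

lemma real_q_exp_tendsto:
  assumes q: "q \<longlonglongrightarrow> 1"
  shows "(\<lambda>n. real_q_exp (q n)) \<longlonglongrightarrow> real_q_exp 1"
proof -
  have lim: "(\<lambda>n. (1 / q n) ^ k / q_fact (q n) k) \<longlonglongrightarrow> (1 / 1) ^ k / q_fact 1 k" for k
  proof -
    have "q_fact (1 :: real) k \<noteq> 0" using q_fact_pos[of "1::real" k] by simp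
    then show ?thesis
      unfolding q_fact_def q_int_def by (intro tendsto_intros q) auto
  qed
  have "eventually (\<lambda>n. q n > 3 / 4) sequentially" using q by (rule order_tendstoD) simp
  then have bound: "eventually (\<lambda>n. \<forall>k. norm ((1 / q n) ^ k / q_fact (q n) k) \<le> (1 / (3 / 4)) ^ k / q_fact (3 / 4) k) sequentially"
  proof eventually_elim
    case (elim n)
    show ?case
    proof
      fix k
      have int: "q_int (3 / 4) i \<le> q_int (q n) i" for i
        unfolding q_int_def using elim by (intro sum_mono power_mono) auto
      have "q_fact (3 / 4) k \<le> q_fact (q n) k"
        unfolding q_fact_def using int by (intro prod_mono) (simp add: q_int_def sum_nonneg)
      moreover have "(1 / q n) ^ k \<le> (1 / (3 / 4)) ^ k"
        using elim by (intro power_mono divide_left_mono) auto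
      moreover have "0 < q_fact (3 / 4 :: real) k" "0 < q_fact (q n) k" using elim by (auto intro: q_fact_pos)
      ultimately show "norm ((1 / q n) ^ k / q_fact (q n) k) \<le> (1 / (3 / 4)) ^ k / q_fact (3 / 4) k"
        using elim by (simp add: abs_of_pos frac_le)
    qed
  qed
  have "eventually (\<lambda>x. True \<and> (\<forall>k. norm ((1 / q (snd x)) ^ k / q_fact (q (snd x)) k) \<le>
      (1 / (3 / 4)) ^ k / q_fact (3 / 4) k)) (at_top \<times>\<^sub>F sequentially)"
    by (rule eventually_prodI[OF always_eventually bound]) simp
  then have "eventually (\<lambda>(k, n). norm ((1 / q n) ^ k / q_fact (q n) k) \<le> (1 / (3 / 4)) ^ k / q_fact (3 / 4) k)
      (at_top \<times>\<^sub>F sequentially)"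
    by (rule eventually_mono) auto
  from tannerys_theorem[OF lim this] show ?thesis
    unfolding real_q_exp_def using summable_real_q_exp[of "3 / 4"] by simp
qed

text \<open>Three factors: the quotient of the normalising constants tends to 1, the quotient of the
  rescaled sums to exp (3 t^2 / 8), and the centred quotient of the terms at the mode to exp (t^2 /
  8). Since both sums are scaled with the same spread and mode, the spread and sqrt (2 pi)
  cancel.\<close>

lemma mgf_tendsto:
  fixes S :: "nat \<Rightarrow> 'a set"
  assumes SA: "\<And>n. finite (S n) \<and> card (S n) = n \<and> chordal_ac_algorithm (S n) (A n)"
  shows "(\<lambda>n. measure_pmf.expectation (random_partition (S n))
      (\<lambda>\<pi>. exp (t * ((real (num_queries (A n) \<pi>) - E_asymp n) / sigma_asymp n)))) \<longlonglongrightarrow> exp (t\<^sup>2 / 2)"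
proof -
  define \<delta> where "\<delta> n = t / sigma_asymp n" for n
  define a where "a n = (\<Sum>m. dobinski_term n (exp (\<delta> n)) m) / (spread n * dobinski_term n (exp (\<delta> n)) (mode n))" for n
  define b where "b n = (\<Sum>m. dobinski_term n 1 m) / (spread n * dobinski_term n 1 (mode n))" for n
  define c where "c n = exp (- \<delta> n * E_asymp n) * (dobinski_term n (exp (\<delta> n)) (mode n) / dobinski_term n 1 (mode n))" for n
  have \<delta>: "\<delta> \<longlonglongrightarrow> 0" unfolding \<delta>_def
    by (intro tendsto_divide_0[OF tendsto_const] filterlim_at_top_imp_at_infinity sigma_at_top)
  have q1: "(\<lambda>n. exp (\<delta> n)) \<longlonglongrightarrow> 1" using tendsto_exp[OF \<delta>] by simp
  have "(\<lambda>n. real_q_exp 1 / real_q_exp (exp (\<delta> n)) * (a n / b n) * c n) \<longlonglongrightarrow>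
      real_q_exp 1 / real_q_exp 1 * (sqrt (2 * pi) * exp ((t * sqrt 3 / 2)\<^sup>2 / 2) / sqrt (2 * pi)) * exp (t\<^sup>2 / 8)"
  proof (intro tendsto_intros real_q_exp_tendsto q1)
    show "a \<longlonglongrightarrow> sqrt (2 * pi) * exp ((t * sqrt 3 / 2)\<^sup>2 / 2)"
      unfolding a_def \<delta>_def by (rule dobinski_term_sum_asymptotics)
    show "b \<longlonglongrightarrow> sqrt (2 * pi)"
      unfolding b_def using dobinski_term_sum_asymptotics[of 0] by simp
    show "c \<longlonglongrightarrow> exp (t\<^sup>2 / 8)"
      unfolding c_def \<delta>_def by (rule mode_term_asymptotics)
    show "real_q_exp 1 \<noteq> 0" using real_q_exp_pos[of 1] by simp
  qed auto
  also have "real_q_exp 1 / real_q_exp 1 * (sqrt (2 * pi) * exp ((t * sqrt 3 / 2)\<^sup>2 / 2) / sqrt (2 * pi)) * exp (t\<^sup>2 / 8) =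
      exp (t\<^sup>2 / 2)"
    using real_q_exp_pos[of 1] by (simp add: exp_add[symmetric] power_divide power_mult_distrib)
  finally have lim: "(\<lambda>n. real_q_exp 1 / real_q_exp (exp (\<delta> n)) * (a n / b n) * c n) \<longlonglongrightarrow> exp (t\<^sup>2 / 2)" .
  have "eventually (\<lambda>n. exp (\<delta> n) > 1 / 2) sequentially" using q1 by (rule order_tendstoD) simp
  then have "eventually (\<lambda>n. real_q_exp 1 / real_q_exp (exp (\<delta> n)) * (a n / b n) * c n =
      measure_pmf.expectation (random_partition (S n))
        (\<lambda>\<pi>. exp (t * ((real (num_queries (A n) \<pi>) - E_asymp n) / sigma_asymp n)))) sequentially"
  proof eventually_elim
    case (elim n)
    have S: "finite (S n)" "card (S n) = n" and A: "chordal_ac_algorithm (S n) (A n)" using SA by auto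
    let ?q = "exp (\<delta> n)" and ?m = "mode n"
    have d: "dobinski_term n ?q ?m > 0" "dobinski_term n 1 ?m > 0" using mode_bounds(3)[of n] by (auto intro: dobinski_term_pos)
    have e: "real_q_exp 1 > 0" "real_q_exp ?q > 0" using elim by (auto intro: real_q_exp_pos)
    \<comment> \<open>Dobinski's formula: at q = 1 every partition has weight 1, so the same
      identity evaluates the Bell number, and no separate asymptotics for it are required.\<close>
    have bell: "real (bell n) = 1 / real_q_exp 1 * (\<Sum>m. dobinski_term n 1 m)"
      using sum_queries_real[OF _ S A, of 1] card_partitions_eq_bell[OF S(1)] S(2) by simp
    have "exp (t * ((real (num_queries (A n) \<pi>) - E_asymp n) / sigma_asymp n)) =
        exp (- \<delta> n * E_asymp n) * ?q ^ num_queries (A n) \<pi>" for \<pi>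
      by (simp add: \<delta>_def exp_of_nat_mult[symmetric] exp_add[symmetric] diff_divide_distrib algebra_simps)
    then have "measure_pmf.expectation (random_partition (S n))
        (\<lambda>\<pi>. exp (t * ((real (num_queries (A n) \<pi>) - E_asymp n) / sigma_asymp n))) =
        exp (- \<delta> n * E_asymp n) * (1 / real (bell n) * (1 / real_q_exp ?q * (\<Sum>m. dobinski_term n ?q m)))"
      using expectation_random_partition[OF S(1), of "\<lambda>\<pi>. ?q ^ num_queries (A n) \<pi>"]
        sum_queries_real[OF elim S A] S(2) by simp
    also have "\<dots> = real_q_exp 1 / real_q_exp ?q * (a n / b n) * c n"
      unfolding bell a_def b_def c_def using d e spread_pos[of n] by (simp add: divide_simps)
    finally show ?case by simp
  qed
  then show ?thesis by (rule Lim_transform_eventually[OF lim])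
qed

theorem theorem3:
  shows
    "(\<forall>(S :: 'a set) A n (q :: complex).
        finite S \<and> card S = n \<and> chordal_ac_algorithm S A \<longrightarrow>
        (q \<noteq> 0 \<and> q \<noteq> 1 \<longrightarrow>
           measure_pmf.expectation (random_partition S) (\<lambda>\<pi>. q ^ num_queries A \<pi>) =
             1 / of_nat (bell n) * (q / (1 - q)) ^ n *
             (\<Sum>k=0..n. of_nat (n choose k) * (-1) ^ k * q_pochhammer ((1 - q) / q) q k)) \<and>
        (q_exp_admissible q \<longrightarrow>
           summable (\<lambda>m. q_int q m ^ n / q_fact q m * q powi (int n - int m)) \<and>
           measure_pmf.expectation (random_partition S) (\<lambda>\<pi>. q ^ num_queries A \<pi>) =
             1 / of_nat (bell n) * (1 / q_exp q (1 / q)) *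
             (\<Sum>m. q_int q m ^ n / q_fact q m * q powi (int n - int m)))) \<and>
     (\<forall>(S :: nat \<Rightarrow> 'a set) A.
        (\<forall>n. finite (S n) \<and> card (S n) = n \<and> chordal_ac_algorithm (S n) (A n)) \<longrightarrow>
        weak_conv_m
          (\<lambda>n. distr (measure_pmf (random_partition (S n))) borel
                 (\<lambda>\<pi>. (real (num_queries (A n) \<pi>) - E_asymp n) / sigma_asymp n))
          std_normal_distribution)"
proof (intro conjI allI impI)
  fix S :: "'a set" and A n and q :: complex
  assume SA: "finite S \<and> card S = n \<and> chordal_ac_algorithm S A"
  note E = expectation_random_partition[of S "\<lambda>\<pi>. q ^ num_queries A \<pi>"]
  show "measure_pmf.expectation (random_partition S) (\<lambda>\<pi>. q ^ num_queries A \<pi>) =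
      1 / of_nat (bell n) * (q / (1 - q)) ^ n *
      (\<Sum>k=0..n. of_nat (n choose k) * (-1) ^ k * q_pochhammer ((1 - q) / q) q k)" if "q \<noteq> 0 \<and> q \<noteq> 1"
    using that SA E sum_queries_pochhammer[of q S A] by (simp add: mult.assoc)
  assume adm: "q_exp_admissible q"
  show "summable (\<lambda>m. q_int q m ^ n / q_fact q m * q powi (int n - int m))"
    using SA sum_queries_dobinski(1)[OF adm, of S A] by auto
  show "measure_pmf.expectation (random_partition S) (\<lambda>\<pi>. q ^ num_queries A \<pi>) =
      1 / of_nat (bell n) * (1 / q_exp q (1 / q)) *
      (\<Sum>m. q_int q m ^ n / q_fact q m * q powi (int n - int m))"
    using SA E sum_queries_dobinski(2)[OF adm, of S A] by auto
next
  fix S :: "nat \<Rightarrow> 'a set" and A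
  assume SA: "\<forall>n. finite (S n) \<and> card (S n) = n \<and> chordal_ac_algorithm (S n) (A n)"
  show "weak_conv_m
      (\<lambda>n. distr (measure_pmf (random_partition (S n))) borel
             (\<lambda>\<pi>. (real (num_queries (A n) \<pi>) - E_asymp n) / sigma_asymp n))
      std_normal_distribution"
  proof (rule mgf_convergence_imp_weak_conv)
    show "finite (set_pmf (random_partition (S n)))" for n
      using SA partitions_nonempty[of "S n"] by (simp add: random_partition_def)
    show "(\<lambda>n. measure_pmf.expectation (random_partition (S n))
        (\<lambda>\<pi>. exp (t * ((real (num_queries (A n) \<pi>) - E_asymp n) / sigma_asymp n)))) \<longlonglongrightarrow> exp (t\<^sup>2 / 2)" for t
      using SA by (intro mgf_tendsto) blast
  qed
qed

end
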